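(* Let $F_1:\mathbb{R}^n\times\mathbb{R}^{k_1}\to\mathbb{R}$ and $F_2:\mathbb{R}^n\times\mathbb{R}^{k_2}\to\mathbb{R}$ be two generating functions such that the generating functions $F_{(\mathbf{T}1)\underline{+}(\mathbf{T}2)}$, $F_{\mathbf{T}(1\underline{\square}2)}$, $F_{(\mathbf{T}1)\underline{\square}(\mathbf{T}2)}$ and $F_{\mathbf{T}(1\underline{+}2)}$ are all almost-simple generating functions. Then their selectors, as functions on $\mathbb{R}^n$, satisfy (i) $s\big(F_{(\mathbf{T}1)\underline{+}(\mathbf{T}2)}\big)=s\big(F_{\mathbf{T}(1\underline{\square}2)}\big)$, (ii) $s\big(F_{(\mathbf{T}1)\underline{\square}(\mathbf{T}2)}\big)=s\big(F_{\mathbf{T}(1\underline{+}2)}\big)$.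
   Context: All functions are smooth and finite-valued. A generating function is a smooth function $F(q,w)$ on a product $\mathbb{R}^n\times\mathbb{R}^k$, where $q\in\mathbb{R}^n$ is the base variable and $w\in\mathbb{R}^k$ is the additional (fibre) variable. Products of vectors such as $qv$ denote Euclidean scalar products. The four generating functions are, with base variable $q\in\mathbb{R}^n$ and all other variables being fibre variables ($V,v,v_1,v_2\in\mathbb{R}^n$, $w_1\in\mathbb{R}^{k_1}$, $w_2\in\mathbb{R}^{k_2}$): $$F_{(\mathbf{T}1)\underline{+}(\mathbf{T}2)}(q,v_1,v_2,w_1,w_2)=q(v_1+v_2)-\big(F_1(v_1,w_1)+F_2(v_2,w_2)\big),$$ $$F_{\mathbf{T}(1\underline{\square}2)}(q,V,v,w_1,w_2)=qV-\big(F_1(v,w_1)+F_2(V-v,w_2)\big),$$ $$F_{(\mathbf{T}1)\underline{\square}(\mathbf{T}2)}(q,V,v_1,v_2,w_1,w_2)=V(v_1-v_2)+qv_2-\big(F_1(v_1,w_1)+F_2(v_2,w_2)\big),$$ $$F_{\mathbf{T}(1\underline{+}2)}(q,v,w_1,w_2)=qv-\big(F_1(v,w_1)+F_2(v,w_2)\big).$$ A function $g$ on $\mathbb{R}^k$ is simple if $\nabla g$ is a diffeomorphism of $\mathbb{R}^k$. A function $f$ on $\mathbb{R}^k$ is almost-simple if $f=g+h$ with $g$ simple and $\|\nabla h\|$ bounded on $\mathbb{R}^k$. A generating function $F$ on $\mathbb{R}^n\times\mathbb{R}^k$ is almost-simple if $F=G+H$ where for every $q\in\mathbb{R}^n$ the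 function $G(q,\cdot)$ is simple and $\|\nabla_wH(q,w)\|\le B(q)$ for all $w$, with $B$ a continuous bounded function on $\mathbb{R}^n$; then each $F(q,\cdot)$ is almost-simple. Min-max: let $f$ be a function on $\mathbb{R}^k$ with proper gradient map. Its critical values lie in some $]-C,C[$; put $f^\lambda=f^{-1}(]-\infty,\lambda])$, and denote by $f^{+\infty}$ (resp. $f^{-\infty}$) the sublevel set $f^{\lambda}$ (resp. $f^{-\lambda}$) for any $\lambda>C$. If there is $\iota\in\{0,\dots,k\}$ such that $H_*(f^{+\infty},f^{-\infty};\mathbb{Q})$ is $\mathbb{Q}$ in degree $\iota$ and $0$ in all other degrees, the min-max of $f$ is $$s(f)=\inf\{\lambda\mid H_\iota(f^\lambda,f^{-\infty};\mathbb{Q})\to H_\iota(f^{+\infty},f^{-\infty};\mathbb{Q})\text{ is surjective}\},$$ the map being induced by inclusion. Every almost-simple function has a min-max. The selector of an almost-simple generating function $F$ is the function $s(F):\mathbb{R}^n\to\mathbb{R}$, $s(F)(q)=s(F(q,\cdot))$. *)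

theory Defs
  imports "HOL-Analysis.Analysis" "HOL-Homology.Homology"
begin

section \<open>Finite-dimensional inner product spaces, dimension zero included\<close>

text \<open>
  The fibre dimensions \<open>k\<close>, \<open>k\<^sub>1\<close>, \<open>k\<^sub>2\<close> may be zero (generating functions without fibre variables),
  whereas every type of class \<^class>\<open>euclidean_space\<close> has positive dimension. The class below drops
  that restriction; a type in it plays the role of \<open>\<real>\<^sup>k\<close> with its Euclidean scalar product, where
  \<open>k = dim UNIV\<close>.
\<close>

class finite_dim_inner = real_inner +
  assumes finite_dim_ex:
    "\<exists>B::'a set. finite B \<and> (\<forall>x. \<exists>c. x = (\<Sum>b\<in>B. scaleR (c b) b))"

lemma finite_dim: "\<exists>B::'a::finite_dim_inner set. finite B \<and> span B = UNIV"
proof -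
  obtain B :: "'a set" where B: "finite B" "\<And>x. \<exists>c. x = (\<Sum>b\<in>B. scaleR (c b) b)"
    using finite_dim_ex by blast
  have "x \<in> span B" for x
    using B(2)[of x] unfolding span_finite[OF B(1)] by (elim exE) (rule range_eqI)
  with B(1) show ?thesis by blast
qed

subclass (in euclidean_space) finite_dim_inner
proof
  show "\<exists>B::'a set. finite B \<and> (\<forall>x. \<exists>c. x = (\<Sum>b\<in>B. scaleR (c b) b))"
  proof (intro exI[of _ Basis] conjI allI)
    fix x :: 'a
    show "\<exists>c. x = (\<Sum>b\<in>Basis. scaleR (c b) b)"
      by (rule exI[of _ "inner x"]) (simp add: euclidean_representation)
  qed simp
qed

instance prod :: (finite_dim_inner, finite_dim_inner) finite_dim_inner
proof
  obtain A :: "'a set" where A: "finite A" "span A = UNIV" using finite_dim by blast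
  obtain B :: "'b set" where B: "finite B" "span B = UNIV" using finite_dim by blast
  define i where "i = (\<lambda>a::'a. (a, 0::'b))"
  define j where "j = (\<lambda>b::'b. (0::'a, b))"
  let ?C = "i ` A \<union> j ` B"
  have lin: "linear i" "linear j"
    by (auto intro!: linearI simp: i_def j_def)
  have x_in: "x \<in> span ?C" for x
  proof -
    have "i (fst x) \<in> span (i ` A)" "j (snd x) \<in> span (j ` B)"
      using A(2) B(2) lin by (simp_all add: linear_span_image)
    moreover have "span (i ` A) \<subseteq> span ?C" "span (j ` B) \<subseteq> span ?C"
      by (simp_all add: span_mono)
    ultimately have "i (fst x) + j (snd x) \<in> span ?C"
      by (blast intro: span_add)
    then show ?thesis by (simp add: i_def j_def)
  qed
  have fin: "finite ?C" using A(1) B(1) by simp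
  have "\<exists>c. x = (\<Sum>b\<in>?C. scaleR (c b) b)" for x
    using x_in[of x] unfolding span_finite[OF fin] by (rule rangeE) (rule exI)
  with fin show "\<exists>B::('a \<times> 'b) set. finite B \<and> (\<forall>x. \<exists>c. x = (\<Sum>b\<in>B. scaleR (c b) b))"
    by (intro exI[of _ ?C] conjI allI)
qed

text \<open>The type \<^typ>\<open>unit\<close> is made an instance, so that \<open>\<real>\<^sup>0\<close> is available as a fibre.\<close>

instantiation unit :: real_inner
begin

definition zero_unit :: unit where "zero_unit = ()"
definition plus_unit :: "unit \<Rightarrow> unit \<Rightarrow> unit" where "plus_unit x y = ()"
definition minus_unit :: "unit \<Rightarrow> unit \<Rightarrow> unit" where "minus_unit x y = ()"
definition uminus_unit :: "unit \<Rightarrow> unit" where "uminus_unit x = ()"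
definition scaleR_unit :: "real \<Rightarrow> unit \<Rightarrow> unit" where "scaleR_unit r x = ()"
definition inner_unit :: "unit \<Rightarrow> unit \<Rightarrow> real" where "inner_unit x y = 0"
definition norm_unit :: "unit \<Rightarrow> real" where "norm_unit x = 0"
definition dist_unit :: "unit \<Rightarrow> unit \<Rightarrow> real" where "dist_unit x y = 0"
definition sgn_unit :: "unit \<Rightarrow> unit" where "sgn_unit x = ()"
definition uniformity_unit :: "(unit \<times> unit) filter" where
  "uniformity_unit = (INF e\<in>{0<..}. principal {(x, y). dist x y < e})"
definition open_unit :: "unit set \<Rightarrow> bool" where
  "open_unit U \<longleftrightarrow> (\<forall>x\<in>U. eventually (\<lambda>(x', y). x' = x \<longrightarrow> y \<in> U) uniformity)"

instance
  by standard
    (simp_all add: inner_unit_def norm_unit_def dist_unit_def uniformity_unit_def open_unit_def)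

end

instance unit :: finite_dim_inner
  by standard (rule exI[of _ "{}"], simp)


section \<open>Smooth functions, gradients, simple and almost-simple functions\<close>

text \<open>
  On finite-dimensional spaces (the only ones used here) \<open>f\<close> is of class \<open>C\<^sup>n\<^sup>+\<^sup>1\<close> iff it is
  differentiable and all its directional derivatives are of class \<open>C\<^sup>n\<close>.
\<close>

primrec cont_diff :: "nat \<Rightarrow> ('a::real_normed_vector \<Rightarrow> 'b::real_normed_vector) \<Rightarrow> bool" where
  "cont_diff 0 f \<longleftrightarrow> continuous_on UNIV f"
| "cont_diff (Suc n) f \<longleftrightarrow>
     (\<forall>x. f differentiable (at x)) \<and> (\<forall>v. cont_diff n (\<lambda>x. frechet_derivative f (at x) v))"

definition smooth :: "('a::real_normed_vector \<Rightarrow> 'b::real_normed_vector) \<Rightarrow> bool" where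
  "smooth f \<longleftrightarrow> (\<forall>n. cont_diff n f)"

definition diffeomorphism :: "('a::real_normed_vector \<Rightarrow> 'b::real_normed_vector) \<Rightarrow> bool" where
  "diffeomorphism f \<longleftrightarrow> bij f \<and> smooth f \<and> smooth (inv_into UNIV f)"

definition grad :: "('a::real_inner \<Rightarrow> real) \<Rightarrow> 'a \<Rightarrow> 'a" where
  "grad f x = (THE D. GDERIV f x :> D)"

definition simple :: "('a::finite_dim_inner \<Rightarrow> real) \<Rightarrow> bool" where
  "simple g \<longleftrightarrow> smooth g \<and> diffeomorphism (grad g)"

definition almost_simple_gf ::
    "((real^'n) \<times> 'w::finite_dim_inner \<Rightarrow> real) \<Rightarrow> bool" where
  "almost_simple_gf F \<longleftrightarrow>
     (\<exists>G H B. smooth G \<and> smooth H \<and> (\<forall>z. F z = G z + H z) \<and>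
        (\<forall>q. simple (\<lambda>w. G (q, w))) \<and>
        continuous_on UNIV B \<and> bounded (range B) \<and>
        (\<forall>q w. norm (grad (\<lambda>w. H (q, w)) w) \<le> B q))"


section \<open>Singular homology of pairs with rational coefficients\<close>

text \<open>
  HOL-Homology only treats integral coefficients. The definitions follow that development, with
  formal \<open>\<rat>\<close>-linear combinations of singular simplices as chains. As there, the second member \<open>S\<close>
  of a pair enters through \<^term>\<open>subtopology X S\<close>, hence only via its intersection with the space.
\<close>

type_synonym 'a rat_chain = "((nat \<Rightarrow> real) \<Rightarrow> 'a) \<Rightarrow>\<^sub>0 rat"

definition rat_chain_group :: "nat \<Rightarrow> 'a topology \<Rightarrow> 'a rat_chain monoid" where
  "rat_chain_group p X =
     \<lparr>carrier = {c. Poly_Mapping.keys c \<subseteq> singular_simplex_set p X}, monoid.mult = (+), one = 0\<rparr>"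

definition rat_boundary :: "nat \<Rightarrow> 'a rat_chain \<Rightarrow> 'a rat_chain" where
  "rat_boundary p c =
     (if p = 0 then 0 else
        \<Sum>f\<in>Poly_Mapping.keys c. \<Sum>k\<le>p.
          Poly_Mapping.single (singular_face p k f) ((- 1) ^ k * Poly_Mapping.lookup c f))"

definition rat_relcycles :: "nat \<Rightarrow> 'a topology \<Rightarrow> 'a set \<Rightarrow> 'a rat_chain set" where
  "rat_relcycles p X S =
     {c \<in> carrier (rat_chain_group p X).
        rat_boundary p c \<in> carrier (rat_chain_group (p - 1) (subtopology X S))}"

definition rat_relboundaries :: "nat \<Rightarrow> 'a topology \<Rightarrow> 'a set \<Rightarrow> 'a rat_chain set" where
  "rat_relboundaries p X S =
     {c. \<exists>d \<in> carrier (rat_chain_group (Suc p) X).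
        rat_boundary (Suc p) d - c \<in> carrier (rat_chain_group p (subtopology X S))}"

definition rat_relcycle_group :: "nat \<Rightarrow> 'a topology \<Rightarrow> 'a set \<Rightarrow> 'a rat_chain monoid" where
  "rat_relcycle_group p X S = (rat_chain_group p X)\<lparr>carrier := rat_relcycles p X S\<rparr>"

definition rat_homology :: "nat \<Rightarrow> 'a topology \<Rightarrow> 'a set \<Rightarrow> 'a rat_chain set monoid" where
  "rat_homology p X S = rat_relcycle_group p X S Mod rat_relboundaries p X S"

text \<open>
  The map \<open>H\<^sub>p(X,S;\<rat>) \<rightarrow> H\<^sub>p(Y,T;\<rat>)\<close> induced by an inclusion of pairs sends the class
  \<open>c + \<partial>(X,S)\<close> to \<open>c + \<partial>(Y,T)\<close>; the latter is the sum of the former and the relative boundaries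
  of \<open>(Y,T)\<close>.
\<close>

definition rat_homology_incl ::
    "nat \<Rightarrow> 'a topology \<Rightarrow> 'a set \<Rightarrow> 'a rat_chain set \<Rightarrow> 'a rat_chain set" where
  "rat_homology_incl p Y T C = rat_relboundaries p Y T <#>\<^bsub>rat_relcycle_group p Y T\<^esub> C"

text \<open>
  A group isomorphism between (additive groups of) \<open>\<rat>\<close>-vector spaces is automatically
  \<open>\<rat>\<close>-linear, so being isomorphic to \<open>\<rat>\<close> may be expressed by group isomorphisms.
\<close>

definition rat_group :: "rat monoid" where
  "rat_group = \<lparr>carrier = UNIV, monoid.mult = (+), one = 0\<rparr>"


section \<open>Min-max and selector\<close>

definition sublevel :: "('a \<Rightarrow> real) \<Rightarrow> real \<Rightarrow> 'a set" where
  "sublevel f l = {x. f x \<le> l}"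

definition minmax_homology ::
    "('a::topological_space \<Rightarrow> real) \<Rightarrow> nat \<Rightarrow> real \<Rightarrow> real \<Rightarrow> 'a rat_chain set monoid" where
  "minmax_homology f p l m = rat_homology p (top_of_set (sublevel f l)) (sublevel f m)"

text \<open>The levels \<open>L\<close> for which \<open>f\<^sup>L\<close> and \<open>f\<^sup>-\<^sup>L\<close> serve as \<open>f\<^sup>+\<^sup>\<infinity>\<close> and \<open>f\<^sup>-\<^sup>\<infinity>\<close>.\<close>

definition infinity_level :: "('a::real_inner \<Rightarrow> real) \<Rightarrow> real \<Rightarrow> bool" where
  "infinity_level f L \<longleftrightarrow>
     (\<exists>C. 0 < C \<and> C < L \<and> (\<forall>x. grad f x = 0 \<longrightarrow> f x \<in> {-C<..<C}))"

text \<open>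
  The restriction to \<open>\<lambda> \<in> [-L, L]\<close> makes \<open>(f\<^sup>\<lambda>, f\<^sup>-\<^sup>L) \<subseteq> (f\<^sup>L, f\<^sup>-\<^sup>L)\<close> meaningful; it does not affect
  the infimum. Any level beyond the critical values may be used as \<open>L\<close>; correspondingly the
  defining conditions are required for all of them.
\<close>

definition is_minmax :: "('a::finite_dim_inner \<Rightarrow> real) \<Rightarrow> real \<Rightarrow> bool" where
  "is_minmax f s \<longleftrightarrow>
     smooth f \<and> proper_map euclidean euclidean (grad f) \<and>
     (\<exists>i \<le> dim (UNIV :: 'a set). \<forall>L. infinity_level f L \<longrightarrow>
        minmax_homology f i L (- L) \<cong> rat_group \<and>
        (\<forall>p. p \<noteq> i \<longrightarrow> trivial_group (minmax_homology f p L (- L))) \<and>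
        s = Inf {l \<in> {- L..L}.
              rat_homology_incl i (top_of_set (sublevel f L)) (sublevel f (- L))
                ` carrier (minmax_homology f i l (- L))
              = carrier (minmax_homology f i L (- L))})"

definition minmax :: "('a::finite_dim_inner \<Rightarrow> real) \<Rightarrow> real" where
  "minmax f = (THE s. is_minmax f s)"

definition selector ::
    "((real^'n) \<times> 'w::finite_dim_inner \<Rightarrow> real) \<Rightarrow> real^'n \<Rightarrow> real" where
  "selector F q = minmax (\<lambda>w. F (q, w))"


section \<open>The four generating functions\<close>

definition gf_T1_plus_T2 ::
    "((real^'n) \<times> 'w1 \<Rightarrow> real) \<Rightarrow> ((real^'n) \<times> 'w2 \<Rightarrow> real)
      \<Rightarrow> (real^'n) \<times> ((real^'n) \<times> (real^'n) \<times> 'w1 \<times> 'w2) \<Rightarrow> real" where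
  "gf_T1_plus_T2 F1 F2 = (\<lambda>(q, v1, v2, w1, w2).
     q \<bullet> (v1 + v2) - (F1 (v1, w1) + F2 (v2, w2)))"

definition gf_T_1_box_2 ::
    "((real^'n) \<times> 'w1 \<Rightarrow> real) \<Rightarrow> ((real^'n) \<times> 'w2 \<Rightarrow> real)
      \<Rightarrow> (real^'n) \<times> ((real^'n) \<times> (real^'n) \<times> 'w1 \<times> 'w2) \<Rightarrow> real" where
  "gf_T_1_box_2 F1 F2 = (\<lambda>(q, V, v, w1, w2).
     q \<bullet> V - (F1 (v, w1) + F2 (V - v, w2)))"

definition gf_T1_box_T2 ::
    "((real^'n) \<times> 'w1 \<Rightarrow> real) \<Rightarrow> ((real^'n) \<times> 'w2 \<Rightarrow> real)
      \<Rightarrow> (real^'n) \<times> ((real^'n) \<times> (real^'n) \<times> (real^'n) \<times> 'w1 \<times> 'w2) \<Rightarrow> real" where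
  "gf_T1_box_T2 F1 F2 = (\<lambda>(q, V, v1, v2, w1, w2).
     V \<bullet> (v1 - v2) + q \<bullet> v2 - (F1 (v1, w1) + F2 (v2, w2)))"

definition gf_T_1_plus_2 ::
    "((real^'n) \<times> 'w1 \<Rightarrow> real) \<Rightarrow> ((real^'n) \<times> 'w2 \<Rightarrow> real)
      \<Rightarrow> (real^'n) \<times> ((real^'n) \<times> 'w1 \<times> 'w2) \<Rightarrow> real" where
  "gf_T_1_plus_2 F1 F2 = (\<lambda>(q, v, w1, w2).
     q \<bullet> v - (F1 (v, w1) + F2 (v, w2)))"

end

theory Submission
  imports Defs
begin

text \<open>
  Fix \<open>q\<close>. The fibre functions in (i) differ by the linear substitution \<open>V = v\<^sub>1 + v\<^sub>2\<close>, \<open>v = v\<^sub>1\<close>, which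
  preserves critical values and the homology of sublevel sets. In (ii), put \<open>u = v\<^sub>1 - v\<^sub>2\<close> and
  \<open>x = (v\<^sub>2, w\<^sub>1, w\<^sub>2)\<close>: the left fibre function becomes \<open>g(V,x,u) = V \<bullet> u + h(x,u)\<close>, and the right one is
  \<open>f(x) = h(x,0)\<close>. Since \<open>V\<close> acts as a Lagrange multiplier for the constraint \<open>u = 0\<close>, both have the
  same critical values. It remains to see that relative homology of sublevel sets is shifted by \<open>n\<close>,
  compatibly with inclusions; then \<open>f\<close> and \<open>g\<close> have the same min-max
  (\<open>is_minmax_shift\<close>).

  The shift is computed on open sublevel sets. The fibres of \<open>{g < l}\<close> over \<open>(x,u)\<close> are half-spaces for
  \<open>u \<noteq> 0\<close>, and everything or nothing for \<open>u = 0\<close>, according as \<open>f x < l\<close> or not. So \<open>{g < l}\<close> is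
  homotopy equivalent to \<open>{(x,u). u \<noteq> 0 \<or> f x < l}\<close> (\<open>fibre_shift\<close>), and a pair of such sets is, by
  excision, the product of the pair \<open>({f < l}, {f < m})\<close> with \<open>(\<real>\<^sup>n, \<real>\<^sup>n - 0)\<close> (\<open>base_shift\<close>). The latter
  product raises degrees by \<open>n\<close>, one coordinate at a time (\<open>suspension_shift\<close>).

  Open and closed sublevel sets of regular levels have the same homology, because a step along
  \<open>- grad f\<close>, of a continuously varying size, pushes the closed set into the open one
  (\<open>ex_descent_homotopy\<close>); hence no flow is integrated. For the infimum that defines the min-max,
  other levels need only be compared up to an arbitrarily small change of level.

  Going back from \<open>g\<close> to \<open>f\<close>, the degree of the min-max must not exceed the dimension of the fibre of
  \<open>f\<close>. This holds since pairs of open subsets of \<open>\<real>\<^sup>k\<close> have no homology above degree \<open>k\<close>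
  (\<open>acyclic_above_dimension\<close>).

  Homotopy invariance and excision for rational chains come from the integral ones: a rational
  chain is a rational multiple of an integral chain.
\<close>

section \<open>Rational chains as multiples of integral chains\<close>

definition qscale :: "rat \<Rightarrow> ('b \<Rightarrow>\<^sub>0 rat) \<Rightarrow> ('b \<Rightarrow>\<^sub>0 rat)" where
  "qscale r c = Poly_Mapping.map ((*) r) c"

definition rat_of_chain :: "('b \<Rightarrow>\<^sub>0 int) \<Rightarrow> ('b \<Rightarrow>\<^sub>0 rat)" where
  "rat_of_chain c = Poly_Mapping.map of_int c"

lemma lookup_qscale [simp]: "Poly_Mapping.lookup (qscale r c) x = r * Poly_Mapping.lookup c x"
  by (simp add: qscale_def Poly_Mapping.map.rep_eq when_def)

lemma lookup_rat_of_chain [simp]: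
  "Poly_Mapping.lookup (rat_of_chain c) x = of_int (Poly_Mapping.lookup c x)"
  by (simp add: rat_of_chain_def Poly_Mapping.map.rep_eq when_def)

lemma qscale_add: "qscale r (a + b) = qscale r a + qscale r b"
  by (rule poly_mapping_eqI) (simp add: lookup_add algebra_simps)

lemma qscale_diff: "qscale r (a - b) = qscale r a - qscale r b"
  by (rule poly_mapping_eqI) (simp add: lookup_minus algebra_simps)

lemma qscale_qscale [simp]: "qscale r (qscale s a) = qscale (r * s) a"
  by (rule poly_mapping_eqI) simp

lemma qscale_1 [simp]: "qscale 1 a = a"
  by (rule poly_mapping_eqI) simp

lemma qscale_minus_1: "qscale (- 1) a = - a"
  by (rule poly_mapping_eqI) simp

lemma qscale_0 [simp]: "qscale r 0 = 0" "qscale 0 a = 0"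
  by (rule poly_mapping_eqI, simp)+

lemma keys_qscale: "r \<noteq> 0 \<Longrightarrow> Poly_Mapping.keys (qscale r c) = Poly_Mapping.keys c"
  by (auto simp: in_keys_iff)

lemma keys_qscale_subset: "Poly_Mapping.keys (qscale r c) \<subseteq> Poly_Mapping.keys c"
  by (auto simp: in_keys_iff)

lemma keys_rat_of_chain [simp]: "Poly_Mapping.keys (rat_of_chain c) = Poly_Mapping.keys c"
  by (auto simp: in_keys_iff)

lemma rat_of_chain_diff: "rat_of_chain (a - b) = rat_of_chain a - rat_of_chain b"
  by (rule poly_mapping_eqI) (simp add: lookup_minus)

lemma rat_of_chain_0 [simp]: "rat_of_chain 0 = 0"
  by (rule poly_mapping_eqI) simp

lemma rat_of_chain_cmul: "rat_of_chain (frag_cmul n a) = qscale (of_int n) (rat_of_chain a)"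
  by (rule poly_mapping_eqI) simp

lemma clear_denominators:
  obtains n :: int and c' where "n \<noteq> 0" "qscale (of_int n) c = rat_of_chain c'"
proof -
  define d where "d x = snd (quotient_of (Poly_Mapping.lookup c x))" for x
  define n where "n = (\<Prod>x\<in>Poly_Mapping.keys c. d x)"
  have dpos: "d x > 0" for x
    unfolding d_def by (rule quotient_of_denom_pos')
  have n0: "n \<noteq> 0"
    unfolding n_def using dpos by (simp add: less_imp_neq[symmetric])
  have int: "\<exists>m::int. of_int n * Poly_Mapping.lookup c x = of_int m" for x
  proof (cases "x \<in> Poly_Mapping.keys c")
    case True
    then have "d x dvd n" unfolding n_def by (intro dvd_prodI) simp_all
    then obtain k where k: "n = d x * k" by blast
    obtain a where a: "quotient_of (Poly_Mapping.lookup c x) = (a, d x)"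
      unfolding d_def by (metis prod.collapse)
    have "Poly_Mapping.lookup c x = of_int a / of_int (d x)"
      by (rule quotient_of_div[OF a])
    then have "of_int n * Poly_Mapping.lookup c x = of_int (k * a)"
      using dpos[of x] k by simp
    then show ?thesis by blast
  next
    case False
    then show ?thesis by (intro exI[of _ 0]) (simp add: in_keys_iff)
  qed
  then obtain m where m: "\<And>x. of_int n * Poly_Mapping.lookup c x = of_int (m x)"
    by metis
  define c' where "c' = Abs_poly_mapping m"
  have "{x. m x \<noteq> 0} \<subseteq> Poly_Mapping.keys c"
  proof (rule subsetI, rule ccontr)
    fix x assume "x \<in> {x. m x \<noteq> 0}" "x \<notin> Poly_Mapping.keys c"
    then show False using m[of x] by (simp add: in_keys_iff)
  qed
  then have "finite {x. m x \<noteq> 0}" by (rule finite_subset) simp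
  then have "Poly_Mapping.lookup c' = m"
    unfolding c'_def by (simp add: Abs_poly_mapping_inverse)
  then have "qscale (of_int n) c = rat_of_chain c'"
    by (intro poly_mapping_eqI) (simp add: m)
  with n0 that show thesis by blast
qed

text \<open>
  The boundary operator and chain maps commute with \<^const>\<open>qscale\<close> and \<^const>\<open>rat_of_chain\<close>, so that this
  representation carries facts on integral chains over to rational ones.
\<close>
lemma rat_chain_as_integral:
  fixes c :: "'b \<Rightarrow>\<^sub>0 rat"
  obtains r c' where "r \<noteq> 0" "c = qscale r (rat_of_chain c')" "Poly_Mapping.keys c' = Poly_Mapping.keys c"
proof -
  obtain n :: int and c' where n: "n \<noteq> 0" "qscale (of_int n) c = rat_of_chain c'"
    by (rule clear_denominators)
  have "c = qscale (1 / of_int n) (qscale (of_int n) c)" using n(1) by simp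
  moreover have "Poly_Mapping.keys c' = Poly_Mapping.keys c"
    using n keys_qscale[of "of_int n" c] by simp
  ultimately show thesis using that[of "1 / of_int n" c'] n by simp
qed

text \<open>
  The \<open>\<rat>\<close>-linear extension of an integral \<open>b\<close>. The boundary and all chain maps have this form, so
  linearity and the comparison with integral chains are proved once for all of them.
\<close>
definition rat_extend :: "('b \<Rightarrow> 'a \<Rightarrow>\<^sub>0 int) \<Rightarrow> ('b \<Rightarrow>\<^sub>0 rat) \<Rightarrow> ('a \<Rightarrow>\<^sub>0 rat)" where
  "rat_extend b c = (\<Sum>x\<in>Poly_Mapping.keys c. qscale (Poly_Mapping.lookup c x) (rat_of_chain (b x)))"

lemma lookup_rat_extend:
  assumes "finite A" "Poly_Mapping.keys c \<subseteq> A"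
  shows "Poly_Mapping.lookup (rat_extend b c) y =
    (\<Sum>x\<in>A. Poly_Mapping.lookup c x * of_int (Poly_Mapping.lookup (b x) y))"
  unfolding rat_extend_def lookup_sum
  using assms by (intro sum.mono_neutral_cong_left) (auto simp: in_keys_iff)

lemma rat_extend_add: "rat_extend b (c + d) = rat_extend b c + rat_extend b d"
proof (rule poly_mapping_eqI)
  fix y
  let ?A = "Poly_Mapping.keys c \<union> Poly_Mapping.keys d"
  have "Poly_Mapping.keys (c + d) \<subseteq> ?A" by (rule Poly_Mapping.keys_add)
  then show "Poly_Mapping.lookup (rat_extend b (c + d)) y =
        Poly_Mapping.lookup (rat_extend b c + rat_extend b d) y"
    by (simp add: lookup_add lookup_rat_extend[of ?A] algebra_simps sum.distrib)
qed

lemma rat_extend_qscale: "rat_extend b (qscale r c) = qscale r (rat_extend b c)"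
  by (rule poly_mapping_eqI)
    (simp add: lookup_rat_extend[of "Poly_Mapping.keys c"] keys_qscale_subset sum_distrib_left mult.assoc)

lemma rat_extend_minus: "rat_extend b (- c) = - rat_extend b c"
  using rat_extend_qscale[of b "- 1" c] by (simp add: qscale_minus_1)

lemma rat_extend_diff: "rat_extend b (c - d) = rat_extend b c - rat_extend b d"
  using rat_extend_add[of b c "- d"] by (simp add: rat_extend_minus)

lemma rat_extend_of: "rat_extend b (rat_of_chain c) = rat_of_chain (frag_extend b c)"
  by (rule poly_mapping_eqI) (simp add: lookup_rat_extend[of "Poly_Mapping.keys c"] frag_extend_def lookup_sum)

lemma rat_boundary_extend:
  "rat_boundary p c = (if p = 0 then 0 else
     rat_extend (\<lambda>f. \<Sum>k\<le>p. frag_cmul ((-1) ^ k) (frag_of (singular_face p k f))) c)"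
proof (cases "p = 0")
  case False
  have "Poly_Mapping.lookup (rat_boundary p c) y =
    Poly_Mapping.lookup (rat_extend (\<lambda>f. \<Sum>k\<le>p. frag_cmul ((-1) ^ k) (frag_of (singular_face p k f))) c) y" for y
    using False
    by (auto simp: rat_boundary_def lookup_sum lookup_single when_def sum_distrib_left
        lookup_rat_extend[of "Poly_Mapping.keys c"] intro!: sum.cong)
  then show ?thesis using False by (simp add: poly_mapping_eqI)
qed (simp add: rat_boundary_def)

lemma rat_boundary_add: "rat_boundary p (c + d) = rat_boundary p c + rat_boundary p d"
  by (simp add: rat_boundary_extend rat_extend_add)

lemma rat_boundary_diff: "rat_boundary p (c - d) = rat_boundary p c - rat_boundary p d"
  by (simp add: rat_boundary_extend rat_extend_diff)

lemma rat_boundary_qscale: "rat_boundary p (qscale r c) = qscale r (rat_boundary p c)"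
  by (simp add: rat_boundary_extend rat_extend_qscale)

lemma rat_boundary_of: "rat_boundary p (rat_of_chain c) = rat_of_chain (chain_boundary p c)"
  by (simp add: rat_boundary_extend chain_boundary_def rat_extend_of)

lemma rat_boundary_0 [simp]: "rat_boundary p 0 = 0"
  by (simp add: rat_boundary_def)

definition qchain_map ::
    "nat \<Rightarrow> ('a \<Rightarrow> 'b) \<Rightarrow> 'a rat_chain \<Rightarrow> 'b rat_chain" where
  "qchain_map p g = rat_extend (frag_of \<circ> simplex_map p g)"

lemma qchain_map_add: "qchain_map p g (c + d) = qchain_map p g c + qchain_map p g d"
  by (simp add: qchain_map_def rat_extend_add)

lemma qchain_map_diff: "qchain_map p g (c - d) = qchain_map p g c - qchain_map p g d"
  by (simp add: qchain_map_def rat_extend_diff)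

lemma qchain_map_qscale: "qchain_map p g (qscale r c) = qscale r (qchain_map p g c)"
  by (simp add: qchain_map_def rat_extend_qscale)

lemma qchain_map_of: "qchain_map p g (rat_of_chain c) = rat_of_chain (chain_map p g c)"
  by (simp add: qchain_map_def chain_map_def rat_extend_of)

section \<open>Cycles and boundaries of pairs of sets\<close>

definition qchains :: "nat \<Rightarrow> 'a::topological_space set \<Rightarrow> 'a rat_chain set" where
  "qchains p Y = {c. Poly_Mapping.keys c \<subseteq> singular_simplex_set p (top_of_set Y)}"

text \<open>
  For \<open>S \<subseteq> Y\<close>, this set and the next one are \<^const>\<open>rat_relcycles\<close> and \<^const>\<open>rat_relboundaries\<close> of
  \<open>top_of_set Y\<close> and \<open>S\<close>, free of iterated subtopologies.
\<close>
definition qcycles :: "nat \<Rightarrow> 'a::topological_space set \<Rightarrow> 'a set \<Rightarrow> 'a rat_chain set" where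
  "qcycles p Y S = {c \<in> qchains p Y. rat_boundary p c \<in> qchains (p - 1) S}"

definition qbounds :: "nat \<Rightarrow> 'a::topological_space set \<Rightarrow> 'a set \<Rightarrow> 'a rat_chain set" where
  "qbounds p Y S = {c. \<exists>d\<in>qchains (Suc p) Y. rat_boundary (Suc p) d - c \<in> qchains p S}"

lemma qchains_of_iff: "rat_of_chain c \<in> qchains p Y \<longleftrightarrow> singular_chain p (top_of_set Y) c"
  by (simp add: qchains_def singular_chain_def)

lemma qchains_0 [simp]: "0 \<in> qchains p Y" by (simp add: qchains_def)

lemma qchains_add: "a \<in> qchains p Y \<Longrightarrow> b \<in> qchains p Y \<Longrightarrow> a + b \<in> qchains p Y"
  unfolding qchains_def using Poly_Mapping.keys_add[of a b] by auto

lemma qchains_minus: "a \<in> qchains p Y \<Longrightarrow> - a \<in> qchains p Y"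
  by (simp add: qchains_def)

lemma qchains_diff: "a \<in> qchains p Y \<Longrightarrow> b \<in> qchains p Y \<Longrightarrow> a - b \<in> qchains p Y"
  using qchains_add[of a p Y "- b"] qchains_minus[of b p Y] by simp

lemma qchains_qscale: "a \<in> qchains p Y \<Longrightarrow> qscale r a \<in> qchains p Y"
  unfolding qchains_def using keys_qscale_subset[of r a] by auto

lemma qchains_qscale_iff: "r \<noteq> 0 \<Longrightarrow> qscale r a \<in> qchains p Y \<longleftrightarrow> a \<in> qchains p Y"
  by (simp add: qchains_def keys_qscale)

lemma qchains_as_integral:
  assumes "c \<in> qchains p Y"
  obtains r c' where "r \<noteq> 0" "c = qscale r (rat_of_chain c')" "singular_chain p (top_of_set Y) c'"
  using assms rat_chain_as_integral[of c] by (metis qchains_of_iff qchains_qscale_iff)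

lemma qchains_mono: "S \<subseteq> Y \<Longrightarrow> qchains p S \<subseteq> qchains p Y"
  unfolding qchains_def using singular_simplex_mono[of p euclidean S _ Y] by auto

lemma qchains_boundary: "c \<in> qchains p Y \<Longrightarrow> rat_boundary p c \<in> qchains (p - 1) Y"
proof -
  assume c: "c \<in> qchains p Y"
  obtain r c' where r: "r \<noteq> 0" "c = qscale r (rat_of_chain c')" by (rule rat_chain_as_integral)
  then have "singular_chain p (top_of_set Y) c'" using c by (simp add: qchains_qscale_iff qchains_of_iff)
  then have "singular_chain (p - 1) (top_of_set Y) (chain_boundary p c')" by (simp add: singular_chain_boundary)
  then show ?thesis
    using r by (simp add: rat_boundary_qscale rat_boundary_of qchains_qscale_iff qchains_of_iff)
qed

lemma qchains_boundary_Suc: "c \<in> qchains (Suc p) Y \<Longrightarrow> rat_boundary (Suc p) c \<in> qchains p Y"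
  using qchains_boundary[of c "Suc p" Y] by simp

lemma rat_boundary_boundary: "c \<in> qchains (Suc p) Y \<Longrightarrow> rat_boundary p (rat_boundary (Suc p) c) = 0"
proof -
  assume c: "c \<in> qchains (Suc p) Y"
  obtain r c' where r: "r \<noteq> 0" "c = qscale r (rat_of_chain c')" by (rule rat_chain_as_integral)
  then have "singular_chain (Suc p) (top_of_set Y) c'" using c by (simp add: qchains_qscale_iff qchains_of_iff)
  then have "chain_boundary p (chain_boundary (Suc p) c') = 0"
    by (metis chain_boundary_boundary diff_Suc_1')
  then show ?thesis
    using r by (simp add: rat_boundary_qscale rat_boundary_of)
qed

lemma rat_relcycles_eq:
  assumes "S \<subseteq> Y" shows "rat_relcycles p (top_of_set Y) S = qcycles p Y S"
  using assms
  by (simp add: rat_relcycles_def qcycles_def qchains_def rat_chain_group_def subtopology_subtopology Int_absorb1)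

lemma rat_relboundaries_eq:
  assumes "S \<subseteq> Y" shows "rat_relboundaries p (top_of_set Y) S = qbounds p Y S"
  using assms
  by (simp add: rat_relboundaries_def qbounds_def qchains_def rat_chain_group_def subtopology_subtopology Int_absorb1)

lemma qbounds_iff: "c \<in> qbounds p Y S \<longleftrightarrow>
  (\<exists>d\<in>qchains (Suc p) Y. \<exists>e\<in>qchains p S. c = rat_boundary (Suc p) d + e)"
proof
  assume "c \<in> qbounds p Y S"
  then obtain d where d: "d \<in> qchains (Suc p) Y" "rat_boundary (Suc p) d - c \<in> qchains p S"
    by (auto simp: qbounds_def)
  have "c = rat_boundary (Suc p) d + - (rat_boundary (Suc p) d - c)" by simp
  then show "\<exists>d\<in>qchains (Suc p) Y. \<exists>e\<in>qchains p S. c = rat_boundary (Suc p) d + e"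
    using d qchains_minus by blast
next
  assume "\<exists>d\<in>qchains (Suc p) Y. \<exists>e\<in>qchains p S. c = rat_boundary (Suc p) d + e"
  then show "c \<in> qbounds p Y S"
    by (auto simp: qbounds_def intro: qchains_minus intro!: bexI)
qed

lemma qcycles_diff: "a \<in> qcycles p Y S \<Longrightarrow> b \<in> qcycles p Y S \<Longrightarrow> a - b \<in> qcycles p Y S"
  by (simp add: qcycles_def qchains_diff rat_boundary_diff)

lemma qcycles_0 [simp]: "0 \<in> qcycles p Y S"
  by (simp add: qcycles_def)

lemma qcycles_mono: "Y \<subseteq> Y' \<Longrightarrow> S \<subseteq> S' \<Longrightarrow> qcycles p Y S \<subseteq> qcycles p Y' S'"
  using qchains_mono[of Y Y' p] qchains_mono[of S S' "p-1"] by (auto simp: qcycles_def)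

lemma qbounds_mono: "Y \<subseteq> Y' \<Longrightarrow> S \<subseteq> S' \<Longrightarrow> qbounds p Y S \<subseteq> qbounds p Y' S'"
  using qchains_mono[of Y Y' "Suc p"] qchains_mono[of S S' p] by (auto simp: qbounds_def)

lemma qbounds_0 [simp]: "0 \<in> qbounds p Y S"
  by (auto simp: qbounds_def intro!: bexI[of _ 0])

lemma qbounds_add: "a \<in> qbounds p Y S \<Longrightarrow> b \<in> qbounds p Y S \<Longrightarrow> a + b \<in> qbounds p Y S"
  unfolding qbounds_iff
proof (elim bexE)
  fix d e d' e'
  assume "d \<in> qchains (Suc p) Y" "e \<in> qchains p S" "a = rat_boundary (Suc p) d + e"
   "d' \<in> qchains (Suc p) Y" "e' \<in> qchains p S" "b = rat_boundary (Suc p) d' + e'"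
  then show "\<exists>d\<in>qchains (Suc p) Y. \<exists>e\<in>qchains p S. a + b = rat_boundary (Suc p) d + e"
    by (intro bexI[of _ "d + d'"] bexI[of _ "e + e'"]) (simp_all add: rat_boundary_add qchains_add)
qed

lemma qbounds_qscale: "a \<in> qbounds p Y S \<Longrightarrow> qscale r a \<in> qbounds p Y S"
  unfolding qbounds_iff
proof (elim bexE)
  fix d e
  assume "d \<in> qchains (Suc p) Y" "e \<in> qchains p S" "a = rat_boundary (Suc p) d + e"
  then show "\<exists>d\<in>qchains (Suc p) Y. \<exists>e\<in>qchains p S. qscale r a = rat_boundary (Suc p) d + e"
    by (intro bexI[of _ "qscale r d"] bexI[of _ "qscale r e"])
      (simp_all add: qscale_add rat_boundary_qscale qchains_qscale)
qed

lemma qbounds_minus: "a \<in> qbounds p Y S \<Longrightarrow> - a \<in> qbounds p Y S"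
  using qbounds_qscale[of a p Y S "-1"] by (simp add: qscale_minus_1)

lemma qbounds_diff: "a \<in> qbounds p Y S \<Longrightarrow> b \<in> qbounds p Y S \<Longrightarrow> a - b \<in> qbounds p Y S"
  using qbounds_add[of a p Y S "- b"] qbounds_minus[of b p Y S] by simp

lemma qchains_qbounds: "e \<in> qchains p S \<Longrightarrow> e \<in> qbounds p Y S"
  unfolding qbounds_iff by (rule bexI[of _ 0]) auto

lemma qbounds_subset_qcycles: "S \<subseteq> Y \<Longrightarrow> qbounds p Y S \<subseteq> qcycles p Y S"
proof
  fix c assume S: "S \<subseteq> Y" and "c \<in> qbounds p Y S"
  then obtain d e where de: "d \<in> qchains (Suc p) Y" "e \<in> qchains p S" "c = rat_boundary (Suc p) d + e"
    unfolding qbounds_iff by blast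
  then show "c \<in> qcycles p Y S"
    using qchains_mono[OF S, of p] qchains_boundary[of e p S]
    by (auto simp: qcycles_def rat_boundary_add rat_boundary_boundary qchains_boundary qchains_boundary_Suc
        intro!: qchains_add)
qed

lemma qcycles_of_iff: 
  assumes "S \<subseteq> Y"
  shows "rat_of_chain c \<in> qcycles p Y S \<longleftrightarrow> singular_relcycle p (top_of_set Y) S c"
  using assms
  by (simp add: qcycles_def singular_relcycle qchains_of_iff rat_boundary_of subtopology_subtopology Int_absorb1)

lemma qcycles_qscale_iff: "r \<noteq> 0 \<Longrightarrow> qscale r c \<in> qcycles p Y S \<longleftrightarrow> c \<in> qcycles p Y S"
  by (simp add: qcycles_def qchains_qscale_iff rat_boundary_qscale)

lemma qbounds_of:
  assumes "S \<subseteq> Y" "singular_relboundary p (top_of_set Y) S c"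
  shows "rat_of_chain c \<in> qbounds p Y S"
proof -
  obtain d where "singular_chain (Suc p) (top_of_set Y) d"
    "singular_chain p (top_of_set S) (chain_boundary (Suc p) d - c)"
    using assms by (auto simp: singular_relboundary_def mod_subset_def subtopology_subtopology Int_absorb1)
  then show ?thesis
    unfolding qbounds_def
    by (intro CollectI bexI[of _ "rat_of_chain d"])
      (simp_all add: qchains_of_iff rat_boundary_of flip: rat_of_chain_diff)
qed

text \<open>
  The multiple is unavoidable: an integral torsion cycle bounds only rationally.
\<close>
lemma qbounds_of_multiple:
  assumes S: "S \<subseteq> Y" and c: "rat_of_chain c \<in> qbounds p Y S"
  obtains n where "n \<noteq> 0" "singular_relboundary p (top_of_set Y) S (frag_cmul n c)"
proof -
  obtain d where d: "d \<in> qchains (Suc p) Y" "rat_boundary (Suc p) d - rat_of_chain c \<in> qchains p S"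
    using c by (auto simp: qbounds_def)
  obtain n :: int and d' where n: "n \<noteq> 0" "qscale (of_int n) d = rat_of_chain d'"
    by (rule clear_denominators)
  have "singular_chain (Suc p) (top_of_set Y) d'"
    using d(1) n qchains_of_iff qchains_qscale by metis
  moreover
  have "rat_of_chain (chain_boundary (Suc p) d' - frag_cmul n c) = 
    qscale (of_int n) (rat_boundary (Suc p) d - rat_of_chain c)"
    by (simp add: qscale_diff rat_of_chain_diff rat_of_chain_cmul n(2)
        flip: rat_boundary_of rat_boundary_qscale)
  then have "singular_chain p (top_of_set S) (chain_boundary (Suc p) d' - frag_cmul n c)"
    by (metis d(2) qchains_of_iff qchains_qscale)
  ultimately have "singular_relboundary p (top_of_set Y) S (frag_cmul n c)"
    using S by (auto simp: singular_relboundary_def mod_subset_def subtopology_subtopology Int_absorb1)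
  with n that show thesis by blast
qed

section \<open>Quotients of additive groups\<close>

definition addgrp :: "'a::ab_group_add set \<Rightarrow> 'a monoid" where
  "addgrp Z = \<lparr>carrier = Z, monoid.mult = (+), one = 0\<rparr>"

lemma addgrp_simps [simp]:
  "carrier (addgrp Z) = Z" "x \<otimes>\<^bsub>addgrp Z\<^esub> y = x + y" "\<one>\<^bsub>addgrp Z\<^esub> = 0"
  by (simp_all add: addgrp_def)

definition add_closed :: "'a::ab_group_add set \<Rightarrow> bool" where
  "add_closed Z \<longleftrightarrow> 0 \<in> Z \<and> (\<forall>x\<in>Z. \<forall>y\<in>Z. x - y \<in> Z)"

lemma add_closedD:
  assumes "add_closed Z"
  shows "0 \<in> Z" "x \<in> Z \<Longrightarrow> y \<in> Z \<Longrightarrow> x - y \<in> Z" "x \<in> Z \<Longrightarrow> - x \<in> Z"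
    "x \<in> Z \<Longrightarrow> y \<in> Z \<Longrightarrow> x + y \<in> Z"
proof -
  show 0: "0 \<in> Z" and d: "x \<in> Z \<Longrightarrow> y \<in> Z \<Longrightarrow> x - y \<in> Z" for x y
    using assms by (auto simp: add_closed_def)
  show m: "x \<in> Z \<Longrightarrow> - x \<in> Z" for x using d[OF 0, of x] by simp
  show "x \<in> Z \<Longrightarrow> y \<in> Z \<Longrightarrow> x + y \<in> Z" using d[of x "- y"] m[of y] by simp
qed

lemma comm_group_addgrp: "add_closed Z \<Longrightarrow> comm_group (addgrp Z)"
  by (rule comm_groupI)
    (auto simp: add_closedD algebra_simps intro: bexI[of _ "- x" for x] add_closedD)

lemma group_addgrp: "add_closed Z \<Longrightarrow> group (addgrp Z)"
  using comm_group_addgrp comm_group.axioms(2) by blast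

lemma m_inv_addgrp: "add_closed Z \<Longrightarrow> x \<in> Z \<Longrightarrow> inv\<^bsub>addgrp Z\<^esub> x = - x"
  by (rule group.inv_equality[OF group_addgrp]) (auto simp: add_closedD)

lemma subgroup_addgrp: "add_closed Z \<Longrightarrow> add_closed B \<Longrightarrow> B \<subseteq> Z \<Longrightarrow> subgroup B (addgrp Z)"
proof -
  assume Z: "add_closed Z" and B: "add_closed B" "B \<subseteq> Z"
  show "subgroup B (addgrp Z)"
  proof (rule group.subgroupI[OF group_addgrp[OF Z]])
    show "B \<noteq> {}" using add_closedD(1)[OF B(1)] by blast
    show "inv\<^bsub>addgrp Z\<^esub> x \<in> B" if "x \<in> B" for x
      using that B m_inv_addgrp[OF Z, of x] add_closedD(3)[OF B(1), of x] by auto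
  qed (use B add_closedD(4)[OF B(1)] in auto)
qed

lemma normal_addgrp: "add_closed Z \<Longrightarrow> add_closed B \<Longrightarrow> B \<subseteq> Z \<Longrightarrow> B \<lhd> addgrp Z"
  by (rule comm_group.normal_iff_subgroup[OF comm_group_addgrp, THEN iffD2]) (auto intro: subgroup_addgrp)

lemma r_coset_addgrp: "B #>\<^bsub>addgrp Z\<^esub> x = (\<lambda>b. b + x) ` B"
  by (auto simp: r_coset_def)

lemma coset_eq_iff:
  assumes "add_closed B"
  shows "(\<lambda>b. b + x) ` B = (\<lambda>b. b + y) ` B \<longleftrightarrow> x - y \<in> B"
proof
  assume "(\<lambda>b. b + x) ` B = (\<lambda>b. b + y) ` B"
  moreover have "x \<in> (\<lambda>b. b + x) ` B"
    using add_closedD(1)[OF assms] by (intro image_eqI[of _ _ 0]) auto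
  ultimately have "x \<in> (\<lambda>b. b + y) ` B" by simp
  then show "x - y \<in> B" by auto
next
  assume *: "x - y \<in> B"
  have "(\<lambda>b. b + u) ` B \<subseteq> (\<lambda>b. b + v) ` B" if "u - v \<in> B" for u v
  proof (rule image_subsetI)
    fix b assume "b \<in> B"
    then have "b + (u - v) \<in> B" using that assms by (simp add: add_closedD)
    moreover have "b + u = b + (u - v) + v" by simp
    ultimately show "b + u \<in> (\<lambda>b. b + v) ` B" by (rule rev_image_eqI)
  qed
  from this[of x y] this[of y x] show "(\<lambda>b. b + x) ` B = (\<lambda>b. b + y) ` B"
    using * add_closedD(3)[OF assms *] by auto
qed

lemma group_quotient:
  assumes "add_closed Z" "add_closed B" "B \<subseteq> Z"
  shows "group (addgrp Z Mod B)"
  using normal.factorgroup_is_group[OF normal_addgrp[OF assms]] .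

lemma trivial_quotient_iff:
  assumes Z: "add_closed Z" and B: "add_closed B" and "B \<subseteq> Z"
  shows "trivial_group (addgrp Z Mod B) \<longleftrightarrow> Z \<subseteq> B"
proof -
  have B0: "B = (\<lambda>b. b + 0) ` B" by simp
  have "trivial_group (addgrp Z Mod B) \<longleftrightarrow> (\<forall>x\<in>Z. (\<lambda>b. b + x) ` B = (\<lambda>b. b + 0) ` B)"
    using group.trivial_group_subset[OF group_quotient[OF assms]]
    by (simp add: carrier_FactGroup r_coset_addgrp image_subset_iff)
  also have "\<dots> \<longleftrightarrow> Z \<subseteq> B"
    by (simp only: coset_eq_iff[OF B] diff_zero subset_eq)
  finally show ?thesis .
qed

text \<open>
  The first isomorphism theorem for the map that sends \<open>c\<close> to the coset of \<open>\<phi> c\<close>.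
\<close>
lemma quotient_isoI:
  assumes Z: "add_closed Z" and B: "add_closed B" "B \<subseteq> Z"
    and Z': "add_closed Z'" and B': "add_closed B'" "B' \<subseteq> Z'"
    and add: "\<And>a b. \<phi> (a + b) = \<phi> a + \<phi> b"
    and ZZ: "\<And>c. c \<in> Z \<Longrightarrow> \<phi> c \<in> Z'"
    and BB: "\<And>c. c \<in> Z \<Longrightarrow> \<phi> c \<in> B' \<longleftrightarrow> c \<in> B"
    and surj: "\<And>z. z \<in> Z' \<Longrightarrow> \<exists>c\<in>Z. z - \<phi> c \<in> B'"
  shows "addgrp Z Mod B \<cong> addgrp Z' Mod B'"
proof -
  let ?G = "addgrp Z" and ?Q = "addgrp Z' Mod B'"
  define h where "h c = (\<lambda>b. b + \<phi> c) ` B'" for c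
  have gG: "group ?G" and gQ: "group ?Q"
    using group_addgrp[OF Z] group_quotient[OF Z' B'] by auto
  have hom: "h \<in> hom ?G ?Q"
  proof (rule homI)
    show "h x \<in> carrier ?Q" if "x \<in> carrier ?G" for x
      using that ZZ by (auto simp: h_def carrier_FactGroup r_coset_addgrp)
    show "h (x \<otimes>\<^bsub>?G\<^esub> y) = h x \<otimes>\<^bsub>?Q\<^esub> h y" if "x \<in> carrier ?G" "y \<in> carrier ?G" for x y
      using normal.rcos_sum[OF normal_addgrp[OF Z' B'], of "\<phi> x" "\<phi> y"] that ZZ
      by (simp add: h_def add r_coset_addgrp)
  qed
  interpret group_hom ?G ?Q h
    using gG gQ hom by (simp add: group_hom_def group_hom_axioms_def)
  have "kernel ?G ?Q h = B"
  proof -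
    have "h c = B' \<longleftrightarrow> c \<in> B" if "c \<in> Z" for c
      using coset_eq_iff[OF B'(1), of "\<phi> c" 0] BB[OF that] by (simp add: h_def)
    then show ?thesis using B(2) by (auto simp: kernel_def)
  qed
  moreover have "h ` carrier ?G = carrier ?Q"
  proof
    show "h ` carrier ?G \<subseteq> carrier ?Q" using hom by (auto simp: hom_def)
    show "carrier ?Q \<subseteq> h ` carrier ?G"
    proof
      fix C assume "C \<in> carrier ?Q"
      then obtain z where z: "z \<in> Z'" "C = (\<lambda>b. b + z) ` B'"
        by (auto simp: carrier_FactGroup r_coset_addgrp)
      obtain c where c: "c \<in> Z" "z - \<phi> c \<in> B'" using surj[OF z(1)] by blast
      then have "C = h c" using z coset_eq_iff[OF B'(1), of z "\<phi> c"] by (simp add: h_def)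
      then show "C \<in> h ` carrier ?G" using c by simp
    qed
  qed
  ultimately show ?thesis using FactGroup_iso by simp
qed

section \<open>Rational homology groups of pairs\<close>

abbreviation hq :: "nat \<Rightarrow> 'a::topological_space set \<Rightarrow> 'a set \<Rightarrow> 'a rat_chain set monoid" where
  "hq p Y S \<equiv> rat_homology p (top_of_set Y) S"

lemma rat_homology_eq: "S \<subseteq> Y \<Longrightarrow> hq p Y S = addgrp (qcycles p Y S) Mod (qbounds p Y S)"
  by (simp add: rat_homology_def rat_relcycle_group_def rat_chain_group_def addgrp_def
      rat_relcycles_eq rat_relboundaries_eq)

lemma add_closed_qcycles: "add_closed (qcycles p Y S)"
  by (simp add: add_closed_def qcycles_diff)

lemma add_closed_qbounds: "add_closed (qbounds p Y S)"
  by (simp add: add_closed_def qbounds_diff)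

lemma group_rat_homology: "S \<subseteq> Y \<Longrightarrow> group (hq p Y S)"
  by (simp add: rat_homology_eq group_quotient add_closed_qcycles add_closed_qbounds qbounds_subset_qcycles)

definition acyclic_at :: "nat \<Rightarrow> 'a::topological_space set \<Rightarrow> 'a set \<Rightarrow> bool" where
  "acyclic_at p Y S \<longleftrightarrow> qcycles p Y S \<subseteq> qbounds p Y S"

lemma trivial_rat_homology_iff: "S \<subseteq> Y \<Longrightarrow> trivial_group (hq p Y S) \<longleftrightarrow> acyclic_at p Y S"
  by (simp add: acyclic_at_def rat_homology_eq trivial_quotient_iff add_closed_qcycles add_closed_qbounds
      qbounds_subset_qcycles)

text \<open>
  The map \<open>\<phi>\<close> of chains induces a well-defined bijection of homology groups. Two degrees occur
  because \<open>\<phi>\<close> may be the boundary operator.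
\<close>
definition qiso :: "nat \<Rightarrow> 'a::topological_space set \<Rightarrow> 'a set \<Rightarrow> nat \<Rightarrow> 'b::topological_space set \<Rightarrow> 'b set \<Rightarrow>
    ('a rat_chain \<Rightarrow> 'b rat_chain) \<Rightarrow> bool" where
  "qiso p Y S p' Z T \<phi> \<longleftrightarrow>
     (\<forall>a b. \<phi> (a + b) = \<phi> a + \<phi> b) \<and>
     (\<forall>c\<in>qcycles p Y S. \<phi> c \<in> qcycles p' Z T \<and> (\<phi> c \<in> qbounds p' Z T \<longleftrightarrow> c \<in> qbounds p Y S)) \<and>
     (\<forall>z\<in>qcycles p' Z T. \<exists>c\<in>qcycles p Y S. z - \<phi> c \<in> qbounds p' Z T)"

lemma qiso_imp_iso:
  assumes "qiso p Y S p' Z T \<phi>" "S \<subseteq> Y" "T \<subseteq> Z"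
  shows "hq p Y S \<cong> hq p' Z T"
  unfolding rat_homology_eq[OF assms(2)] rat_homology_eq[OF assms(3)]
  using assms unfolding qiso_def
  by (intro quotient_isoI[where \<phi> = \<phi>])
    (auto simp: add_closed_qcycles add_closed_qbounds qbounds_subset_qcycles[THEN subsetD])

text \<open>
  Surjectivity of the map induced by the inclusion \<open>(Y,S) \<subseteq> (Y',S')\<close>, in terms of representatives.
\<close>
definition rel_surj :: "nat \<Rightarrow> 'a::topological_space set \<Rightarrow> 'a set \<Rightarrow> 'a set \<Rightarrow> 'a set \<Rightarrow> bool" where
  "rel_surj p Y S Y' S' \<longleftrightarrow> (\<forall>z\<in>qcycles p Y' S'. \<exists>c\<in>qcycles p Y S. z - c \<in> qbounds p Y' S')"

lemma set_mult_addgrp: "A <#>\<^bsub>addgrp Z\<^esub> C = {a + c |a c. a \<in> A \<and> c \<in> C}"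
  by (auto simp: set_mult_def)

lemma image_eq_image_iff: "A \<subseteq> A' \<Longrightarrow> f ` A = f ` A' \<longleftrightarrow> (\<forall>z\<in>A'. \<exists>c\<in>A. f z = f c)"
proof
  show "\<forall>z\<in>A'. \<exists>c\<in>A. f z = f c" if "A \<subseteq> A'" "f ` A = f ` A'"
    using that by (metis imageE imageI)
  show "f ` A = f ` A'" if AA: "A \<subseteq> A'" and ex: "\<forall>z\<in>A'. \<exists>c\<in>A. f z = f c"
  proof
    show "f ` A \<subseteq> f ` A'" using AA by (rule image_mono)
    show "f ` A' \<subseteq> f ` A"
    proof (rule image_subsetI)
      fix z assume "z \<in> A'"
      then obtain c where "c \<in> A" "f z = f c" using ex by blast
      then show "f z \<in> f ` A" by simp
    qed
  qed
qed

lemma rat_homology_incl_surj_iff: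
  assumes "S \<subseteq> Y" "S' \<subseteq> Y'" "Y \<subseteq> Y'" "S \<subseteq> S'"
  shows "rat_homology_incl p (top_of_set Y') S' ` carrier (hq p Y S) = carrier (hq p Y' S')
    \<longleftrightarrow> rel_surj p Y S Y' S'"
proof -
  let ?B = "qbounds p Y S" and ?B' = "qbounds p Y' S'"
  have BB: "?B \<subseteq> ?B'" using assms by (intro qbounds_mono)
  have grp: "rat_relcycle_group p (top_of_set Y') S' = addgrp (qcycles p Y' S')"
    using assms
    by (simp add: rat_relcycle_group_def rat_chain_group_def addgrp_def rat_relcycles_eq)
  have incl: "rat_homology_incl p (top_of_set Y') S' ((\<lambda>b. b + c) ` ?B) = (\<lambda>b. b + c) ` ?B'" for c
  proof -
    have "{a + d |a d. a \<in> ?B' \<and> d \<in> (\<lambda>b. b + c) ` ?B} = (\<lambda>b. b + c) ` ?B'"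
    proof (intro equalityI subsetI)
      fix x assume "x \<in> {a + d |a d. a \<in> ?B' \<and> d \<in> (\<lambda>b. b + c) ` ?B}"
      then obtain a b where "a \<in> ?B'" "b \<in> ?B" "x = a + (b + c)" by auto
      then show "x \<in> (\<lambda>b. b + c) ` ?B'"
        using BB by (intro image_eqI[of _ _ "a + b"]) (auto intro: qbounds_add)
    next
      fix x assume "x \<in> (\<lambda>b. b + c) ` ?B'"
      then obtain a where a: "a \<in> ?B'" "x = a + (0 + c)" by auto
      moreover have "0 + c \<in> (\<lambda>b. b + c) ` ?B" by (rule imageI) simp
      ultimately show "x \<in> {a + d |a d. a \<in> ?B' \<and> d \<in> (\<lambda>b. b + c) ` ?B}"
        by (intro CollectI exI conjI)
    qed
    then show ?thesis
      using assms by (simp add: rat_homology_incl_def grp set_mult_addgrp rat_relboundaries_eq)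
  qed
  have carr: "carrier (hq p Y S) = (\<lambda>c. (\<lambda>b. b + c) ` ?B) ` qcycles p Y S"
    "carrier (hq p Y' S') = (\<lambda>c. (\<lambda>b. b + c) ` ?B') ` qcycles p Y' S'"
    using assms by (simp_all add: rat_homology_eq carrier_FactGroup r_coset_addgrp)
  have sub: "qcycles p Y S \<subseteq> qcycles p Y' S'" using assms by (intro qcycles_mono)
  have "rat_homology_incl p (top_of_set Y') S' ` carrier (hq p Y S) = (\<lambda>c. (\<lambda>b. b + c) ` ?B') ` qcycles p Y S"
    by (simp add: carr image_image incl)
  also have "\<dots> = carrier (hq p Y' S') \<longleftrightarrow>
     (\<forall>z\<in>qcycles p Y' S'. \<exists>c\<in>qcycles p Y S. (\<lambda>b. b + z) ` ?B' = (\<lambda>b. b + c) ` ?B')"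
    unfolding carr by (rule image_eq_image_iff[OF sub])
  also have "\<dots> \<longleftrightarrow> rel_surj p Y S Y' S'"
    by (simp add: rel_surj_def coset_eq_iff add_closed_qbounds)
  finally show ?thesis .
qed

text \<open>
  One and the same \<open>\<phi>\<close> serves both pairs, so it commutes with the inclusion already on chains.
\<close>
lemma qiso_rel_surj_iff:
  assumes i: "qiso p Y S p' Z T \<phi>" and i': "qiso p Y' S' p' Z' T' \<phi>"
    and "Y \<subseteq> Y'" "S \<subseteq> S'" "Z \<subseteq> Z'" "T \<subseteq> T'"
  shows "rel_surj p Y S Y' S' \<longleftrightarrow> rel_surj p' Z T Z' T'"
proof -
  have cy: "qcycles p Y S \<subseteq> qcycles p Y' S'" and bd: "qbounds p' Z T \<subseteq> qbounds p' Z' T'"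
    using qcycles_mono[OF assms(3,4)] qbounds_mono[OF assms(5,6)] by auto
  have add: "\<phi> (a + b) = \<phi> a + \<phi> b" for a b using i by (simp add: qiso_def)
  have diff: "\<phi> (a - b) = \<phi> a - \<phi> b" for a b using add[of "a - b" b] by (simp add: algebra_simps)
  show ?thesis
  proof
    assume L: "rel_surj p Y S Y' S'"
    show "rel_surj p' Z T Z' T'"
      unfolding rel_surj_def
    proof
      fix z assume "z \<in> qcycles p' Z' T'"
      then obtain c where c: "c \<in> qcycles p Y' S'" "z - \<phi> c \<in> qbounds p' Z' T'"
        using i' by (auto simp: qiso_def)
      then obtain c0 where c0: "c0 \<in> qcycles p Y S" "c - c0 \<in> qbounds p Y' S'"
        using L by (auto simp: rel_surj_def)
      have "\<phi> (c - c0) \<in> qbounds p' Z' T'"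
        using c0 c cy i' by (auto simp: qiso_def qcycles_diff subset_iff)
      then have "(z - \<phi> c) + (\<phi> c - \<phi> c0) \<in> qbounds p' Z' T'"
        using c by (intro qbounds_add) (auto simp: diff)
      moreover have "\<phi> c0 \<in> qcycles p' Z T" using i c0 by (auto simp: qiso_def)
      ultimately show "\<exists>c\<in>qcycles p' Z T. z - c \<in> qbounds p' Z' T'"
        by (intro bexI[of _ "\<phi> c0"]) auto
    qed
  next
    assume R: "rel_surj p' Z T Z' T'"
    show "rel_surj p Y S Y' S'"
      unfolding rel_surj_def
    proof
      fix c assume c: "c \<in> qcycles p Y' S'"
      then have "\<phi> c \<in> qcycles p' Z' T'" using i' by (auto simp: qiso_def)
      then obtain z where z: "z \<in> qcycles p' Z T" "\<phi> c - z \<in> qbounds p' Z' T'"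
        using R by (auto simp: rel_surj_def)
      then obtain c0 where c0: "c0 \<in> qcycles p Y S" "z - \<phi> c0 \<in> qbounds p' Z T"
        using i by (auto simp: qiso_def)
      then have "(\<phi> c - z) + (z - \<phi> c0) \<in> qbounds p' Z' T'"
        using bd z by (intro qbounds_add) auto
      then have "\<phi> (c - c0) \<in> qbounds p' Z' T'" by (simp add: diff)
      moreover have "c - c0 \<in> qcycles p Y' S'" using c c0 cy by (auto intro: qcycles_diff)
      ultimately have "c - c0 \<in> qbounds p Y' S'" using i' by (auto simp: qiso_def)
      then show "\<exists>c0\<in>qcycles p Y S. c - c0 \<in> qbounds p Y' S'" using c0 by blast
    qed
  qed
qed

lemma qiso_acyclic_iff:
  assumes "qiso p Y S p' Z T \<phi>" "S \<subseteq> Y" "T \<subseteq> Z"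
  shows "acyclic_at p Y S \<longleftrightarrow> acyclic_at p' Z T"

  using isomorphic_group_triviality[OF qiso_imp_iso[OF assms]
      group_rat_homology[OF assms(2)] group_rat_homology[OF assms(3)]]
  by (simp add: trivial_rat_homology_iff assms(2,3))

section \<open>Chain maps\<close>

lemma qchain_map_compose: "qchain_map p g (qchain_map p f c) = qchain_map p (g \<circ> f) c"
proof -
  obtain r c' where "r \<noteq> 0" "c = qscale r (rat_of_chain c')" by (rule rat_chain_as_integral)
  then show ?thesis by (simp add: qchain_map_qscale qchain_map_of chain_map_compose)
qed

lemma qchain_map_cong:
  assumes "c \<in> qchains p Y" "\<And>y. y \<in> Y \<Longrightarrow> f y = g y"
  shows "qchain_map p f c = qchain_map p g c"
proof -
  obtain r c' where r: "r \<noteq> 0" "c = qscale r (rat_of_chain c')" and c': "singular_chain p (top_of_set Y) c'"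
    by (rule qchains_as_integral[OF assms(1)])
  from c' have "chain_map p f c' = chain_map p g c'"
    using assms by (intro chain_map_eq) auto
  then show ?thesis using r by (simp add: qchain_map_qscale qchain_map_of)
qed

lemma qchain_map_id:
  assumes "c \<in> qchains p Y" "\<And>y. y \<in> Y \<Longrightarrow> f y = y"
  shows "qchain_map p f c = c"
proof -
  obtain r c' where r: "r \<noteq> 0" "c = qscale r (rat_of_chain c')" and c': "singular_chain p (top_of_set Y) c'"
    by (rule qchains_as_integral[OF assms(1)])
  from c' have "chain_map p f c' = c'"
    using assms by (intro chain_map_id_gen) auto
  then show ?thesis using r by (simp add: qchain_map_qscale qchain_map_of)
qed

lemma qchains_chain_map:
  assumes "c \<in> qchains p Y" "continuous_on Y g" "g ` Y \<subseteq> Z"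
  shows "qchain_map p g c \<in> qchains p Z"
proof -
  obtain r c' where r: "r \<noteq> 0" "c = qscale r (rat_of_chain c')" and c': "singular_chain p (top_of_set Y) c'"
    by (rule qchains_as_integral[OF assms(1)])
  have "continuous_map (top_of_set Y) (top_of_set Z) g"
    using assms by (auto simp: continuous_map_in_subtopology)
  with c' have "singular_chain p (top_of_set Z) (chain_map p g c')"
    by (rule singular_chain_chain_map)
  then show ?thesis using r by (simp add: qchain_map_qscale qchain_map_of qchains_qscale_iff qchains_of_iff)
qed

lemma rat_boundary_chain_map:
  assumes "c \<in> qchains p Y"
  shows "rat_boundary p (qchain_map p g c) = qchain_map (p - 1) g (rat_boundary p c)"
proof -
  obtain r c' where r: "r \<noteq> 0" "c = qscale r (rat_of_chain c')" and c': "singular_chain p (top_of_set Y) c'"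
    by (rule qchains_as_integral[OF assms(1)])
  from c' have "chain_boundary p (chain_map p g c') = chain_map (p - Suc 0) g (chain_boundary p c')"
    by (rule chain_boundary_chain_map)
  then show ?thesis
    using r by (simp add: qchain_map_qscale qchain_map_of rat_boundary_qscale rat_boundary_of)
qed

lemma qcycles_chain_map:
  assumes "c \<in> qcycles p Y S" "S \<subseteq> Y" "continuous_on Y g" "g ` Y \<subseteq> Z" "g ` S \<subseteq> T"
  shows "qchain_map p g c \<in> qcycles p Z T"
  using assms continuous_on_subset[OF assms(3,2)]
  by (auto simp: qcycles_def rat_boundary_chain_map intro!: qchains_chain_map del: image_subsetI)

lemma qbounds_chain_map:
  assumes "c \<in> qbounds p Y S" "S \<subseteq> Y" "continuous_on Y g" "g ` Y \<subseteq> Z" "g ` S \<subseteq> T"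
  shows "qchain_map p g c \<in> qbounds p Z T"
proof -
  obtain d e where de: "d \<in> qchains (Suc p) Y" "e \<in> qchains p S" "c = rat_boundary (Suc p) d + e"
    using assms(1) by (auto simp: qbounds_iff)
  then have "qchain_map p g c = rat_boundary (Suc p) (qchain_map (Suc p) g d) + qchain_map p g e"
    by (simp add: qchain_map_add rat_boundary_chain_map)
  then show ?thesis
    unfolding qbounds_iff using assms de continuous_on_subset[OF assms(3,2)]
    by (intro bexI[of _ "qchain_map (Suc p) g d"] bexI[of _ "qchain_map p g e"])
      (auto intro!: qchains_chain_map del: image_subsetI)
qed

section \<open>Homotopy invariance\<close>

lemma homotopic_chain_maps:
  fixes H :: "real \<times> 'a::topological_space \<Rightarrow> 'b::topological_space"
  assumes "S \<subseteq> Y" "T \<subseteq> Z"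
    and cont: "continuous_on ({0..1} \<times> Y) H"
    and HY: "\<And>t y. t \<in> {0..1} \<Longrightarrow> y \<in> Y \<Longrightarrow> H (t, y) \<in> Z"
    and HS: "\<And>t y. t \<in> {0..1} \<Longrightarrow> y \<in> S \<Longrightarrow> H (t, y) \<in> T"
    and c: "c \<in> qcycles p Y S"
  shows "qchain_map p (\<lambda>y. H (0, y)) c - qchain_map p (\<lambda>y. H (1, y)) c \<in> qbounds p Z T"
proof -
  obtain r c' where r: "r \<noteq> 0" "c = qscale r (rat_of_chain c')" by (rule rat_chain_as_integral)
  then have c': "singular_relcycle p (top_of_set Y) S c'"
    using c by (simp add: qcycles_qscale_iff qcycles_of_iff[OF \<open>S \<subseteq> Y\<close>])
  have "continuous_map (prod_topology (top_of_set {0..1}) (top_of_set Y)) (top_of_set Z) H"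
    using cont HY by (auto simp: continuous_map_in_subtopology subtopology_Times[symmetric]
        euclidean_product_topology)
  then have "homotopic_with (\<lambda>h. h \<in> S \<rightarrow> T) (top_of_set Y) (top_of_set Z) (\<lambda>y. H (0, y)) (\<lambda>y. H (1, y))"
    unfolding homotopic_with_def using HS by (intro exI[of _ H]) auto
  from homotopic_imp_homologous_rel_chain_maps[OF this c']
  have "rat_of_chain (chain_map p (\<lambda>y. H (0, y)) c' - chain_map p (\<lambda>y. H (1, y)) c') \<in> qbounds p Z T"
    unfolding homologous_rel_def by (rule qbounds_of[OF \<open>T \<subseteq> Z\<close>])
  from qbounds_qscale[OF this, of r] show ?thesis
    using r by (simp add: qchain_map_qscale qchain_map_of rat_of_chain_diff qscale_diff)
qed

lemma homotopic_to_id: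
  fixes H :: "real \<times> 'a::topological_space \<Rightarrow> 'a"
  assumes "S \<subseteq> Y"
    and "continuous_on ({0..1} \<times> Y) H"
    and "\<And>t y. t \<in> {0..1} \<Longrightarrow> y \<in> Y \<Longrightarrow> H (t, y) \<in> Y"
    and "\<And>t y. t \<in> {0..1} \<Longrightarrow> y \<in> S \<Longrightarrow> H (t, y) \<in> S"
    and "\<And>y. y \<in> Y \<Longrightarrow> H (0, y) = y"
    and c: "c \<in> qcycles p Y S"
  shows "c - qchain_map p (\<lambda>y. H (1, y)) c \<in> qbounds p Y S"
proof -
  have "qchain_map p (\<lambda>y. H (0, y)) c = c"
    using c assms by (intro qchain_map_id[of _ _ Y]) (auto simp: qcycles_def)
  then show ?thesis using homotopic_chain_maps[of S Y S Y H c p] assms by simp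
qed

lemma continuous_on_slice:
  fixes H :: "real \<times> 'a::topological_space \<Rightarrow> 'b::topological_space"
  assumes "continuous_on ({0..1} \<times> Y) H" "t \<in> {0..1}"
  shows "continuous_on Y (\<lambda>y. H (t, y))"
  by (rule continuous_on_compose2[OF assms(1)]) (use assms(2) in \<open>auto intro!: continuous_intros\<close>)

proposition qiso_homotopy_equivalence:
  fixes F :: "'a::topological_space \<Rightarrow> 'b::topological_space"
  assumes "S \<subseteq> Y" "T \<subseteq> Z"
    and F: "continuous_on Y F" "F ` Y \<subseteq> Z" "F ` S \<subseteq> T"
    and G: "continuous_on Z G" "G ` Z \<subseteq> Y" "G ` T \<subseteq> S"
    and H: "continuous_on ({0..1} \<times> Y) H"
      "\<And>t y. t \<in> {0..1} \<Longrightarrow> y \<in> Y \<Longrightarrow> H (t, y) \<in> Y"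
      "\<And>t y. t \<in> {0..1} \<Longrightarrow> y \<in> S \<Longrightarrow> H (t, y) \<in> S"
      "\<And>y. y \<in> Y \<Longrightarrow> H (0::real, y) = y" "\<And>y. y \<in> Y \<Longrightarrow> H (1, y) = G (F y)"
    and K: "continuous_on ({0..1} \<times> Z) K"
      "\<And>t z. t \<in> {0..1} \<Longrightarrow> z \<in> Z \<Longrightarrow> K (t, z) \<in> Z"
      "\<And>t z. t \<in> {0..1} \<Longrightarrow> z \<in> T \<Longrightarrow> K (t, z) \<in> T"
      "\<And>z. z \<in> Z \<Longrightarrow> K (0::real, z) = z" "\<And>z. z \<in> Z \<Longrightarrow> K (1, z) = F (G z)"
  shows "qiso p Y S p Z T (qchain_map p F)"
  unfolding qiso_def
proof (intro conjI allI ballI)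
  show "qchain_map p F (a + b) = qchain_map p F a + qchain_map p F b" for a b
    by (rule qchain_map_add)
  fix c assume c: "c \<in> qcycles p Y S"
  show "qchain_map p F c \<in> qcycles p Z T"
    using qcycles_chain_map[OF c \<open>S \<subseteq> Y\<close> F] .
  show "qchain_map p F c \<in> qbounds p Z T \<longleftrightarrow> c \<in> qbounds p Y S"
  proof
    assume "c \<in> qbounds p Y S"
    then show "qchain_map p F c \<in> qbounds p Z T"
      using qbounds_chain_map[OF _ \<open>S \<subseteq> Y\<close> F] by blast
  next
    assume "qchain_map p F c \<in> qbounds p Z T"
    then have "qchain_map p G (qchain_map p F c) \<in> qbounds p Y S"
      using qbounds_chain_map[OF _ \<open>T \<subseteq> Z\<close> G] by blast
    moreover have "qchain_map p G (qchain_map p F c) = qchain_map p (\<lambda>y. H (1, y)) c"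
      unfolding qchain_map_compose using c H(5)
      by (intro qchain_map_cong[of _ _ Y]) (auto simp: qcycles_def)
    ultimately show "c \<in> qbounds p Y S"
      using homotopic_to_id[OF \<open>S \<subseteq> Y\<close> H(1-4) c] qbounds_add by fastforce
  qed
next
  fix z assume z: "z \<in> qcycles p Z T"
  have "qchain_map p F (qchain_map p G z) = qchain_map p (\<lambda>y. K (1, y)) z"
    unfolding qchain_map_compose using z K(5)
    by (intro qchain_map_cong[of _ _ Z]) (auto simp: qcycles_def)
  then have "z - qchain_map p F (qchain_map p G z) \<in> qbounds p Z T"
    using homotopic_to_id[OF \<open>T \<subseteq> Z\<close> K(1-4) z] by simp
  then show "\<exists>c\<in>qcycles p Y S. z - qchain_map p F c \<in> qbounds p Z T"
    using qcycles_chain_map[OF z \<open>T \<subseteq> Z\<close> G] by blast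
qed

text \<open>
  The homotopy pushes \<open>(Y,S)\<close> into \<open>(Y',S')\<close>. It has to preserve the smaller pair, not to fix its points, so
  this covers pushes that move everything.
\<close>
proposition qiso_deformation:
  fixes H :: "real \<times> 'a::topological_space \<Rightarrow> 'a"
  assumes sub: "S \<subseteq> Y" "Y' \<subseteq> Y" "S' \<subseteq> S" "S' \<subseteq> Y'"
    and H: "continuous_on ({0..1} \<times> Y) H" "\<And>y. y \<in> Y \<Longrightarrow> H (0, y) = y"
    and pres: "\<And>t y. t \<in> {0..1} \<Longrightarrow> y \<in> Y \<Longrightarrow> H (t, y) \<in> Y"
      "\<And>t y. t \<in> {0..1} \<Longrightarrow> y \<in> S \<Longrightarrow> H (t, y) \<in> S"
      "\<And>t y. t \<in> {0..1} \<Longrightarrow> y \<in> Y' \<Longrightarrow> H (t, y) \<in> Y'"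
      "\<And>t y. t \<in> {0..1} \<Longrightarrow> y \<in> S' \<Longrightarrow> H (t, y) \<in> S'"
    and end1: "\<And>y. y \<in> Y \<Longrightarrow> H (1, y) \<in> Y'" "\<And>y. y \<in> S \<Longrightarrow> H (1, y) \<in> S'"
  shows "qiso p Y' S' p Y S (\<lambda>c. c)"
  unfolding qiso_def
proof (intro conjI allI ballI)
  let ?h = "\<lambda>y. H (1, y)"
  have cont: "continuous_on Y ?h"
    using continuous_on_slice[OF H(1), of 1] by simp
  have cont': "continuous_on ({0..1} \<times> Y') H"
    using continuous_on_subset[OF H(1), of "{0..1} \<times> Y'"] sub by auto
  have h: "?h ` Y \<subseteq> Y'" "?h ` S \<subseteq> S'" using end1 by auto
  fix c assume c: "c \<in> qcycles p Y' S'"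
  show "c \<in> qcycles p Y S" using c qcycles_mono[OF sub(2,3)] by blast
  show "c \<in> qbounds p Y S \<longleftrightarrow> c \<in> qbounds p Y' S'"
  proof
    assume "c \<in> qbounds p Y S"
    then have "qchain_map p ?h c \<in> qbounds p Y' S'"
      using qbounds_chain_map[OF _ sub(1) cont h] by blast
    moreover have "c - qchain_map p ?h c \<in> qbounds p Y' S'"
      using homotopic_to_id[OF sub(4) cont' pres(3,4) _ c] sub H(2) by blast
    ultimately show "c \<in> qbounds p Y' S'" using qbounds_add by fastforce
  qed (use qbounds_mono[OF sub(2,3)] in blast)
next
  let ?h = "\<lambda>y. H (1, y)"
  have cont: "continuous_on Y ?h"
    using continuous_on_slice[OF H(1), of 1] by simp
  have h: "?h ` Y \<subseteq> Y'" "?h ` S \<subseteq> S'" using end1 by auto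
  fix z assume z: "z \<in> qcycles p Y S"
  then have "qchain_map p ?h z \<in> qcycles p Y' S'"
    using qcycles_chain_map[OF _ sub(1) cont h] by blast
  moreover have "z - qchain_map p ?h z \<in> qbounds p Y S"
    using homotopic_to_id[OF sub(1) H(1) pres(1,2) H(2) z] by blast
  ultimately show "\<exists>c\<in>qcycles p Y' S'. z - c \<in> qbounds p Y S" by blast
qed simp

lemma acyclic_atD: "acyclic_at p Y S \<Longrightarrow> z \<in> qcycles p Y S \<Longrightarrow> z \<in> qbounds p Y S"
  by (auto simp: acyclic_at_def)

lemma acyclic_atE:
  assumes "acyclic_at p Y S" "z \<in> qcycles p Y S"
  obtains y w where "y \<in> qchains (Suc p) Y" "w \<in> qchains p S" "z = rat_boundary (Suc p) y + w"
  using acyclic_atD[OF assms] unfolding qbounds_iff by blast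

lemma acyclic_deformation:
  fixes H :: "real \<times> 'a::topological_space \<Rightarrow> 'a"
  assumes sub: "S \<subseteq> Y"
    and H: "continuous_on ({0..1} \<times> Y) H" "\<And>y. y \<in> Y \<Longrightarrow> H (0, y) = y"
    and pres: "\<And>t y. t \<in> {0..1} \<Longrightarrow> y \<in> Y \<Longrightarrow> H (t, y) \<in> Y"
      "\<And>t y. t \<in> {0..1} \<Longrightarrow> y \<in> S \<Longrightarrow> H (t, y) \<in> S"
    and end1: "\<And>y. y \<in> Y \<Longrightarrow> H (1, y) \<in> S"
  shows "acyclic_at p Y S"
  unfolding acyclic_at_def
proof
  let ?h = "\<lambda>y. H (1, y)"
  fix z assume z: "z \<in> qcycles p Y S"
  have cont: "continuous_on Y ?h"
    using continuous_on_slice[OF H(1), of 1] by simp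
  have "qchain_map p ?h z \<in> qchains p S"
    using z end1 by (intro qchains_chain_map[OF _ cont]) (auto simp: qcycles_def)
  then have "qchain_map p ?h z \<in> qbounds p Y S" by (rule qchains_qbounds)
  moreover have "z - qchain_map p ?h z \<in> qbounds p Y S"
    using homotopic_to_id[OF sub H(1) pres(1,2) H(2) z] by blast
  ultimately show "z \<in> qbounds p Y S" using qbounds_add by fastforce
qed

section \<open>Excision and exact sequences\<close>

text \<open>
  Excision of \<open>A - V\<close>. Subdivision of integral cycles gives surjectivity. For injectivity,
  the integral theorem is applied to a multiple of the cycle that bounds integrally.
\<close>
proposition qiso_excision:
  fixes A :: "'a::topological_space set"
  assumes A: "A = V \<union> B" and V: "openin (top_of_set A) V" and B: "openin (top_of_set A) B"
  shows "qiso p V (V \<inter> B) p A B (\<lambda>c. c)"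
proof -
  let ?X = "top_of_set A" and ?U = "A - V"
  have "B \<subseteq> A" "V \<subseteq> A" using A by auto
  have UV: "A - ?U = V" "B - ?U = V \<inter> B" using A by auto
  have "closedin ?X ?U" using V by (metis closedin_diff closedin_topspace topspace_euclidean_subtopology)
  then have cl: "?X closure_of ?U \<subseteq> ?X interior_of B"
    using B A by (auto simp: closure_of_closedin interior_of_openin)
  have tops: "subtopology ?X V = top_of_set V" "subtopology ?X A = ?X"
    using \<open>V \<subseteq> A\<close> by (auto simp: subtopology_subtopology Int_absorb1)
  have iso: "hom_induced (int p) (top_of_set V) (V \<inter> B) ?X B id
    \<in> iso (relative_homology_group (int p) (top_of_set V) (V \<inter> B)) (relative_homology_group (int p) ?X B)"
    using homology_excision_axiom[OF cl \<open>B \<subseteq> A\<close>, of "int p"] unfolding UV tops .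
  have integral: "singular_relboundary p (top_of_set V) (V \<inter> B) c"
    if c: "singular_relcycle p (top_of_set V) (V \<inter> B) c" and b: "singular_relboundary p ?X B c" for c
  proof -
    let ?h = "hom_induced (int p) (top_of_set V) (V \<inter> B) ?X B id"
    have contm: "continuous_map (top_of_set V) ?X id"
      using \<open>V \<subseteq> A\<close> by (auto simp: continuous_map_in_subtopology)
    have h: "?h (homologous_rel_set p (top_of_set V) (V \<inter> B) d) = homologous_rel_set p ?X B d"
      if d: "singular_relcycle p (top_of_set V) (V \<inter> B) d" for d
    proof -
      have "chain_map p id d = d"
        using d by (intro chain_map_ident[of _ "top_of_set V"]) (simp add: singular_relcycle)
      then show ?thesis using hom_induced_chain_map[OF contm _ d, of B] by auto
    qed
    have "homologous_rel_set p ?X B c = homologous_rel_set p ?X B 0"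
      unfolding homologous_rel_set_eq using b by (simp add: homologous_rel_def)
    then have "?h (homologous_rel_set p (top_of_set V) (V \<inter> B) c)
        = ?h (homologous_rel_set p (top_of_set V) (V \<inter> B) 0)"
      using h[OF c] h[of 0] by simp
    moreover have "inj_on ?h (carrier (relative_homology_group (int p) (top_of_set V) (V \<inter> B)))"
      using iso by (auto simp: iso_def bij_betw_def)
    moreover have "homologous_rel_set p (top_of_set V) (V \<inter> B) d \<in> carrier (relative_homology_group (int p) (top_of_set V) (V \<inter> B))"
      if "singular_relcycle p (top_of_set V) (V \<inter> B) d" for d
      using that by (simp add: carrier_relative_homology_group)
    ultimately have "homologous_rel_set p (top_of_set V) (V \<inter> B) c = homologous_rel_set p (top_of_set V) (V \<inter> B) 0"
      using c by (auto dest: inj_onD)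
    then show ?thesis unfolding homologous_rel_set_eq by (simp add: homologous_rel_def)
  qed
  show ?thesis
    unfolding qiso_def
  proof (intro conjI allI ballI)
  fix c assume c: "c \<in> qcycles p V (V \<inter> B)"
  show "c \<in> qcycles p A B" using c qcycles_mono[OF \<open>V \<subseteq> A\<close>, of "V \<inter> B" B] by blast
  show "c \<in> qbounds p A B \<longleftrightarrow> c \<in> qbounds p V (V \<inter> B)"
  proof
    assume b: "c \<in> qbounds p A B"
    obtain r c' where r: "r \<noteq> 0" "c = qscale r (rat_of_chain c')" by (rule rat_chain_as_integral)
    have "rat_of_chain c' = qscale (1/r) c" using r by simp
    then have "rat_of_chain c' \<in> qbounds p A B" using b by (metis qbounds_qscale)
    then obtain n where n: "n \<noteq> 0" "singular_relboundary p ?X B (frag_cmul n c')"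
      using qbounds_of_multiple[OF \<open>B \<subseteq> A\<close>] by blast
    have "singular_relcycle p (top_of_set V) (V \<inter> B) c'"
      using c r by (simp add: qcycles_qscale_iff qcycles_of_iff)
    then have "singular_relcycle p (top_of_set V) (V \<inter> B) (frag_cmul n c')"
      by (rule singular_relcycle_cmul)
    from integral[OF this n(2)] have "rat_of_chain (frag_cmul n c') \<in> qbounds p V (V \<inter> B)"
      by (intro qbounds_of) auto
    then have "qscale (r / of_int n) (rat_of_chain (frag_cmul n c')) \<in> qbounds p V (V \<inter> B)"
      by (rule qbounds_qscale)
    then show "c \<in> qbounds p V (V \<inter> B)" using r n by (simp add: rat_of_chain_cmul)
  qed (use qbounds_mono[OF \<open>V \<subseteq> A\<close>, of "V \<inter> B" B] in blast)
next
  fix z assume z: "z \<in> qcycles p A B"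
  obtain r z' where r: "r \<noteq> 0" "z = qscale r (rat_of_chain z')" by (rule rat_chain_as_integral)
  have "singular_relcycle p ?X B z'"
    using z r by (simp add: qcycles_qscale_iff qcycles_of_iff[OF \<open>B \<subseteq> A\<close>])
  then have "singular_relcycle p (subtopology ?X A) B z'" by (simp add: tops)
  then obtain c' where c': "singular_relcycle p (subtopology ?X (A - ?U)) (B - ?U) c'"
    "homologous_rel p (subtopology ?X A) B z' c'"
    using excised_relcycle_exists[OF cl \<open>B \<subseteq> A\<close>] by blast
  then have "rat_of_chain c' \<in> qcycles p V (V \<inter> B)"
    unfolding UV tops by (subst qcycles_of_iff) auto
  moreover have "rat_of_chain (z' - c') \<in> qbounds p A B"
    using c' \<open>B \<subseteq> A\<close> unfolding tops homologous_rel_def by (intro qbounds_of)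
  from qbounds_qscale[OF this, of r] have "z - qscale r (rat_of_chain c') \<in> qbounds p A B"
    using r by (simp add: rat_of_chain_diff qscale_diff)
  ultimately show "\<exists>c\<in>qcycles p V (V \<inter> B). z - c \<in> qbounds p A B"
    using r(1) by (intro bexI[of _ "qscale r (rat_of_chain c')"]) (simp_all add: qcycles_qscale_iff)
  qed simp
qed

text \<open>
  In the exact sequence of the triple \<open>S \<subseteq> P \<subseteq> Y\<close>, the groups of \<open>(Y,S)\<close> vanish, which leaves an
  isomorphism.
\<close>
proposition qiso_boundary:
  assumes sub: "S \<subseteq> P" "P \<subseteq> Y" and ac: "acyclic_at (Suc p) Y S" "acyclic_at p Y S"
  shows "qiso (Suc p) Y P p P S (rat_boundary (Suc p))"
  unfolding qiso_def
proof (intro conjI allI ballI)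
  show "rat_boundary (Suc p) (a + b) = rat_boundary (Suc p) a + rat_boundary (Suc p) b" for a b
    by (rule rat_boundary_add)
  fix c assume c: "c \<in> qcycles (Suc p) Y P"
  show "rat_boundary (Suc p) c \<in> qcycles p P S"
    using c by (auto simp: qcycles_def rat_boundary_boundary)
  show "rat_boundary (Suc p) c \<in> qbounds p P S \<longleftrightarrow> c \<in> qbounds (Suc p) Y P"
  proof
    assume "rat_boundary (Suc p) c \<in> qbounds p P S"
    then obtain d e where d: "d \<in> qchains (Suc p) P" "e \<in> qchains p S"
      "rat_boundary (Suc p) c = rat_boundary (Suc p) d + e"
      by (auto simp: qbounds_iff)
    have "c - d \<in> qcycles (Suc p) Y S"
      using c d qchains_mono[OF sub(2), of "Suc p"]
      by (auto simp: qcycles_def rat_boundary_diff intro!: qchains_diff)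
    then have "c - d \<in> qbounds (Suc p) Y S" using ac by (auto simp: acyclic_at_def)
    then have "c - d \<in> qbounds (Suc p) Y P" using qbounds_mono[OF subset_refl sub(1)] by blast
    then have "(c - d) + d \<in> qbounds (Suc p) Y P"
      using d by (intro qbounds_add) (auto intro: qchains_qbounds)
    then show "c \<in> qbounds (Suc p) Y P" by simp
  next
    assume "c \<in> qbounds (Suc p) Y P"
    then obtain d e where d: "d \<in> qchains (Suc (Suc p)) Y" "e \<in> qchains (Suc p) P"
      "c = rat_boundary (Suc (Suc p)) d + e"
      by (auto simp: qbounds_iff)
    then have "rat_boundary (Suc p) c = rat_boundary (Suc p) e + 0"
      by (simp add: rat_boundary_add rat_boundary_boundary)
    then show "rat_boundary (Suc p) c \<in> qbounds p P S"
      unfolding qbounds_iff using d qchains_0 by blast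
  qed
next
  fix z assume z: "z \<in> qcycles p P S"
  then have "z \<in> qcycles p Y S" using qcycles_mono[OF sub(2) subset_refl] by blast
  then obtain y w where y: "y \<in> qchains (Suc p) Y" "w \<in> qchains p S" "z = rat_boundary (Suc p) y + w"
    by (rule acyclic_atE[OF ac(2)])
  have "rat_boundary (Suc p) y = z - w" using y by simp
  also have "\<dots> \<in> qchains p P"
    using z y(2) qchains_mono[OF sub(1), of p] by (auto simp: qcycles_def intro: qchains_diff)
  finally have "y \<in> qcycles (Suc p) Y P" using y by (simp add: qcycles_def)
  moreover have "z - rat_boundary (Suc p) y \<in> qbounds p P S"
    using y by (simp add: qchains_qbounds)
  ultimately show "\<exists>c\<in>qcycles (Suc p) Y P. z - rat_boundary (Suc p) c \<in> qbounds p P S" by blast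
qed

text \<open>
  The lowest degree, which \<open>qiso_boundary\<close> does not reach: every chain of degree 0 is a cycle.
\<close>
lemma acyclic_at_0_mono:
  assumes "acyclic_at 0 Y S" "S \<subseteq> P" shows "acyclic_at 0 Y P"
proof -
  have "qcycles 0 Y P = qcycles 0 Y S" by (auto simp: qcycles_def rat_boundary_def)
  then show ?thesis
    using assms qbounds_mono[OF subset_refl assms(2), of 0 Y] by (auto simp: acyclic_at_def)
qed

text \<open>
  This lemma and the next are exactness of the sequence of the triple \<open>B \<subseteq> A \<subseteq> X\<close>, at \<open>(X,B)\<close> and \<open>(A,B)\<close>.
\<close>
lemma acyclic_triple_outer:
  assumes "B \<subseteq> A" "A \<subseteq> X" "acyclic_at i A B" "acyclic_at i X A"
  shows "acyclic_at i X B"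
  unfolding acyclic_at_def
proof
  fix z assume z: "z \<in> qcycles i X B"
  then have "z \<in> qcycles i X A" using qcycles_mono[OF subset_refl assms(1)] by blast
  then obtain y w where y: "y \<in> qchains (Suc i) X" "w \<in> qchains i A" "z = rat_boundary (Suc i) y + w"
    by (rule acyclic_atE[OF assms(4)])
  have "rat_boundary i z = rat_boundary i w"
    using y by (simp add: rat_boundary_add rat_boundary_boundary)
  then have "w \<in> qcycles i A B" using z y by (simp add: qcycles_def)
  then have "w \<in> qbounds i X B"
    using assms(3) qbounds_mono[OF assms(2) subset_refl] by (auto simp: acyclic_at_def)
  moreover have "rat_boundary (Suc i) y \<in> qbounds i X B"
    unfolding qbounds_iff using y qchains_0 by (metis add_0_right)
  ultimately show "z \<in> qbounds i X B" using y by (simp add: qbounds_add)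
qed

lemma acyclic_triple_inner:
  assumes "B \<subseteq> A" "A \<subseteq> X" "acyclic_at (Suc i) X A" "acyclic_at i X B"
  shows "acyclic_at i A B"
  unfolding acyclic_at_def
proof
  fix z assume z: "z \<in> qcycles i A B"
  then have "z \<in> qcycles i X B" using qcycles_mono[OF assms(2) subset_refl] by blast
  then obtain y w where y: "y \<in> qchains (Suc i) X" "w \<in> qchains i B" "z = rat_boundary (Suc i) y + w"
    by (rule acyclic_atE[OF assms(4)])
  have "rat_boundary (Suc i) y = z - w" using y by simp
  also have "\<dots> \<in> qchains i A"
    using z y(2) qchains_mono[OF assms(1), of i] by (auto simp: qcycles_def intro: qchains_diff)
  finally have "y \<in> qcycles (Suc i) X A" using y by (simp add: qcycles_def)
  then obtain a b where a: "a \<in> qchains (Suc (Suc i)) X" "b \<in> qchains (Suc i) A" "y = rat_boundary (Suc (Suc i)) a + b"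
    by (rule acyclic_atE[OF assms(3)])
  then have "z = rat_boundary (Suc i) b + w"
    using y by (simp add: rat_boundary_add rat_boundary_boundary)
  then show "z \<in> qbounds i A B" unfolding qbounds_iff using a y by blast
qed

section \<open>Degree shifts between inclusions of pairs\<close>

definition incl_pairs :: "'a set \<Rightarrow> 'a set \<Rightarrow> 'a set \<Rightarrow> 'a set \<Rightarrow> bool" where
  "incl_pairs Y S Y' S' \<longleftrightarrow> S \<subseteq> Y \<and> S' \<subseteq> Y' \<and> Y \<subseteq> Y' \<and> S \<subseteq> S'"

text \<open>
  The inclusion \<open>(Y,S) \<subseteq> (Y',S')\<close> looks in homology like \<open>(Z,T) \<subseteq> (Z',T')\<close> with degrees raised by \<open>d\<close>.
  Only what a min-max value depends on is recorded: the groups of the larger pairs, which include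
  zero groups of \<open>(Z',T')\<close> below \<open>d\<close>, and surjectivity.
\<close>
definition homology_shift :: "nat \<Rightarrow>
    'a::topological_space set \<Rightarrow> 'a set \<Rightarrow> 'a set \<Rightarrow> 'a set \<Rightarrow>
    'b::topological_space set \<Rightarrow> 'b set \<Rightarrow> 'b set \<Rightarrow> 'b set \<Rightarrow> bool" where
  "homology_shift d Y S Y' S' Z T Z' T' \<longleftrightarrow>
     incl_pairs Y S Y' S' \<and> incl_pairs Z T Z' T' \<and>
     (\<forall>p. hq p Y' S' \<cong> hq (p + d) Z' T' \<and> (rel_surj p Y S Y' S' \<longleftrightarrow> rel_surj (p + d) Z T Z' T')) \<and>
     (\<forall>q<d. acyclic_at q Z' T')"

lemma homology_shiftI:
  assumes "incl_pairs Y S Y' S'" "incl_pairs Z T Z' T'"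
    and "\<And>p. \<exists>\<phi>. qiso p Y S (p + d) Z T \<phi> \<and> qiso p Y' S' (p + d) Z' T' \<phi>"
    and "\<And>q. q < d \<Longrightarrow> acyclic_at q Z' T'"
  shows "homology_shift d Y S Y' S' Z T Z' T'"
  unfolding homology_shift_def
proof (intro conjI allI impI)
  fix p
  obtain \<phi> where \<phi>: "qiso p Y S (p + d) Z T \<phi>" "qiso p Y' S' (p + d) Z' T' \<phi>"
    using assms(3) by blast
  show "hq p Y' S' \<cong> hq (p + d) Z' T'"
    using qiso_imp_iso[OF \<phi>(2)] assms(1,2) by (simp add: incl_pairs_def)
  show "rel_surj p Y S Y' S' \<longleftrightarrow> rel_surj (p + d) Z T Z' T'"
    using qiso_rel_surj_iff[OF \<phi>] assms(1,2) by (simp add: incl_pairs_def)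
qed (fact assms(1), fact assms(2), rule assms(4))

lemma homology_shiftI_reverse:
  assumes "incl_pairs Y S Y' S'" "incl_pairs Z T Z' T'"
    and "\<And>p. \<exists>\<phi>. qiso (p + d) Z T p Y S \<phi> \<and> qiso (p + d) Z' T' p Y' S' \<phi>"
    and "\<And>q. q < d \<Longrightarrow> acyclic_at q Z' T'"
  shows "homology_shift d Y S Y' S' Z T Z' T'"
  unfolding homology_shift_def
proof (intro conjI allI impI)
  fix p
  obtain \<phi> where \<phi>: "qiso (p + d) Z T p Y S \<phi>" "qiso (p + d) Z' T' p Y' S' \<phi>"
    using assms(3) by blast
  have sub: "S' \<subseteq> Y'" "T' \<subseteq> Z'" using assms(1,2) by (auto simp: incl_pairs_def)
  show "hq p Y' S' \<cong> hq (p + d) Z' T'"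
    by (rule group.iso_sym[OF group_rat_homology[OF sub(2)] qiso_imp_iso[OF \<phi>(2) sub(2,1)]])
  show "rel_surj p Y S Y' S' \<longleftrightarrow> rel_surj (p + d) Z T Z' T'"
    using qiso_rel_surj_iff[OF \<phi>] assms(1,2) by (simp add: incl_pairs_def)
qed (fact assms(1), fact assms(2), rule assms(4))

lemma homology_shiftD:
  assumes "homology_shift d Y S Y' S' Z T Z' T'"
  shows "incl_pairs Y S Y' S'" "incl_pairs Z T Z' T'"
    "hq p Y' S' \<cong> hq (p + d) Z' T'" "rel_surj p Y S Y' S' \<longleftrightarrow> rel_surj (p + d) Z T Z' T'"
    "q < d \<Longrightarrow> acyclic_at q Z' T'"
  using assms by (simp_all only: homology_shift_def)

lemma homology_shift_trans:
  assumes 1: "homology_shift d Y S Y' S' Z T Z' T'" and 2: "homology_shift d' Z T Z' T' W R W' R'"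
  shows "homology_shift (d + d') Y S Y' S' W R W' R'"
  unfolding homology_shift_def
proof (intro conjI allI impI)
  show "incl_pairs Y S Y' S'" "incl_pairs W R W' R'"
    using homology_shiftD(1)[OF 1] homology_shiftD(2)[OF 2] .
  fix p
  have "hq p Y' S' \<cong> hq (p + d + d') W' R'"
    by (rule iso_trans[OF homology_shiftD(3)[OF 1] homology_shiftD(3)[OF 2]])
  then show "hq p Y' S' \<cong> hq (p + (d + d')) W' R'" by (simp only: add.assoc)
  show "rel_surj p Y S Y' S' \<longleftrightarrow> rel_surj (p + (d + d')) W R W' R'"
    using homology_shiftD(4)[OF 1, of p] homology_shiftD(4)[OF 2, of "p + d"] by (simp only: add.assoc)
next
  fix q assume q: "q < d + d'"
  have sub: "T' \<subseteq> Z'" "R' \<subseteq> W'" using homology_shiftD(2)[OF 1] homology_shiftD(2)[OF 2] by (auto simp: incl_pairs_def)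
  show "acyclic_at q W' R'"
  proof (cases "q < d'")
    case True then show ?thesis by (rule homology_shiftD(5)[OF 2])
  next
    case False
    then obtain q' where q': "q = q' + d'" by (intro that[of "q - d'"]) simp
    have iso: "hq q' Z' T' \<cong> hq q W' R'" using homology_shiftD(3)[OF 2] q' by simp
    have "acyclic_at q' Z' T'" using q q' by (intro homology_shiftD(5)[OF 1]) simp
    then show ?thesis
      using isomorphic_group_triviality[OF iso group_rat_homology[OF sub(1)] group_rat_homology[OF sub(2)]]
        trivial_rat_homology_iff[OF sub(1), of q'] trivial_rat_homology_iff[OF sub(2), of q] by simp
  qed
qed

section \<open>Crossing with a line\<close>

text \<open>
  For \<open>W\<close> inside the kernel of \<open>\<phi>\<close> and \<open>\<phi> e = 1\<close> this is \<open>W + \<real> e\<close>.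
\<close>
definition cyl :: "('v \<Rightarrow> real) \<Rightarrow> 'v \<Rightarrow> 'v::real_vector set \<Rightarrow> 'v set" where
  "cyl \<phi> e W = {z. z - \<phi> z *\<^sub>R e \<in> W}"

text \<open>
  In the cylinder over \<open>(A,B)\<close> with height \<open>\<phi>\<close>, the points over \<open>B\<close> or of height in \<open>U\<close>; thus, with
  the full cylinder over \<open>A\<close>, the product of \<open>(A,B)\<close> and \<open>(\<real>,U)\<close>. Working with cylinders inside one vector
  space allows an induction on the number of coordinates without changing types.
\<close>
definition cyl_rel :: "('v \<Rightarrow> real) \<Rightarrow> 'v \<Rightarrow> real set \<Rightarrow> 'v::real_vector set \<Rightarrow> 'v set \<Rightarrow> 'v set" where
  "cyl_rel \<phi> e U A B = cyl \<phi> e B \<union> {z \<in> cyl \<phi> e A. \<phi> z \<in> U}"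

locale line_direction =
  fixes \<phi> :: "'v::real_normed_vector \<Rightarrow> real" and e :: 'v
  assumes lin: "bounded_linear \<phi>" and e1: "\<phi> e = 1"
begin

abbreviation "Cyl \<equiv> cyl \<phi> e"
abbreviation "Rel \<equiv> cyl_rel \<phi> e"

definition slide :: "real \<Rightarrow> real \<times> 'v \<Rightarrow> 'v" where
  "slide a = (\<lambda>(s, z). z + (s * (a - \<phi> z)) *\<^sub>R e)"

lemma phi_slide: "\<phi> (slide a (s, z)) = (1 - s) * \<phi> z + s * a"
  using e1 by (simp add: slide_def linear_simps[OF lin] algebra_simps)

lemma slide_mem_Cyl [simp]: "slide a (s, z) \<in> Cyl W \<longleftrightarrow> z \<in> Cyl W"
proof -
  have "slide a (s, z) - \<phi> (slide a (s, z)) *\<^sub>R e = z - \<phi> z *\<^sub>R e"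
    unfolding phi_slide by (simp add: slide_def algebra_simps)
  then show ?thesis by (simp add: cyl_def)
qed

lemma continuous_phi: "continuous_on S \<phi>"
  using lin by (rule linear_continuous_on)

lemma continuous_slide: "continuous_on S (slide a)"
  unfolding slide_def case_prod_unfold
  by (intro continuous_intros continuous_on_compose2[OF continuous_phi]) auto

lemma slide_0: "slide a (0, z) = z" by (simp add: slide_def)

lemma slide_convex:
  assumes "convex U" "a \<in> U" "\<phi> z \<in> U" "s \<in> {0..1}"
  shows "\<phi> (slide a (s, z)) \<in> U"
  using convexD_alt[OF assms(1,3,2), of s] assms(4) by (simp add: phi_slide)

lemma Rel_subset: "B \<subseteq> A \<Longrightarrow> Rel U A B \<subseteq> Cyl A"
  by (auto simp: cyl_rel_def cyl_def)

lemma Cyl_mono: "A \<subseteq> A' \<Longrightarrow> Cyl A \<subseteq> Cyl A'"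
  by (auto simp: cyl_def)

lemma Rel_mono: "A \<subseteq> A' \<Longrightarrow> B \<subseteq> B' \<Longrightarrow> U \<subseteq> U' \<Longrightarrow> Rel U A B \<subseteq> Rel U' A' B'"
  by (auto simp: cyl_rel_def cyl_def)

lemma Cyl_subset_Rel: "Cyl B \<subseteq> Rel U A B"
  by (auto simp: cyl_rel_def)

lemma slide_mem_Rel:
  assumes "convex U" "a \<in> U" "s \<in> {0..1}" "z \<in> Rel U A B"
  shows "slide a (s, z) \<in> Rel U A B"
  using assms slide_convex[of U a z s] by (auto simp: cyl_rel_def)

lemma acyclic_cylinder:
  assumes "B \<subseteq> A" "convex U" "a \<in> U"
  shows "acyclic_at p (Cyl A) (Rel U A B)"
proof (rule acyclic_deformation[where H = "slide a"])
  fix y assume "y \<in> Cyl A"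
  then show "slide a (1, y) \<in> Rel U A B" using assms by (simp add: cyl_rel_def phi_slide)
qed (use assms Rel_subset continuous_slide slide_0 slide_mem_Rel in auto)

lemma qiso_projection:
  assumes B: "B \<subseteq> A" and A: "A \<subseteq> {z. \<phi> z = 0}" and U: "convex U" "a \<in> U"
  shows "qiso p (Rel U A B) (Cyl B) p A B (qchain_map p (\<lambda>z. z - \<phi> z *\<^sub>R e))"
proof (rule qiso_homotopy_equivalence[where G = "\<lambda>z. z + a *\<^sub>R e" and H = "slide a" and K = snd])
  have G: "\<phi> (z + a *\<^sub>R e) = a" if "z \<in> A" for z
    using that A e1 by (auto simp: linear_simps[OF lin])
  show "(\<lambda>z. z + a *\<^sub>R e) ` A \<subseteq> Rel U A B"
    using G U by (auto simp: cyl_rel_def cyl_def)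
  show "(\<lambda>z. z + a *\<^sub>R e) ` B \<subseteq> Cyl B"
    using G B by (force simp: cyl_def)
  show "continuous_on (Rel U A B) (\<lambda>z. z - \<phi> z *\<^sub>R e)"
    by (intro continuous_intros continuous_phi)
  show "snd (1, z) = z + a *\<^sub>R e - \<phi> (z + a *\<^sub>R e) *\<^sub>R e" if "z \<in> A" for z
    using G[OF that] by simp
  show "slide a (1, y) = y - \<phi> y *\<^sub>R e + a *\<^sub>R e" for y
    by (simp add: slide_def algebra_simps)
  show "(\<lambda>z. z - \<phi> z *\<^sub>R e) ` Rel U A B \<subseteq> A" "(\<lambda>z. z - \<phi> z *\<^sub>R e) ` Cyl B \<subseteq> B"
    using B by (auto simp: cyl_rel_def cyl_def)
qed (use B U Cyl_subset_Rel continuous_slide slide_0 slide_mem_Rel in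
    \<open>auto intro!: continuous_intros\<close>)

lemma openin_Rel:
  assumes B: "openin (top_of_set A) B" and U: "open U" and "U \<subseteq> U'"
  shows "openin (top_of_set (Rel U' A B)) (Rel U A B)"
proof -
  obtain Q where Q: "open Q" "B = A \<inter> Q" using B by (auto simp: openin_open)
  let ?Q = "(\<lambda>z. z - \<phi> z *\<^sub>R e) -` Q \<union> \<phi> -` U"
  have "open ?Q"
    using Q U by (intro open_Un open_vimage continuous_intros continuous_phi)
  moreover have "Rel U A B = Rel U' A B \<inter> ?Q"
    using Q \<open>U \<subseteq> U'\<close> by (auto simp: cyl_rel_def cyl_def)
  ultimately show ?thesis by (auto simp: openin_open)
qed

lemma qiso_excise_half:
  assumes B: "openin (top_of_set A) B" and U: "open Lo" "open Hi" "Lo \<inter> Hi = {}"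
  shows "qiso p (Rel Hi A B) (Cyl B) p (Rel (Lo \<union> Hi) A B) (Rel Lo A B) (\<lambda>c. c)"
proof -
  have "Rel (Lo \<union> Hi) A B = Rel Hi A B \<union> Rel Lo A B" by (auto simp: cyl_rel_def)
  moreover have "Rel Hi A B \<inter> Rel Lo A B = Cyl B" using U by (auto simp: cyl_rel_def)
  moreover have "openin (top_of_set (Rel (Lo \<union> Hi) A B)) (Rel Hi A B)"
     "openin (top_of_set (Rel (Lo \<union> Hi) A B)) (Rel Lo A B)"
    using B U by (auto intro!: openin_Rel)
  ultimately show ?thesis
    using qiso_excision[of "Rel (Lo \<union> Hi) A B" "Rel Hi A B" "Rel Lo A B" p] by simp
qed

lemma qiso_suspension_boundary:
  assumes "B \<subseteq> A" "convex Lo" "a \<in> Lo"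
  shows "qiso (Suc p) (Cyl A) (Rel (Lo \<union> Hi) A B) p (Rel (Lo \<union> Hi) A B) (Rel Lo A B) (rat_boundary (Suc p))"
  using assms Rel_mono[OF subset_refl subset_refl, of Lo "Lo \<union> Hi"]
  by (intro qiso_boundary acyclic_cylinder Rel_subset) auto

text \<open>
  In shorthand: \<open>H\<^sub>p(A,B)\<close> is \<open>H\<^sub>p\<close> of the upper half relative to the cylinder over \<open>B\<close> (projection), hence
  \<open>H\<^sub>p\<close> of both halves relative to the lower one (excision), hence \<open>H\<^sub>p\<^sub>+\<^sub>1\<close> of the full
  cylinder relative to both halves, as the full cylinder contracts into the lower half.
\<close>
proposition suspension_shift:
  assumes A: "A' \<subseteq> {z. \<phi> z = 0}" and incl: "incl_pairs A B A' B'"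
    and B: "openin (top_of_set A) B" "openin (top_of_set A') B'"
    and Lo: "open Lo" "convex Lo" "a \<in> Lo" and Hi: "open Hi" "convex Hi" "b \<in> Hi" and disj: "Lo \<inter> Hi = {}"
  shows "homology_shift 1 A B A' B'
      (Cyl A) (Rel (Lo \<union> Hi) A B) (Cyl A') (Rel (Lo \<union> Hi) A' B')"
proof -
  have sub: "B \<subseteq> A" "B' \<subseteq> A'" "A \<subseteq> A'" "B \<subseteq> B'" using incl by (auto simp: incl_pairs_def)
  have A0: "A \<subseteq> {z. \<phi> z = 0}" using A sub by blast
  have 1: "homology_shift 0 A B A' B' (Rel Hi A B) (Cyl B) (Rel Hi A' B') (Cyl B')"
  proof (rule homology_shiftI_reverse)
    show "\<exists>\<psi>. qiso (p + 0) (Rel Hi A B) (Cyl B) p A B \<psi> \<and> qiso (p + 0) (Rel Hi A' B') (Cyl B') p A' B' \<psi>" for p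
      using qiso_projection[OF sub(1) A0 Hi(2,3), of p] qiso_projection[OF sub(2) A Hi(2,3), of p] by auto
  qed (use incl sub Cyl_mono Rel_mono Cyl_subset_Rel in \<open>auto simp: incl_pairs_def\<close>)
  have 2: "homology_shift 0 (Rel Hi A B) (Cyl B) (Rel Hi A' B') (Cyl B')
     (Rel (Lo \<union> Hi) A B) (Rel Lo A B) (Rel (Lo \<union> Hi) A' B') (Rel Lo A' B')"
  proof (rule homology_shiftI)
    show "\<exists>\<psi>. qiso p (Rel Hi A B) (Cyl B) (p + 0) (Rel (Lo \<union> Hi) A B) (Rel Lo A B) \<psi> \<and>
      qiso p (Rel Hi A' B') (Cyl B') (p + 0) (Rel (Lo \<union> Hi) A' B') (Rel Lo A' B') \<psi>" for p
      using qiso_excise_half[OF B(1) Lo(1) Hi(1) disj, of p] qiso_excise_half[OF B(2) Lo(1) Hi(1) disj, of p]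
      by auto
  qed (use sub Cyl_mono Rel_mono[OF sub(3,4)] Rel_mono[OF subset_refl subset_refl] Cyl_subset_Rel in
      \<open>auto simp: incl_pairs_def\<close>)
  have 3: "homology_shift 1 (Rel (Lo \<union> Hi) A B) (Rel Lo A B) (Rel (Lo \<union> Hi) A' B') (Rel Lo A' B')
      (Cyl A) (Rel (Lo \<union> Hi) A B) (Cyl A') (Rel (Lo \<union> Hi) A' B')"
  proof (rule homology_shiftI_reverse)
    show "\<exists>\<psi>. qiso (p + 1) (Cyl A) (Rel (Lo \<union> Hi) A B) p (Rel (Lo \<union> Hi) A B) (Rel Lo A B) \<psi> \<and>
       qiso (p + 1) (Cyl A') (Rel (Lo \<union> Hi) A' B') p (Rel (Lo \<union> Hi) A' B') (Rel Lo A' B') \<psi>" for p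
      using qiso_suspension_boundary[OF sub(1) Lo(2,3), of p Hi] qiso_suspension_boundary[OF sub(2) Lo(2,3), of p Hi]
      by auto
    show "acyclic_at q (Cyl A') (Rel (Lo \<union> Hi) A' B')" if "q < 1" for q
      using acyclic_at_0_mono[OF acyclic_cylinder[OF sub(2) Lo(2,3)], of "Rel (Lo \<union> Hi) A' B'"]
        Rel_mono[OF subset_refl subset_refl, of Lo "Lo \<union> Hi"] that by auto
  qed (use sub Cyl_mono Rel_mono[OF sub(3,4)] Rel_mono[OF subset_refl subset_refl] Rel_subset in
      \<open>auto simp: incl_pairs_def\<close>)
  show ?thesis
    using homology_shift_trans[OF homology_shift_trans[OF 1 2] 3] by simp
qed

text \<open>
  Here \<open>Lo\<close> or \<open>Hi\<close> may be empty. If exactly one is, the cylinder contracts into the other and all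
  homology vanishes; if both are, nothing is suspended and the degree bound only improves.
\<close>
lemma acyclic_suspension:
  assumes A: "A \<subseteq> {z. \<phi> z = 0}" "B \<subseteq> A" and B: "openin (top_of_set A) B"
    and Lo: "open Lo" "convex Lo" and Hi: "open Hi" "convex Hi" and disj: "Lo \<inter> Hi = {}"
    and ac: "\<And>q. q > d \<Longrightarrow> acyclic_at q A B" and q: "q > Suc d"
  shows "acyclic_at q (Cyl A) (Rel (Lo \<union> Hi) A B)"
proof -
  consider "Lo = {}" "Hi = {}" | a where "a \<in> Lo" "Hi = {}" | b where "Lo = {}" "b \<in> Hi"
    | a b where "a \<in> Lo" "b \<in> Hi" by blast
  then show ?thesis
  proof cases
    case 1
    have "Rel UNIV A B = Cyl A" "Rel (Lo \<union> Hi) A B = Cyl B"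
      using A 1 by (auto simp: cyl_rel_def cyl_def)
    then have "acyclic_at q (Cyl A) (Rel (Lo \<union> Hi) A B) \<longleftrightarrow> acyclic_at q A B"
      using qiso_acyclic_iff[OF qiso_projection[OF A(2,1), of UNIV 0 q]] A Cyl_mono[OF A(2)] by simp
    then show ?thesis using ac q by simp
  next
    case 2
    then show ?thesis using acyclic_cylinder[OF A(2) Lo(2)] by simp
  next
    case 3
    then show ?thesis using acyclic_cylinder[OF A(2) Hi(2)] by simp
  next
    case 4
    obtain q' where q': "q = Suc q'" "q' > d" using q by (cases q) auto
    have sub: "Cyl B \<subseteq> Rel Hi A B" "Rel Lo A B \<subseteq> Rel (Lo \<union> Hi) A B" "Rel (Lo \<union> Hi) A B \<subseteq> Cyl A"
      using Rel_subset[OF A(2)] Rel_mono[OF subset_refl subset_refl] Cyl_subset_Rel by auto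
    have "acyclic_at q' (Rel Hi A B) (Cyl B)"
      using qiso_acyclic_iff[OF qiso_projection[OF A(2,1) Hi(2) 4(2)] sub(1) A(2)] ac[OF q'(2)] by simp
    then have "acyclic_at q' (Rel (Lo \<union> Hi) A B) (Rel Lo A B)"
      using qiso_acyclic_iff[OF qiso_excise_half[OF B Lo(1) Hi(1) disj] sub(1,2)] by simp
    then show ?thesis
      using qiso_acyclic_iff[OF qiso_suspension_boundary[OF A(2) Lo(2) 4(1)] sub(3,2)] q' by simp
  qed
qed

end

section \<open>Orthonormal bases and compactness in finite dimension\<close>

definition onb :: "'a::real_inner set \<Rightarrow> bool" where
  "onb C \<longleftrightarrow> finite C \<and> (\<forall>c\<in>C. \<forall>d\<in>C. c \<bullet> d = (if c = d then 1 else 0)) \<and>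
     (\<forall>x. x = (\<Sum>c\<in>C. (x \<bullet> c) *\<^sub>R c))"

text \<open>
  Gram-Schmidt orthogonalisation.
\<close>
lemma orthonormal_extension:
  fixes B :: "'a::real_inner set"
  assumes "finite B"
  shows "\<exists>C. finite C \<and> (\<forall>c\<in>C. \<forall>d\<in>C. c \<bullet> d = (if c = d then 1 else 0)) \<and>
     (\<forall>x\<in>B. x = (\<Sum>c\<in>C. (x \<bullet> c) *\<^sub>R c))"
  using assms
proof (induction B)
  case empty
  show ?case by (rule exI[of _ "{}"]) auto
next
  case (insert b B)
  then obtain C where C: "finite C" "\<And>c d. c \<in> C \<Longrightarrow> d \<in> C \<Longrightarrow> c \<bullet> d = (if c = d then 1 else 0)"
    "\<And>x. x \<in> B \<Longrightarrow> x = (\<Sum>c\<in>C. (x \<bullet> c) *\<^sub>R c)" by blast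
  define u where "u = b - (\<Sum>c\<in>C. (b \<bullet> c) *\<^sub>R c)"
  have uC: "u \<bullet> d = 0" if "d \<in> C" for d
  proof -
    have "(\<Sum>c\<in>C. (b \<bullet> c) *\<^sub>R c) \<bullet> d = (\<Sum>c\<in>C. (b \<bullet> c) * (if c = d then 1 else 0))"
      using that C(2) by (simp add: inner_sum_left)
    also have "\<dots> = b \<bullet> d" using that C(1) by (simp add: if_distrib cong: if_cong)
    finally show ?thesis by (simp add: u_def inner_diff_left)
  qed
  show ?case
  proof (cases "u = 0")
    case True
    then show ?thesis using C by (intro exI[of _ C]) (auto simp: u_def)
  next
    case False
    define n where "n = u /\<^sub>R norm u"
    have nn: "n \<bullet> n = 1" using False by (simp add: n_def dot_square_norm power2_eq_square)
    have nC: "n \<bullet> d = 0" "d \<bullet> n = 0" if "d \<in> C" for d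
      using uC[OF that] by (simp_all add: n_def inner_commute)
    have nin: "n \<notin> C" using nC nn by force
    have xn: "x \<bullet> n = 0" if "x \<in> B" for x
    proof -
      have "x \<bullet> n = (\<Sum>c\<in>C. (x \<bullet> c) *\<^sub>R c) \<bullet> n" using C(3)[OF that] by simp
      then show ?thesis by (simp add: inner_sum_left nC)
    qed
    have bn: "b \<bullet> n = norm u"
    proof -
      have "b \<bullet> n = (u + (\<Sum>c\<in>C. (b \<bullet> c) *\<^sub>R c)) \<bullet> n" by (simp add: u_def)
      also have "\<dots> = u \<bullet> n" by (simp add: inner_add_left inner_sum_left nC)
      also have "\<dots> = norm u" using False by (simp add: n_def dot_square_norm power2_eq_square)
      finally show ?thesis .
    qed
    have "b = (\<Sum>c\<in>insert n C. (b \<bullet> c) *\<^sub>R c)"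
      using False nin C(1) by (simp add: bn) (simp add: n_def u_def)
    moreover have "x = (\<Sum>c\<in>insert n C. (x \<bullet> c) *\<^sub>R c)" if "x \<in> B" for x
      using nin C(1) C(3)[OF that] by (simp add: xn[OF that])
    ultimately show ?thesis
      using C nn nC nin by (intro exI[of _ "insert n C"]) auto
  qed
qed

lemma ex_onb: "\<exists>C::'a::finite_dim_inner set. onb C"
proof -
  obtain B :: "'a set" where B: "finite B" "span B = UNIV" using finite_dim by blast
  obtain C where C: "finite C" "\<forall>c\<in>C. \<forall>d\<in>C. c \<bullet> d = (if c = d then 1 else 0)"
    "\<And>x. x \<in> B \<Longrightarrow> x = (\<Sum>c\<in>C. (x \<bullet> c) *\<^sub>R c)" using orthonormal_extension[OF B(1)] by blast
  have "x = (\<Sum>c\<in>C. (x \<bullet> c) *\<^sub>R c)" if "x \<in> span B" for x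
    using that
  proof (induction rule: span_induct_alt)
    case base
    show ?case by simp
  next
    case (step r x y)
    have "r *\<^sub>R x + y = r *\<^sub>R (\<Sum>c\<in>C. (x \<bullet> c) *\<^sub>R c) + (\<Sum>c\<in>C. (y \<bullet> c) *\<^sub>R c)"
      using step C(3) by simp
    also have "\<dots> = (\<Sum>c\<in>C. ((r *\<^sub>R x + y) \<bullet> c) *\<^sub>R c)"
      by (simp add: inner_add_left scaleR_add_left sum.distrib scaleR_sum_right)
    finally show ?case .
  qed
  then show ?thesis using B C unfolding onb_def by (intro exI[of _ C]) auto
qed

lemma onbD:
  assumes "onb C"
  shows "finite C" "c \<in> C \<Longrightarrow> d \<in> C \<Longrightarrow> c \<bullet> d = (if c = d then 1 else 0)"
    "x = (\<Sum>c\<in>C. (x \<bullet> c) *\<^sub>R c)"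
  using assms by (auto simp: onb_def)

lemma onb_card:
  fixes C :: "'a::real_inner set"
  assumes C: "onb C" shows "card C = dim (UNIV :: 'a set)"
proof -
  have "independent C"
    unfolding independent_explicit_finite_subsets
  proof (intro allI impI ballI)
    fix S u v assume S: "S \<subseteq> C" "finite S" "(\<Sum>v\<in>S. u v *\<^sub>R v) = 0" and v: "v \<in> S"
    have "(\<Sum>w\<in>S. u w *\<^sub>R w) \<bullet> v = (\<Sum>w\<in>S. u w * (if w = v then 1 else 0))"
      unfolding inner_sum_left
    proof (intro sum.cong refl)
      fix w assume "w \<in> S"
      then have "w \<in> C" "v \<in> C" using S v by auto
      then show "(u w *\<^sub>R w) \<bullet> v = u w * (if w = v then 1 else 0)" by (simp add: onbD(2)[OF C])
    qed
    also have "\<dots> = u v" using S v by (simp add: if_distrib cong: if_cong)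
    finally show "u v = 0" using S by simp
  qed
  moreover have "x \<in> span C" for x
    by (subst onbD(3)[OF C]) (intro span_sum span_scale span_base)
  ultimately show ?thesis
    by (intro dim_eq_card[symmetric]) auto
qed

lemma norm_le_coordinates:
  assumes "onb C" shows "norm x \<le> (\<Sum>c\<in>C. \<bar>x \<bullet> c\<bar>)"
proof -
  have n1: "norm c = 1" if "c \<in> C" for c
    using onbD(2)[OF assms that that] by (simp add: norm_eq_sqrt_inner)
  have "norm x = norm (\<Sum>c\<in>C. (x \<bullet> c) *\<^sub>R c)" by (rule arg_cong[OF onbD(3)[OF assms]])
  also have "\<dots> \<le> (\<Sum>c\<in>C. norm ((x \<bullet> c) *\<^sub>R c))" by (rule norm_sum)
  also have "\<dots> = (\<Sum>c\<in>C. \<bar>x \<bullet> c\<bar>)" using n1 by simp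
  finally show ?thesis .
qed

lemma coordinate_le_norm:
  assumes "onb C" "c \<in> C" shows "\<bar>x \<bullet> c\<bar> \<le> norm x"
  using Cauchy_Schwarz_ineq2[of x c] onbD(2)[OF assms(1) assms(2) assms(2)]
  by (simp add: norm_eq_sqrt_inner)

text \<open>
  The cube is a Minkowski sum of segments, one for each basis vector.
\<close>
lemma compact_onb_cube:
  assumes "onb C" shows "compact {x. \<forall>c\<in>C. \<bar>x \<bullet> c\<bar> \<le> r}"
proof -
  have "compact {x. \<exists>t. (\<forall>c\<in>D. \<bar>t c\<bar> \<le> r) \<and> x = (\<Sum>c\<in>D. t c *\<^sub>R c)}" if "finite D" for D :: "'a set"
    using that
  proof (induction D)
    case (insert d D)
    let ?K = "\<lambda>D. {x. \<exists>t. (\<forall>c\<in>D. \<bar>t c\<bar> \<le> r) \<and> x = (\<Sum>c\<in>D. t c *\<^sub>R c)}"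
    have "?K (insert d D) = {x + y | x y. x \<in> (\<lambda>s. s *\<^sub>R d) ` {-r..r} \<and> y \<in> ?K D}"
    proof (intro equalityI subsetI)
      fix x assume "x \<in> ?K (insert d D)"
      then obtain t where "\<forall>c\<in>insert d D. \<bar>t c\<bar> \<le> r" "x = (\<Sum>c\<in>insert d D. t c *\<^sub>R c)" by blast
      then show "x \<in> {x + y | x y. x \<in> (\<lambda>s. s *\<^sub>R d) ` {-r..r} \<and> y \<in> ?K D}"
        using insert by (intro CollectI exI[of _ "t d *\<^sub>R d"] exI[of _ "\<Sum>c\<in>D. t c *\<^sub>R c"]) (auto simp: abs_le_iff)
    next
      fix x assume "x \<in> {x + y | x y. x \<in> (\<lambda>s. s *\<^sub>R d) ` {-r..r} \<and> y \<in> ?K D}"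
      then obtain s t where st: "s \<in> {-r..r}" "\<forall>c\<in>D. \<bar>t c\<bar> \<le> r" "x = s *\<^sub>R d + (\<Sum>c\<in>D. t c *\<^sub>R c)" by blast
      have "(\<Sum>c\<in>D. t c *\<^sub>R c) = (\<Sum>c\<in>D. (t(d := s)) c *\<^sub>R c)"
        using insert by (intro sum.cong) auto
      then show "x \<in> ?K (insert d D)"
        using st insert by (intro CollectI exI[of _ "t(d := s)"]) (auto simp: abs_le_iff)
    qed
    moreover have "compact ((\<lambda>s. s *\<^sub>R d) ` {-r..r})"
      by (intro compact_continuous_image continuous_intros) auto
    then have "compact {x + y | x y. x \<in> (\<lambda>s. s *\<^sub>R d) ` {-r..r} \<and> y \<in> ?K D}"
      using insert.IH by (rule compact_sums)
    ultimately show ?case by (simp only:)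
  qed simp
  note * = this[OF onbD(1)[OF assms]]
  have "{x. \<exists>t. (\<forall>c\<in>C. \<bar>t c\<bar> \<le> r) \<and> x = (\<Sum>c\<in>C. t c *\<^sub>R c)} = {x. \<forall>c\<in>C. \<bar>x \<bullet> c\<bar> \<le> r}"
  proof (intro equalityI subsetI)
    fix x assume "x \<in> {x. \<exists>t. (\<forall>c\<in>C. \<bar>t c\<bar> \<le> r) \<and> x = (\<Sum>c\<in>C. t c *\<^sub>R c)}"
    then obtain t where t: "\<forall>c\<in>C. \<bar>t c\<bar> \<le> r" "x = (\<Sum>c\<in>C. t c *\<^sub>R c)" by blast
    have "x \<bullet> d = t d" if "d \<in> C" for d
    proof -
      have "x \<bullet> d = (\<Sum>c\<in>C. t c * (if c = d then 1 else 0))"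
        unfolding t(2) inner_sum_left
        by (intro sum.cong refl) (simp add: onbD(2)[OF assms _ that])
      then show ?thesis using that onbD(1)[OF assms] by (simp add: if_distrib cong: if_cong)
    qed
    then show "x \<in> {x. \<forall>c\<in>C. \<bar>x \<bullet> c\<bar> \<le> r}" using t by auto
  next
    fix x assume x: "x \<in> {x. \<forall>c\<in>C. \<bar>x \<bullet> c\<bar> \<le> r}"
    have "\<forall>c\<in>C. \<bar>x \<bullet> c\<bar> \<le> r" using x by simp
    then have "(\<forall>c\<in>C. \<bar>x \<bullet> c\<bar> \<le> r) \<and> x = (\<Sum>c\<in>C. (x \<bullet> c) *\<^sub>R c)"
      using onbD(3)[OF assms] by (rule conjI)
    then show "x \<in> {x. \<exists>t. (\<forall>c\<in>C. \<bar>t c\<bar> \<le> r) \<and> x = (\<Sum>c\<in>C. t c *\<^sub>R c)}"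
      by (intro CollectI exI)
  qed
  with * show ?thesis by simp
qed

lemma closed_bounded_imp_compact:
  fixes S :: "'a::finite_dim_inner set"
  assumes "closed S" "bounded S" shows "compact S"
proof -
  obtain C :: "'a set" where C: "onb C" using ex_onb by blast
  obtain r where r: "\<And>x. x \<in> S \<Longrightarrow> norm x \<le> r" using assms(2) by (auto simp: bounded_iff)
  have "S \<subseteq> {x. \<forall>c\<in>C. \<bar>x \<bullet> c\<bar> \<le> r}"
    using r coordinate_le_norm[OF C] by (auto intro: order_trans)
  then have "{x. \<forall>c\<in>C. \<bar>x \<bullet> c\<bar> \<le> r} \<inter> S = S" by blast
  with compact_Int_closed[OF compact_onb_cube[OF C, of r] assms(1)] show ?thesis by (simp only:)
qed

section \<open>Homology above the dimension\<close>

lemma acyclic_singleton: "q > 0 \<Longrightarrow> acyclic_at q {a::'a::topological_space} {}"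
  unfolding acyclic_at_def
proof
  fix z assume q: "q > 0" and z: "z \<in> qcycles q {a} {}"
  obtain r z' where r: "r \<noteq> 0" "z = qscale r (rat_of_chain z')" by (rule rat_chain_as_integral)
  then have "singular_relcycle q (top_of_set {a}) {} z'"
    using z by (simp add: qcycles_qscale_iff qcycles_of_iff)
  then have "singular_relboundary q (top_of_set {a}) {} z'"
    using singular_boundary_eq_cycle_singleton[of "top_of_set {a}" a q z'] q by simp
  from qbounds_qscale[OF qbounds_of[OF _ this], of r] show "z \<in> qbounds q {a} {}" using r by simp
qed

lemma real_interval_complement:
  fixes J :: "real set"
  assumes "closed J" "convex J"
  obtains Lo Hi where "open Lo" "convex Lo" "open Hi" "convex Hi" "Lo \<inter> Hi = {}" "- J = Lo \<union> Hi"
proof (cases "J = {}")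
  case True
  show thesis
    by (rule that[of UNIV "{}"]) (simp_all add: True)
next
  case False
  then obtain j where j: "j \<in> J" by blast
  have int: "is_interval J" using assms(2) by (simp add: is_interval_convex_1)
  have lo: "is_interval ({..<j} - J)"
    unfolding is_interval_1
  proof (intro ballI allI impI)
    fix a b x assume *: "a \<in> {..<j} - J" "b \<in> {..<j} - J" "a \<le> x \<and> x \<le> b"
    then have "x \<notin> J" using mem_is_interval_1_I[OF int _ j, of x b] by (metis DiffD1 DiffD2 lessThan_iff less_imp_le)
    then show "x \<in> {..<j} - J" using * by simp
  qed
  have hi: "is_interval ({j<..} - J)"
    unfolding is_interval_1
  proof (intro ballI allI impI)
    fix a b x assume *: "a \<in> {j<..} - J" "b \<in> {j<..} - J" "a \<le> x \<and> x \<le> b"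
    then have "x \<notin> J" using mem_is_interval_1_I[OF int j, of x a] by (metis DiffD1 DiffD2 greaterThan_iff less_imp_le)
    then show "x \<in> {j<..} - J" using * by simp
  qed
  have eq: "- J = ({..<j} - J) \<union> ({j<..} - J)"
  proof (intro equalityI subsetI)
    fix x assume "x \<in> - J"
    then show "x \<in> ({..<j} - J) \<union> ({j<..} - J)" using j by (cases x j rule: linorder_cases) auto
  qed auto
  show thesis
  proof (rule that[OF _ _ _ _ _ eq])
    show "convex ({..<j} - J)" "convex ({j<..} - J)"
      using lo hi by (simp_all only: is_interval_convex_1)
    show "open ({..<j} - J)" "open ({j<..} - J)"
      using assms(1) by (simp_all add: open_Diff)
    show "({..<j} - J) \<inter> ({j<..} - J) = {}" by auto
  qed
qed

text \<open>
  A product of closed intervals, possibly unbounded, degenerate or empty. Cells are stable under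
  intersection, as Mayer-Vietoris arguments require, and half-spaces are among them, which is what
  lets finitely many cover a non-compact closed set.
\<close>
definition cell :: "'a::real_inner set \<Rightarrow> 'a set \<Rightarrow> bool" where
  "cell C K \<longleftrightarrow> (\<exists>J. (\<forall>c. closed (J c) \<and> convex (J c)) \<and> K = {x. \<forall>c\<in>C. x \<bullet> c \<in> (J c :: real set)})"

lemma cell_Int: "cell C K \<Longrightarrow> cell C K' \<Longrightarrow> cell C (K \<inter> K')"
  unfolding cell_def
proof (elim exE conjE)
  fix J J' :: "'a \<Rightarrow> real set"
  assume "\<forall>c. closed (J c) \<and> convex (J c)" "K = {x. \<forall>c\<in>C. x \<bullet> c \<in> J c}"
    "\<forall>c. closed (J' c) \<and> convex (J' c)" "K' = {x. \<forall>c\<in>C. x \<bullet> c \<in> J' c}"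
  then show "\<exists>J. (\<forall>c. closed (J c) \<and> convex (J c)) \<and> K \<inter> K' = {x. \<forall>c\<in>C. x \<bullet> c \<in> J c}"
    by (intro exI[of _ "\<lambda>c. J c \<inter> J' c"]) (auto intro: closed_Int convex_Int)
qed

lemma cellE:
  assumes "cell C K"
  obtains J where "\<forall>c. closed (J c) \<and> convex (J c)" "K = {x. \<forall>c\<in>C. x \<bullet> c \<in> (J c :: real set)}"
  using assms unfolding cell_def by (elim exE conjE)

lemma cell_closed:
  assumes "finite C" "cell C K" shows "closed K"
proof -
  obtain J where *: "\<forall>c. closed (J c) \<and> convex (J c)"
    and J: "K = {x. \<forall>c\<in>C. x \<bullet> c \<in> (J c :: real set)}"
    by (rule cellE[OF assms(2)])
  have "K = (\<Inter>c\<in>C. (\<lambda>x. x \<bullet> c) -` J c)" using J by auto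
  then show ?thesis using * by (auto intro!: closed_INT closed_vimage continuous_intros)
qed

text \<open>
  The complement of a cell makes the space a product of pairs \<open>(\<real>, - J c)\<close>; it is built up one
  coordinate at a time, and each coordinate raises the bound on degrees by at most one.
\<close>
lemma acyclic_cell_complement:
  fixes C :: "'a::real_inner set"
  assumes C: "onb C" and K: "cell C K" and q: "q > card C"
  shows "acyclic_at q UNIV (- K)"
proof -
  obtain J where *: "\<forall>c. closed (J c) \<and> convex (J c)"
    and KJ: "K = {x. \<forall>c\<in>C. x \<bullet> c \<in> (J c :: real set)}"
    by (rule cellE[OF K])
  have J: "closed (J c)" "convex (J c)" for c using * by simp_all
  have "\<exists>Lo Hi. open Lo \<and> convex Lo \<and> open Hi \<and> convex Hi \<and> Lo \<inter> Hi = {} \<and> - J c = Lo \<union> Hi" for c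
    using real_interval_complement[OF J(1,2), of c] by metis
  then obtain Lo Hi where LH: "\<And>c. open (Lo c)" "\<And>c. convex (Lo c)" "\<And>c. open (Hi c)" "\<And>c. convex (Hi c)"
    "\<And>c. Lo c \<inter> Hi c = {}" "\<And>c. - J c = Lo c \<union> Hi c" by metis
  define E where "E D = {x. \<forall>c\<in>C - D. x \<bullet> c = 0}" for D
  define F where "F D = {x \<in> E D. \<exists>c\<in>D. x \<bullet> c \<in> Lo c \<union> Hi c}" for D
  have "D \<subseteq> C \<Longrightarrow> \<forall>q>card D. acyclic_at q (E D) (F D)" if "finite D" for D
    using that
  proof (induction D)
    case empty
    have "E {} = {0}"
    proof (intro equalityI subsetI)
      fix x assume "x \<in> E {}"
      then have "(\<Sum>c\<in>C. (x \<bullet> c) *\<^sub>R c) = 0" by (simp add: E_def)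
      then show "x \<in> {0}" using onbD(3)[OF C, of x] by (simp only: singleton_iff)
    qed (simp add: E_def)
    then show ?case by (simp add: F_def acyclic_singleton)
  next
    case (insert c D)
    then have c: "c \<in> C" "c \<notin> D" "D \<subseteq> C" by auto
    interpret line_direction "\<lambda>x. x \<bullet> c" c
      by (rule line_direction.intro) (simp_all add: bounded_linear_inner_left onbD(2)[OF C c(1) c(1)])
    have in_c: "(z - (z \<bullet> c) *\<^sub>R c) \<bullet> c' = (if c' = c then 0 else z \<bullet> c')" if "c' \<in> C" for z c'
      using onbD(2)[OF C c(1) that] onbD(2)[OF C c(1) c(1)] by (auto simp: inner_diff_left)
    have E: "Cyl (E D) = E (insert c D)"
      using c in_c by (auto simp: cyl_def E_def)
    have F: "Rel (Lo c \<union> Hi c) (E D) (F D) = F (insert c D)"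
    proof -
      have "z \<in> Cyl (F D) \<longleftrightarrow> z \<in> E (insert c D) \<and> (\<exists>c'\<in>D. z \<bullet> c' \<in> Lo c' \<union> Hi c')" for z
      proof -
        have "z \<in> Cyl (F D) \<longleftrightarrow> z \<in> Cyl (E D) \<and> (\<exists>c'\<in>D. (z - (z \<bullet> c) *\<^sub>R c) \<bullet> c' \<in> Lo c' \<union> Hi c')"
          by (simp add: cyl_def F_def)
        also have "\<dots> \<longleftrightarrow> z \<in> E (insert c D) \<and> (\<exists>c'\<in>D. z \<bullet> c' \<in> Lo c' \<union> Hi c')"
          unfolding E using c in_c by (metis subsetD)
        finally show ?thesis .
      qed
      then show ?thesis unfolding cyl_rel_def E by (auto simp: F_def)
    qed
    have "openin (top_of_set (E D)) (F D)"
    proof -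
      have "F D = E D \<inter> (\<Union>c\<in>D. (\<lambda>x. x \<bullet> c) -` (Lo c \<union> Hi c))" by (auto simp: F_def)
      moreover have "open (\<Union>c\<in>D. (\<lambda>x. x \<bullet> c) -` (Lo c \<union> Hi c))"
        using LH by (intro open_UN ballI open_vimage continuous_intros open_Un)
      ultimately show ?thesis by (auto simp: openin_open)
    qed
    moreover have "E D \<subseteq> {z. z \<bullet> c = 0}" using c by (auto simp: E_def)
    moreover have "F D \<subseteq> E D" by (auto simp: F_def)
    ultimately have "acyclic_at q (Cyl (E D)) (Rel (Lo c \<union> Hi c) (E D) (F D))" if "q > Suc (card D)" for q
      using insert LH that by (intro acyclic_suspension[where d = "card D"]) auto
    then show ?case using insert by (simp add: E F)
  qed
  from this[OF onbD(1)[OF C]] have "acyclic_at q (E C) (F C)" using q by blast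
  moreover have "E C = UNIV" by (simp add: E_def)
  moreover have "F C = - K" unfolding F_def KJ using LH(6) \<open>E C = UNIV\<close> by blast
  ultimately show ?thesis by simp
qed

text \<open>
  A fragment of the relative Mayer-Vietoris sequence.
\<close>
lemma acyclic_Int_open:
  fixes P Q :: "'a::topological_space set"
  assumes "open P" "open Q" "acyclic_at q UNIV P" "acyclic_at q UNIV Q" "acyclic_at (Suc q) UNIV (P \<union> Q)"
  shows "acyclic_at q UNIV (P \<inter> Q)"
proof -
  have "acyclic_at q (P \<union> Q) Q"
    by (rule acyclic_triple_inner[OF _ _ assms(5,4)]) auto
  moreover have "qiso q P (P \<inter> Q) q (P \<union> Q) Q (\<lambda>c. c)"
    using assms(1,2) by (intro qiso_excision) (auto intro: open_subset)
  ultimately have "acyclic_at q P (P \<inter> Q)"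
    using qiso_acyclic_iff[of q P "P \<inter> Q" q "P \<union> Q" Q] by auto
  from acyclic_triple_outer[OF _ _ this assms(3)] show ?thesis by blast
qed

text \<open>
  Induction on the number of cells by Mayer-Vietoris; the intersections with one cell form
  a family of the same kind that is no larger than the rest.
\<close>
lemma acyclic_cells_complement:
  fixes C :: "'a::real_inner set"
  assumes C: "onb C" and "finite \<F>" "\<And>K. K \<in> \<F> \<Longrightarrow> cell C K"  "q > card C"
  shows "acyclic_at q UNIV (- \<Union>\<F>)"
proof -
  have "\<forall>\<F> q. finite \<F> \<and> card \<F> \<le> n \<and> (\<forall>K\<in>\<F>. cell C K) \<and> q > card C \<longrightarrow> acyclic_at q UNIV (- \<Union>\<F>)" for n
  proof (induction n)
    case 0
    show ?case by (auto simp: acyclic_at_def qcycles_def intro: qchains_qbounds)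
  next
    case (Suc n)
    show ?case
    proof (intro allI impI)
      fix \<F> :: "'a set set" and q
      assume \<F>: "finite \<F> \<and> card \<F> \<le> Suc n \<and> (\<forall>K\<in>\<F>. cell C K) \<and> q > card C"
      show "acyclic_at q UNIV (- \<Union>\<F>)"
      proof (cases "\<F> = {}")
        case True
        then show ?thesis by (auto simp: acyclic_at_def qcycles_def intro: qchains_qbounds)
      next
        case False
        then obtain K \<G> where K: "\<F> = insert K \<G>" "K \<notin> \<G>" by (metis ex_in_conv mk_disjoint_insert)
        then have \<G>: "finite \<G>" "card \<G> \<le> n" "\<And>G. G \<in> \<G> \<Longrightarrow> cell C G" "cell C K"
          using \<F> by auto
        have "closed (\<Union>\<G>)" using \<G> cell_closed[OF onbD(1)[OF C]] by (intro closed_Union) auto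
        moreover have "closed K" using \<G> cell_closed[OF onbD(1)[OF C]] by auto
        moreover have "acyclic_at q UNIV (- \<Union>\<G>)" using Suc \<G> \<F> by blast
        moreover have "acyclic_at q UNIV (- K)" using acyclic_cell_complement[OF C \<G>(4)] \<F> by blast
        moreover have "acyclic_at (Suc q) UNIV (- \<Union>((\<inter>) K ` \<G>))"
        proof -
          have "card ((\<inter>) K ` \<G>) \<le> n" using card_image_le[OF \<G>(1), of "(\<inter>) K"] \<G>(2) by simp
          moreover have "\<forall>G\<in>(\<inter>) K ` \<G>. cell C G" using \<G>(3) cell_Int[OF \<G>(4)] by auto
          ultimately show ?thesis
            using Suc[rule_format, of "(\<inter>) K ` \<G>" "Suc q"] \<G>(1) \<F> by simp
        qed
        moreover have "- \<Union>((\<inter>) K ` \<G>) = - K \<union> - \<Union>\<G>" by blast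
        ultimately have "acyclic_at q UNIV (- K \<inter> - \<Union>\<G>)"
          by (intro acyclic_Int_open) (auto simp only: open_Compl)
        then show ?thesis by (simp only: K Union_insert Compl_Un)
      qed
    qed
  qed
  with assms(2-) show ?thesis by blast
qed

lemma compact_chain_support:
  assumes "c \<in> qchains p (B :: 'a::topological_space set)"
  obtains T where "compact T" "T \<subseteq> B" "c \<in> qchains p T"
proof -
  let ?T = "\<Union>f\<in>Poly_Mapping.keys c. f ` standard_simplex p"
  have s: "singular_simplex p (top_of_set B) f" if "f \<in> Poly_Mapping.keys c" for f
    using assms that by (auto simp: qchains_def)
  have "compactin euclidean (f ` standard_simplex p)" if "f \<in> Poly_Mapping.keys c" for f
  proof (rule image_compactin)
    show "compactin (subtopology (powertop_real UNIV) (standard_simplex p)) (standard_simplex p)"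
      by (simp add: compactin_subtopology compactin_standard_simplex)
    show "continuous_map (subtopology (powertop_real UNIV) (standard_simplex p)) euclidean f"
      using s[OF that] by (simp add: singular_simplex_def continuous_map_in_subtopology)
  qed
  then have "compact ?T" by (intro compact_UN) auto
  moreover have "?T \<subseteq> B" using s by (auto simp: singular_simplex_subtopology)
  moreover have "singular_simplex p (top_of_set ?T) f" if "f \<in> Poly_Mapping.keys c" for f
    using s[OF that] that unfolding singular_simplex_subtopology by blast
  then have "c \<in> qchains p ?T" by (auto simp: qchains_def)
  ultimately show thesis using that by blast
qed

text \<open>
  Outside a large cube that contains \<open>T\<close>, half-spaces cover; inside, compactness provides
  finitely many small boxes.
\<close>
lemma finite_cell_cover:
  fixes C :: "'a::real_inner set"
  assumes C: "onb C" and B: "open B" and T: "compact T" "T \<subseteq> B"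
  obtains \<F> where "finite \<F>" "\<And>K. K \<in> \<F> \<Longrightarrow> cell C K" "- B \<subseteq> \<Union>\<F>" "T \<subseteq> - \<Union>\<F>"
proof -
  have finC: "finite C" by (rule onbD(1)[OF C])
  obtain r where r: "\<And>x. x \<in> T \<Longrightarrow> norm x \<le> r"
    using compact_imp_bounded[OF T(1)] by (auto simp: bounded_iff)
  define Q where "Q = {x. \<forall>c\<in>C. \<bar>x \<bullet> c\<bar> \<le> r + 1} - B"
  have Q: "compact Q" unfolding Q_def by (intro compact_diff compact_onb_cube C B)
  define box where "box x \<epsilon> = {y. \<forall>c\<in>C. \<bar>y \<bullet> c - x \<bullet> c\<bar> \<le> \<epsilon>}" for x :: 'a and \<epsilon>
  define obox where "obox x \<epsilon> = {y. \<forall>c\<in>C. \<bar>y \<bullet> c - x \<bullet> c\<bar> < \<epsilon>}" for x :: 'a and \<epsilon>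
  have "\<exists>\<epsilon>>0. box x \<epsilon> \<inter> T = {}" if "x \<in> Q" for x
  proof -
    have "x \<in> - T" using that T by (auto simp: Q_def)
    then obtain d where d: "d > 0" "ball x d \<subseteq> - T"
      using compact_imp_closed[OF T(1)] by (metis closed_def open_contains_ball_eq)
    define \<epsilon> where "\<epsilon> = d / (2 * (real (card C) + 1))"
    have "\<epsilon> > 0" unfolding \<epsilon>_def using d by (intro divide_pos_pos mult_pos_pos) auto
    moreover have "y \<in> ball x d" if "y \<in> box x \<epsilon>" for y
    proof -
      have "norm (y - x) \<le> (\<Sum>c\<in>C. \<bar>(y - x) \<bullet> c\<bar>)" by (rule norm_le_coordinates[OF C])
      also have "\<dots> \<le> real (card C) * \<epsilon>"
        using that by (intro sum_bounded_above) (auto simp: box_def inner_diff_left)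
      also have "\<dots> < (real (card C) + 1) * (2 * \<epsilon>)"
        using \<open>\<epsilon> > 0\<close> by (simp add: algebra_simps add_strict_increasing)
      also have "\<dots> = d" by (simp add: \<epsilon>_def field_simps)
      finally show ?thesis by (simp add: dist_norm norm_minus_commute)
    qed
    ultimately show ?thesis using d by blast
  qed
  then obtain \<epsilon> where \<epsilon>: "\<And>x. x \<in> Q \<Longrightarrow> \<epsilon> x > 0 \<and> box x (\<epsilon> x) \<inter> T = {}" by metis
  have op: "open (obox x e)" for x e
  proof -
    have "obox x e = (\<Inter>c\<in>C. (\<lambda>y. \<bar>y \<bullet> c - x \<bullet> c\<bar>) -` {..<e})" by (auto simp: obox_def)
    then show ?thesis using finC by (auto intro!: open_INT open_vimage continuous_intros)
  qed
  have cov: "Q \<subseteq> (\<Union>x\<in>Q. obox x (\<epsilon> x))" using \<epsilon> by (auto simp: obox_def)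
  obtain X where X: "X \<subseteq> Q" "finite X" "Q \<subseteq> (\<Union>x\<in>X. obox x (\<epsilon> x))"
    by (rule compactE_image[OF Q op cov])
  define hi where "hi c = {x. x \<bullet> c \<ge> r + 1}" for c :: 'a
  define lo where "lo c = {x. x \<bullet> c \<le> - (r + 1)}" for c :: 'a
  have "cell C (box x e)" for x e
    unfolding cell_def box_def
    by (intro exI[of _ "\<lambda>c. {x \<bullet> c - e..x \<bullet> c + e}"]) (auto simp: abs_le_iff)
  moreover have "cell C (hi c)" if "c \<in> C" for c
    unfolding cell_def hi_def using that
    by (intro exI[of _ "\<lambda>d. if d = c then {r + 1..} else UNIV"]) auto
  moreover have "cell C (lo c)" if "c \<in> C" for c
    unfolding cell_def lo_def using that
    by (intro exI[of _ "\<lambda>d. if d = c then {..- (r + 1)} else UNIV"]) auto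
  moreover have "- B \<subseteq> \<Union>((\<lambda>x. box x (\<epsilon> x)) ` X \<union> hi ` C \<union> lo ` C)"
  proof
    fix x assume x: "x \<in> - B"
    show "x \<in> \<Union>((\<lambda>x. box x (\<epsilon> x)) ` X \<union> hi ` C \<union> lo ` C)"
    proof (cases "x \<in> Q")
      case True
      then obtain y where "y \<in> X" "x \<in> obox y (\<epsilon> y)" using X by blast
      then have "x \<in> box y (\<epsilon> y)" by (auto simp: obox_def box_def intro: less_imp_le)
      then show ?thesis using \<open>y \<in> X\<close> by blast
    next
      case False
      then obtain c where "c \<in> C" "\<not> \<bar>x \<bullet> c\<bar> \<le> r + 1" using x by (auto simp: Q_def)
      then have "x \<in> hi c \<or> x \<in> lo c" by (auto simp: hi_def lo_def abs_if split: if_splits)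
      then show ?thesis using \<open>c \<in> C\<close> by blast
    qed
  qed
  moreover have "T \<subseteq> - \<Union>((\<lambda>x. box x (\<epsilon> x)) ` X \<union> hi ` C \<union> lo ` C)"
  proof
    fix t assume t: "t \<in> T"
    have "\<bar>t \<bullet> c\<bar> \<le> r" if "c \<in> C" for c
      using coordinate_le_norm[OF C that, of t] r[OF t] by linarith
    then have "t \<notin> hi c" "t \<notin> lo c" if "c \<in> C" for c
      using that by (fastforce simp: hi_def lo_def abs_le_iff)+
    moreover have "t \<notin> box x (\<epsilon> x)" if "x \<in> X" for x using \<epsilon>[of x] X(1) that t by blast
    ultimately show "t \<in> - \<Union>((\<lambda>x. box x (\<epsilon> x)) ` X \<union> hi ` C \<union> lo ` C)" by auto
  qed
  ultimately show thesis
    using that[of "(\<lambda>x. box x (\<epsilon> x)) ` X \<union> hi ` C \<union> lo ` C"] finC X(2) by blast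
qed

text \<open>
  A relative cycle of \<open>(\<real>\<^sup>k, B)\<close> has its boundary in a compact part \<open>T\<close> of \<open>B\<close>. Cover the complement of \<open>B\<close> by
  finitely many cells that miss \<open>T\<close>: the cycle is also one relative to the complement of the cells, where it
  bounds, and that complement lies in \<open>B\<close>. The exact sequence of \<open>B \<subseteq> A \<subseteq> \<real>\<^sup>k\<close> gives general \<open>A\<close>.
\<close>
theorem acyclic_above_dimension:
  fixes A B :: "'a::finite_dim_inner set"
  assumes "open A" "open B" "B \<subseteq> A" and q: "q > dim (UNIV :: 'a set)"
  shows "acyclic_at q A B"
proof -
  obtain C :: "'a set" where C: "onb C" using ex_onb by blast
  have *: "acyclic_at q UNIV B" if B: "open B" and q: "q > dim (UNIV :: 'a set)" for B :: "'a set" and q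
    unfolding acyclic_at_def
  proof
    fix z assume z: "z \<in> qcycles q UNIV B"
    then have "rat_boundary q z \<in> qchains (q - 1) B" by (simp add: qcycles_def)
    then obtain T where T: "compact T" "T \<subseteq> B" "rat_boundary q z \<in> qchains (q - 1) T"
      by (rule compact_chain_support)
    obtain \<F> where \<F>: "finite \<F>" "\<And>K. K \<in> \<F> \<Longrightarrow> cell C K" "- B \<subseteq> \<Union>\<F>" "T \<subseteq> - \<Union>\<F>"
      using finite_cell_cover[OF C B T(1,2)] by blast
    have "z \<in> qcycles q UNIV (- \<Union>\<F>)"
      using z T(3) qchains_mono[OF \<F>(4)] by (auto simp: qcycles_def)
    then have "z \<in> qbounds q UNIV (- \<Union>\<F>)"
      using acyclic_cells_complement[OF C \<F>(1,2), of q] q onb_card[OF C] by (auto simp: acyclic_at_def)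
    moreover have "- \<Union>\<F> \<subseteq> B" using \<F>(3) by blast
    ultimately show "z \<in> qbounds q UNIV B" using qbounds_mono[OF subset_refl] by blast
  qed
  show ?thesis
    using q by (intro acyclic_triple_inner[OF assms(3) subset_UNIV] * assms) auto
qed

section \<open>Gradients of smooth functions\<close>

lemma GDERIV_unique:
  assumes "GDERIV f x :> D" "GDERIV f x :> D'" shows "D = D'"
proof -
  have "(\<lambda>h. h \<bullet> D) = (\<lambda>h. h \<bullet> D')"
    using assms unfolding gderiv_def by (rule has_derivative_unique)
  then have "(D - D') \<bullet> D = (D - D') \<bullet> D'" by (rule fun_cong)
  then have "(D - D') \<bullet> (D - D') = 0" by (simp add: inner_diff_right)
  then show ?thesis by simp
qed

lemma grad_eqI: "GDERIV f x :> D \<Longrightarrow> grad f x = D"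
  unfolding grad_def using GDERIV_unique by blast

lemma GDERIV_coordinates:
  fixes f :: "'a::real_inner \<Rightarrow> real"
  assumes C: "onb C" and f: "f differentiable (at x)"
  shows "GDERIV f x :> (\<Sum>c\<in>C. frechet_derivative f (at x) c *\<^sub>R c)"
proof -
  let ?D = "frechet_derivative f (at x)"
  have fd: "(f has_derivative ?D) (at x)" using f by (simp add: frechet_derivative_works)
  then have lin: "bounded_linear ?D" by (rule has_derivative_bounded_linear)
  have "?D h = h \<bullet> (\<Sum>c\<in>C. ?D c *\<^sub>R c)" for h
  proof -
    have "?D h = ?D (\<Sum>c\<in>C. (h \<bullet> c) *\<^sub>R c)" by (rule arg_cong[OF onbD(3)[OF C]])
    also have "\<dots> = (\<Sum>c\<in>C. (h \<bullet> c) * ?D c)"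
      using bounded_linear.linear[OF lin] by (simp add: linear_sum linear_scale)
    also have "\<dots> = h \<bullet> (\<Sum>c\<in>C. ?D c *\<^sub>R c)"
      unfolding inner_sum_right by (simp add: mult.commute)
    finally show ?thesis .
  qed
  then have "?D = (\<lambda>h. h \<bullet> (\<Sum>c\<in>C. ?D c *\<^sub>R c))" by (rule ext)
  with fd show ?thesis unfolding gderiv_def by simp
qed

lemma GDERIV_grad:
  fixes f :: "'a::finite_dim_inner \<Rightarrow> real"
  assumes "f differentiable (at x)"
  shows "GDERIV f x :> grad f x"
proof -
  obtain C :: "'a set" where C: "onb C" using ex_onb by blast
  show ?thesis using GDERIV_coordinates[OF C assms] grad_eqI by metis
qed

lemma grad_eq_0_iff:
  fixes f :: "'a::finite_dim_inner \<Rightarrow> real"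
  assumes "f differentiable (at x)"
  shows "grad f x = 0 \<longleftrightarrow> (f has_derivative (\<lambda>h. 0)) (at x)"
proof
  assume "grad f x = 0"
  then show "(f has_derivative (\<lambda>h. 0)) (at x)" using GDERIV_grad[OF assms] by (simp add: gderiv_def)
next
  assume "(f has_derivative (\<lambda>h. 0)) (at x)"
  then have "GDERIV f x :> 0" by (simp add: gderiv_def)
  then show "grad f x = 0" by (rule grad_eqI)
qed

lemma smooth_differentiable: "smooth f \<Longrightarrow> f differentiable (at x)"
  unfolding smooth_def by (metis cont_diff.simps(2))

lemma smooth_continuous: "smooth f \<Longrightarrow> continuous_on UNIV f"
  unfolding smooth_def by (metis cont_diff.simps(1))

lemma smooth_continuous_derivative:
  assumes "smooth f" shows "continuous_on UNIV (\<lambda>x. frechet_derivative f (at x) v)"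
proof -
  have "cont_diff (Suc 0) f" using assms unfolding smooth_def by blast
  then show ?thesis by simp
qed

lemma continuous_grad:
  fixes f :: "'a::finite_dim_inner \<Rightarrow> real"
  assumes "smooth f" shows "continuous_on UNIV (grad f)"
proof -
  obtain C :: "'a set" where C: "onb C" using ex_onb by blast
  have "grad f = (\<lambda>x. \<Sum>c\<in>C. frechet_derivative f (at x) c *\<^sub>R c)"
    using grad_eqI[OF GDERIV_coordinates[OF C smooth_differentiable[OF assms]]] by blast
  then show ?thesis
    by (simp only:) (intro continuous_intros smooth_continuous_derivative assms)
qed

lemma cont_diff_add:
  "cont_diff n f \<Longrightarrow> cont_diff n g \<Longrightarrow> cont_diff n (\<lambda>x. f x + g x)"
proof (induction n arbitrary: f g)
  case 0
  then show ?case by (auto intro: continuous_on_add)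
next
  case (Suc n)
  have d: "f differentiable (at x)" "g differentiable (at x)" for x using Suc.prems by auto
  have hd: "((\<lambda>x. f x + g x) has_derivative (\<lambda>v. frechet_derivative f (at x) v + frechet_derivative g (at x) v)) (at x)" for x
    by (intro has_derivative_add d[unfolded frechet_derivative_works])
  have "frechet_derivative (\<lambda>x. f x + g x) (at x) v = frechet_derivative f (at x) v + frechet_derivative g (at x) v" for x v
    using frechet_derivative_at[OF hd] by metis
  then show ?case using Suc d by (auto intro!: differentiable_add)
qed

lemma cont_diff_slice:
  fixes F :: "'a::real_normed_vector \<times> 'b::real_normed_vector \<Rightarrow> 'c::real_normed_vector"
  shows "cont_diff n F \<Longrightarrow> cont_diff n (\<lambda>w. F (q, w))"
proof (induction n arbitrary: F)
  case 0
  then show ?case by (auto intro!: continuous_on_compose2[of UNIV F] continuous_intros)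
next
  case (Suc n)
  have d: "F differentiable (at z)" for z using Suc.prems by (cases z) simp
  have hd: "((\<lambda>w. F (q, w)) has_derivative (\<lambda>v. frechet_derivative F (at (q, w)) (0, v))) (at w)" for w
    by (rule has_derivative_compose[of "\<lambda>w. (q, w)" "\<lambda>v. (0, v)" w UNIV F])
      (auto intro!: derivative_eq_intros d[unfolded frechet_derivative_works])
  have "frechet_derivative (\<lambda>w. F (q, w)) (at w) v = frechet_derivative F (at (q, w)) (0, v)" for w v
    using frechet_derivative_at[OF hd] by metis
  moreover have "(\<lambda>w. F (q, w)) differentiable (at w)" for w
    using hd differentiable_def by blast
  moreover have "cont_diff n (\<lambda>w. frechet_derivative F (at (q, w)) (0, v))" for v
    using Suc.IH[of "\<lambda>z. frechet_derivative F (at z) (0, v)"] Suc.prems by simp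
  ultimately show ?case by simp
qed

lemma smooth_add: "smooth f \<Longrightarrow> smooth g \<Longrightarrow> smooth (\<lambda>x. f x + g x)"
  by (simp add: smooth_def cont_diff_add)

lemma smooth_slice: "smooth F \<Longrightarrow> smooth (\<lambda>w. F (q, w))"
  by (simp add: smooth_def cont_diff_slice)

lemma grad_add:
  fixes f g :: "'a::finite_dim_inner \<Rightarrow> real"
  assumes "f differentiable (at x)" "g differentiable (at x)"
  shows "grad (\<lambda>x. f x + g x) x = grad f x + grad g x"
  by (intro grad_eqI GDERIV_add GDERIV_grad assms)

text \<open>
  If \<open>grad g x + grad h x\<close> stays in a compact set, then \<open>grad g x\<close> stays in a ball, whose preimage under the
  homeomorphism \<open>grad g\<close> is compact.
\<close>
lemma proper_grad_simple_perturbation: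
  fixes g h :: "'a::finite_dim_inner \<Rightarrow> real"
  assumes g: "simple g" and h: "smooth h" and b: "\<And>x. norm (grad h x) \<le> b"
  shows "smooth (\<lambda>x. g x + h x)" "proper_map euclidean euclidean (grad (\<lambda>x. g x + h x))"
proof -
  let ?f = "\<lambda>x. g x + h x"
  have sg: "smooth g" and bij: "bij (grad g)" and inv: "continuous_on UNIV (inv_into UNIV (grad g))"
    using g smooth_continuous by (auto simp: simple_def diffeomorphism_def)
  show sf: "smooth ?f" by (rule smooth_add[OF sg h])
  have gf: "grad ?f x = grad g x + grad h x" for x
    by (intro grad_add smooth_differentiable sg h)
  have comp: "compact {x. grad ?f x \<in> K}" if K: "compact K" for K
  proof (rule closed_bounded_imp_compact)
    have "{x. grad ?f x \<in> K} = grad ?f -` K" by auto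
    then show "closed {x. grad ?f x \<in> K}"
      using continuous_grad[OF sf] compact_imp_closed[OF K] by (simp add: continuous_on_closed_vimage)
    obtain M where M: "\<And>y. y \<in> K \<Longrightarrow> norm y \<le> M"
      using compact_imp_bounded[OF K] by (auto simp: bounded_iff)
    have "compact (cball (0::'a) (M + b))" by (rule closed_bounded_imp_compact) auto
    then have "bounded (inv_into UNIV (grad g) ` cball 0 (M + b))"
      using inv by (intro compact_imp_bounded compact_continuous_image) (auto intro: continuous_on_subset)
    moreover have "{x. grad ?f x \<in> K} \<subseteq> inv_into UNIV (grad g) ` cball 0 (M + b)"
    proof
      fix x assume "x \<in> {x. grad ?f x \<in> K}"
      then have 1: "norm (grad g x + grad h x) \<le> M" using M gf by auto
      have "norm (grad g x) = norm ((grad g x + grad h x) - grad h x)" by simp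
      also have "\<dots> \<le> norm (grad g x + grad h x) + norm (grad h x)" by (rule norm_triangle_ineq4)
      also have "\<dots> \<le> M + b" using 1 b[of x] by simp
      finally have "grad g x \<in> cball 0 (M + b)" by simp
      moreover have "x = inv_into UNIV (grad g) (grad g x)" using bij by (simp add: bij_is_inj)
      ultimately show "x \<in> inv_into UNIV (grad g) ` cball 0 (M + b)" by blast
    qed
    ultimately show "bounded {x. grad ?f x \<in> K}" by (rule bounded_subset)
  qed
  show "proper_map euclidean euclidean (grad ?f)"
  proof (rule compact_imp_proper_map)
    show "k_space (euclidean :: 'a topology)"
      by (rule metrizable_imp_k_space) (rule metrizable_space_euclidean)
    show "kc_space (euclidean :: 'a topology)"
      by (rule Hausdorff_imp_kc_space) simp
    show "continuous_map euclidean euclidean (grad ?f) \<or> kc_space (euclidean :: 'a topology)"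
      using continuous_grad[OF sf] by simp
  qed (use comp in auto)
qed

lemma almost_simple_gf_slice:
  fixes F :: "(real^'n) \<times> 'w::finite_dim_inner \<Rightarrow> real"
  assumes "almost_simple_gf F"
  shows "smooth (\<lambda>w. F (q, w))" "proper_map euclidean euclidean (grad (\<lambda>w. F (q, w)))"
proof -
  obtain G H B where F: "smooth G" "smooth H" "\<And>z. F z = G z + H z" "\<And>q. simple (\<lambda>w. G (q, w))"
    "\<And>q w. norm (grad (\<lambda>w. H (q, w)) w) \<le> B q"
    using assms unfolding almost_simple_gf_def by blast
  have "(\<lambda>w. F (q, w)) = (\<lambda>w. G (q, w) + H (q, w))" using F(3) by auto
  then show "smooth (\<lambda>w. F (q, w))" "proper_map euclidean euclidean (grad (\<lambda>w. F (q, w)))"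
    using proper_grad_simple_perturbation[OF F(4) smooth_slice[OF F(2)] F(5), of q q] by simp_all
qed

section \<open>Pushing down along the gradient\<close>

text \<open>
  The homotopy is \<open>x - t \<eta>(x) grad f x\<close>. The step size \<open>\<eta>\<close> has to be continuous, positive off the critical
  points, and so small that \<open>f\<close> decreases along the whole step. Half the distance from \<open>(x,0)\<close> to
  the set of pairs (point, step) for which \<open>f\<close> fails to decrease has these properties.
\<close>
lemma ex_descent_homotopy:
  fixes f :: "'a::finite_dim_inner \<Rightarrow> real"
  assumes f: "smooth f"
  obtains \<psi> :: "real \<times> 'a \<Rightarrow> 'a" where "continuous_on UNIV \<psi>" "\<And>x. \<psi> (0, x) = x"
    "\<And>t x. t \<in> {0..1} \<Longrightarrow> f (\<psi> (t, x)) \<le> f x"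
    "\<And>x. grad f x \<noteq> 0 \<Longrightarrow> f (\<psi> (1, x)) < f x"
proof -
  \<comment> \<open>Steps of size at least 2 are included to make the set non-empty:
    the distance to the empty set is 0 by convention.\<close>
  define bad where "bad = {(x, t). t > 0 \<and> (t \<ge> 2 \<or> f (x - t *\<^sub>R grad f x) \<ge> f x)}"
  define \<eta> where "\<eta> x = infdist (x, 0) bad / 2" for x
  have bad2: "(x, 2) \<in> bad" for x by (simp add: bad_def)
  have \<eta>0: "\<eta> x \<ge> 0" for x by (simp add: \<eta>_def infdist_nonneg)
  have dec: "f (x - t *\<^sub>R grad f x) < f x" if "0 < t" "t \<le> \<eta> x" for x t
  proof (rule ccontr)
    assume "\<not> f (x - t *\<^sub>R grad f x) < f x"
    then have "(x, t) \<in> bad" using that by (simp add: bad_def)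
    then have "infdist (x, 0) bad \<le> dist (x, 0) (x, t)" by (rule infdist_le)
    also have "\<dots> = t" using that by (simp add: dist_Pair_Pair)
    finally show False using that by (simp add: \<eta>_def)
  qed
  have pos: "\<eta> x > 0" if "grad f x \<noteq> 0" for x
  proof -
    \<comment> \<open>Minus the derivative of \<open>f\<close> along the step from \<open>y\<close>, at time \<open>s\<close>.
      It is positive at \<open>(x, 0)\<close>, hence nearby.\<close>
    define k where "k = (\<lambda>(y, s). grad f (y - s *\<^sub>R grad f y) \<bullet> grad f y)"
    have "continuous_on UNIV k"
      unfolding k_def case_prod_unfold
      by (intro continuous_intros continuous_on_compose2[OF continuous_grad[OF f]]) auto
    then have "open (k -` {0<..})" by (intro open_vimage) auto
    moreover have "(x, 0) \<in> k -` {0<..}" using that by (simp add: k_def)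
    ultimately obtain d where d: "d > 0" "ball (x, 0) d \<subseteq> k -` {0<..}" by (meson openE)
    define \<delta> where "\<delta> = min d 2"
    have "\<delta> \<le> dist (x, 0) z" if "z \<in> bad" for z
    proof (rule ccontr)
      assume "\<not> \<delta> \<le> dist (x, 0) z"
      moreover obtain y t where z: "z = (y, t)" by (cases z)
      ultimately have dz: "dist (x, 0) (y, t) < \<delta>" by simp
      have t: "t > 0" using that z by (simp add: bad_def)
      have "t \<le> dist (x, 0) (y, t)"
        using dist_snd_le[of "(x, 0)" "(y, t)"] t by simp
      then have t2: "t < 2" using dz by (simp add: \<delta>_def)
      have "f (y - t *\<^sub>R grad f y) < f (y - 0 *\<^sub>R grad f y)"
      proof (rule DERIV_neg_imp_decreasing[OF t])
        fix s assume s: "0 \<le> s" "s \<le> t"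
        have "dist (x, 0) (y, s) \<le> dist (x, 0) (y, t)"
          using s by (simp add: dist_Pair_Pair power_mono)
        then have "k (y, s) > 0" using dz d(2) by (auto simp: \<delta>_def subset_iff)
        moreover have "((\<lambda>s. f (y - s *\<^sub>R grad f y)) has_real_derivative - k (y, s)) (at s)"
        proof -
          have "(f has_derivative (\<lambda>h. h \<bullet> grad f (y - s *\<^sub>R grad f y))) (at (y - s *\<^sub>R grad f y))"
            using GDERIV_grad[OF smooth_differentiable[OF f]] unfolding gderiv_def .
          then have "((\<lambda>s. f (y - s *\<^sub>R grad f y)) has_derivative
              (\<lambda>h. (- (h *\<^sub>R grad f y)) \<bullet> grad f (y - s *\<^sub>R grad f y))) (at s)"
            by (rule has_derivative_compose[rotated]) (auto intro!: derivative_eq_intros)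
          then show ?thesis
            unfolding has_field_derivative_def k_def
            by (rule has_derivative_eq_rhs) (auto simp: inner_commute)
        qed
        ultimately show "\<exists>D. ((\<lambda>s. f (y - s *\<^sub>R grad f y)) has_real_derivative D) (at s) \<and> D < 0"
          by (intro exI[of _ "- k (y, s)"]) simp
      qed
      then show False using that z t2 by (simp add: bad_def)
    qed
    then have "\<delta> \<le> infdist (x, 0) bad"
      using bad2 unfolding infdist_def by (auto intro!: cINF_greatest)
    then show ?thesis using d by (simp add: \<eta>_def \<delta>_def)
  qed
  define \<psi> where "\<psi> = (\<lambda>(t, x). x - (t * \<eta> x) *\<^sub>R grad f x)"
  show thesis
  proof (rule that[of \<psi>])
    show "continuous_on UNIV \<psi>"
      unfolding \<psi>_def case_prod_unfold \<eta>_def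
      by (intro continuous_intros continuous_on_compose2[OF continuous_grad[OF f]]) auto
    show "\<psi> (0, x) = x" for x by (simp add: \<psi>_def)
    show "f (\<psi> (t, x)) \<le> f x" if "t \<in> {0..1}" for t x
    proof (cases "t * \<eta> x = 0")
      case True
      then show ?thesis by (auto simp: \<psi>_def)
    next
      case False
      then have "0 < t * \<eta> x" using that \<eta>0[of x] by (auto simp: zero_less_mult_iff)
      moreover have "t * \<eta> x \<le> \<eta> x" using that \<eta>0[of x] by (auto intro: mult_left_le_one_le)
      ultimately show ?thesis using dec[of "t * \<eta> x" x] by (simp add: \<psi>_def)
    qed
    show "f (\<psi> (1, x)) < f x" if "grad f x \<noteq> 0" for x
      using dec[of "\<eta> x" x] pos[OF that] by (simp add: \<psi>_def)
  qed
qed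

definition below :: "('a \<Rightarrow> real) \<Rightarrow> real \<Rightarrow> 'a set" where
  "below f l = {x. f x < l}"

lemma qiso_open_closed_sublevels:
  fixes f :: "'a::finite_dim_inner \<Rightarrow> real"
  assumes f: "smooth f" and "m \<le> l" and reg: "\<And>x. f x = l \<or> f x = m \<Longrightarrow> grad f x \<noteq> 0"
  shows "qiso p (below f l) (below f m) p (sublevel f l) (sublevel f m) (\<lambda>c. c)"
proof -
  obtain \<psi> :: "real \<times> 'a \<Rightarrow> 'a" where \<psi>: "continuous_on UNIV \<psi>" "\<And>x. \<psi> (0, x) = x"
    "\<And>t x. t \<in> {0..1} \<Longrightarrow> f (\<psi> (t, x)) \<le> f x" "\<And>x. grad f x \<noteq> 0 \<Longrightarrow> f (\<psi> (1, x)) < f x"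
    by (rule ex_descent_homotopy[OF f]) metis
  have strict: "f (\<psi> (1, x)) < r" if "f x \<le> r" "r = l \<or> r = m" for x r
    using reg[of x] \<psi>(3)[of 1 x] \<psi>(4)[of x] that by fastforce
  show ?thesis
  proof (rule qiso_deformation[where H = \<psi>])
    show "continuous_on ({0..1} \<times> sublevel f l) \<psi>" by (rule continuous_on_subset[OF \<psi>(1)]) simp
    show "\<psi> (t, y) \<in> sublevel f l" if "t \<in> {0..1}" "y \<in> sublevel f l" for t y
      using \<psi>(3)[OF that(1), of y] that(2) by (simp add: sublevel_def)
    show "\<psi> (t, y) \<in> sublevel f m" if "t \<in> {0..1}" "y \<in> sublevel f m" for t y
      using \<psi>(3)[OF that(1), of y] that(2) by (simp add: sublevel_def)
    show "\<psi> (t, y) \<in> below f l" if "t \<in> {0..1}" "y \<in> below f l" for t y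
      using \<psi>(3)[OF that(1), of y] that(2) by (simp add: below_def)
    show "\<psi> (t, y) \<in> below f m" if "t \<in> {0..1}" "y \<in> below f m" for t y
      using \<psi>(3)[OF that(1), of y] that(2) by (simp add: below_def)
    show "\<psi> (1, y) \<in> below f l" if "y \<in> sublevel f l" for y
      using strict[of y l] that by (simp add: sublevel_def below_def)
    show "\<psi> (1, y) \<in> below f m" if "y \<in> sublevel f m" for y
      using strict[of y m] that by (simp add: sublevel_def below_def)
  qed (use \<psi>(2) \<open>m \<le> l\<close> in \<open>auto simp: sublevel_def below_def\<close>)
qed

lemma open_surj_imp_closed_surj:
  assumes q: "qiso p (below f L) (below f m) p (sublevel f L) (sublevel f m) (\<lambda>c. c)"
    and s: "rel_surj p (below f l) (below f m) (below f L) (below f m)"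
  shows "rel_surj p (sublevel f l) (sublevel f m) (sublevel f L) (sublevel f m)"
  unfolding rel_surj_def
proof
  let ?B = "qbounds p (sublevel f L) (sublevel f m)"
  have os: "below f r \<subseteq> sublevel f r" for r by (auto simp: below_def sublevel_def)
  fix z assume "z \<in> qcycles p (sublevel f L) (sublevel f m)"
  then obtain y where y: "y \<in> qcycles p (below f L) (below f m)" "z - y \<in> ?B"
    using q unfolding qiso_def by blast
  then obtain c where c: "c \<in> qcycles p (below f l) (below f m)" "y - c \<in> qbounds p (below f L) (below f m)"
    using s unfolding rel_surj_def by blast
  have "(z - y) + (y - c) \<in> ?B"
    using y(2) c(2) qbounds_mono[OF os os] by (intro qbounds_add) auto
  then show "\<exists>c\<in>qcycles p (sublevel f l) (sublevel f m). z - c \<in> ?B"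
    using c(1) qcycles_mono[OF os os] by (intro bexI[of _ c]) auto
qed

text \<open>
  The descent homotopy moves a cycle of \<open>({f \<le> l}, {f \<le> m})\<close> into \<open>({f < l'}, {f < m})\<close>: strictness is
  automatic at \<open>l\<close>, and follows from regularity at \<open>m\<close>.
\<close>
lemma closed_surj_imp_open_surj:
  fixes f :: "'a::finite_dim_inner \<Rightarrow> real"
  assumes f: "smooth f" and reg: "\<And>x. f x = m \<Longrightarrow> grad f x \<noteq> 0"
    and q: "qiso p (below f L) (below f m) p (sublevel f L) (sublevel f m) (\<lambda>c. c)"
    and s: "rel_surj p (sublevel f l) (sublevel f m) (sublevel f L) (sublevel f m)"
    and "m \<le> l" "l < l'" "l' \<le> L"
  shows "rel_surj p (below f l') (below f m) (below f L) (below f m)"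
  unfolding rel_surj_def
proof
  let ?B = "qbounds p (sublevel f L) (sublevel f m)"
  obtain \<psi> :: "real \<times> 'a \<Rightarrow> 'a" where \<psi>: "continuous_on UNIV \<psi>" "\<And>x. \<psi> (0, x) = x"
    "\<And>t x. t \<in> {0..1} \<Longrightarrow> f (\<psi> (t, x)) \<le> f x" "\<And>x. grad f x \<noteq> 0 \<Longrightarrow> f (\<psi> (1, x)) < f x"
    by (rule ex_descent_homotopy[OF f]) metis
  let ?h = "\<lambda>x. \<psi> (1, x)"
  have ch: "continuous_on ({0..1} \<times> sublevel f l) \<psi>" by (rule continuous_on_subset[OF \<psi>(1)]) simp
  have mono: "sublevel f m \<subseteq> sublevel f l" "sublevel f l \<subseteq> below f l'" "below f l' \<subseteq> below f L" "sublevel f l \<subseteq> sublevel f L"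
    using assms(5-7) by (auto simp: sublevel_def below_def)
  fix z assume z: "z \<in> qcycles p (below f L) (below f m)"
  then have "z \<in> qcycles p (sublevel f L) (sublevel f m)" using q unfolding qiso_def by blast
  then obtain c where c: "c \<in> qcycles p (sublevel f l) (sublevel f m)" "z - c \<in> ?B"
    using s unfolding rel_surj_def by blast
  let ?c = "qchain_map p ?h c"
  have pres: "\<psi> (t, y) \<in> sublevel f r" if "t \<in> {0..1}" "y \<in> sublevel f r" for t y r
    using \<psi>(3)[OF that(1), of y] that(2) by (simp add: sublevel_def)
  have "c - ?c \<in> qbounds p (sublevel f l) (sublevel f m)"
    by (rule homotopic_to_id[OF mono(1) ch pres pres \<psi>(2) c(1)])
  then have "c - ?c \<in> ?B"
    using qbounds_mono[OF mono(4) subset_refl] by blast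
  then have "(z - c) + (c - ?c) \<in> ?B"
    using c(2) by (rule qbounds_add[rotated])
  then have zc: "z - ?c \<in> ?B" by simp
  have "?c \<in> qcycles p (below f l') (below f m)"
  proof (rule qcycles_chain_map[OF c(1) mono(1)])
    show "continuous_on (sublevel f l) ?h" using continuous_on_slice[OF ch, of 1] by simp
    show "?h ` sublevel f l \<subseteq> below f l'" using pres[of 1 _ l] mono(2) by auto
    show "?h ` sublevel f m \<subseteq> below f m"
    proof (rule image_subsetI)
      fix x assume "x \<in> sublevel f m"
      then show "?h x \<in> below f m"
        using reg[of x] \<psi>(3)[of 1 x] \<psi>(4)[of x] by (fastforce simp: sublevel_def below_def)
    qed
  qed
  moreover from this have "z - ?c \<in> qcycles p (below f L) (below f m)"
    using z qcycles_mono[OF mono(3) subset_refl] by (blast intro: qcycles_diff)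
  then have "z - ?c \<in> qbounds p (below f L) (below f m)"
    using zc q unfolding qiso_def by blast
  ultimately show "\<exists>c\<in>qcycles p (below f l') (below f m). z - c \<in> qbounds p (below f L) (below f m)" by blast
qed

lemma rel_surj_refl: "rel_surj p Y S Y S"
  unfolding rel_surj_def by (metis diff_self qbounds_0)

text \<open>
  At a level \<open>l\<close> that is not regular the two conditions may differ, but the closed condition
  at \<open>l\<close> implies the open one at all larger levels up to \<open>L\<close>.
\<close>
lemma Inf_open_closed_sublevels:
  fixes f :: "'a::finite_dim_inner \<Rightarrow> real"
  assumes f: "smooth f" and "m \<le> L" and reg: "\<And>x. f x = L \<or> f x = m \<Longrightarrow> grad f x \<noteq> 0"
  shows "Inf {l \<in> {m..L}. rel_surj p (sublevel f l) (sublevel f m) (sublevel f L) (sublevel f m)}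
    = Inf {l \<in> {m..L}. rel_surj p (below f l) (below f m) (below f L) (below f m)}" (is "Inf ?C = Inf ?O")
proof -
  note q = qiso_open_closed_sublevels[OF f \<open>m \<le> L\<close> reg, of p]
  have L: "L \<in> ?O" "L \<in> ?C" using \<open>m \<le> L\<close> by (auto simp: rel_surj_refl)
  have bdd: "bdd_below ?O" "bdd_below ?C" by (auto intro!: bdd_belowI[of _ m])
  show ?thesis
  proof (rule antisym)
    show "Inf ?C \<le> Inf ?O"
      using L bdd by (intro cInf_superset_mono) (auto intro: open_surj_imp_closed_surj[OF q])
    show "Inf ?O \<le> Inf ?C"
    proof (rule cInf_greatest)
      show "?C \<noteq> {}" using L by blast
      fix l assume l: "l \<in> ?C"
      show "Inf ?O \<le> l"
      proof (cases "l = L")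
        case True
        then show ?thesis using L bdd by (auto intro: cInf_lower)
      next
        case False
        show ?thesis
        proof (rule dense_ge_bounded[of l L])
          show "l < L" using l False by auto
          fix l' assume l': "l < l'" "l' < L"
          then have "l' \<in> ?O"
            using l closed_surj_imp_open_surj[OF f _ q, of l l'] reg by auto
          then show "Inf ?O \<le> l'" using bdd by (intro cInf_lower)
        qed
      qed
    qed
  qed
qed

section \<open>Min-max values from open sublevel sets\<close>

lemma infinity_levelD:
  assumes "infinity_level f L"
  shows "0 < L" "f x = L \<or> f x = - L \<Longrightarrow> grad f x \<noteq> 0"
proof -
  obtain C where C: "0 < C" "C < L" "\<And>x. grad f x = 0 \<Longrightarrow> f x \<in> {-C<..<C}"
    using assms unfolding infinity_level_def by blast
  show "0 < L" using C by simp
  show "grad f x \<noteq> 0" if "f x = L \<or> f x = - L"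
    using C(3)[of x] C(1,2) that by auto
qed

lemma not_trivial_rat_group: "\<not> trivial_group rat_group"
proof
  assume "trivial_group rat_group"
  then have "(UNIV :: rat set) = {0}" by (simp add: trivial_group_def rat_group_def)
  then have "(1::rat) = 0" by blast
  then show False by simp
qed

lemma rat_group_not_acyclic:
  assumes "S \<subseteq> Y" "hq p Y S \<cong> rat_group" shows "\<not> acyclic_at p Y S"
proof -
  have "comm_group (addgrp (UNIV :: rat set))" by (rule comm_group_addgrp) (simp add: add_closed_def)
  then have "group rat_group" by (simp add: rat_group_def addgrp_def comm_group.axioms(2))
  then show ?thesis
    using isomorphic_group_triviality[OF assms(2) group_rat_homology[OF assms(1)]]
      trivial_rat_homology_iff[OF assms(1)] not_trivial_rat_group by blast
qed

lemma below_mono: "l \<le> l' \<Longrightarrow> below f l \<subseteq> below f l'"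
  by (auto simp: below_def)

lemma incl_pairs_below: "m \<le> l \<Longrightarrow> l \<le> L \<Longrightarrow> incl_pairs (below f l) (below f m) (below f L) (below f m)"
  by (simp add: incl_pairs_def below_mono)

lemma open_below: "continuous_on UNIV f \<Longrightarrow> open (below f l)"
  unfolding below_def by (rule open_Collect_less) auto

definition minmax_at :: "('a::real_inner \<Rightarrow> real) \<Rightarrow> real \<Rightarrow> nat \<Rightarrow> real \<Rightarrow> bool" where
  "minmax_at f s i L \<longleftrightarrow>
     hq i (below f L) (below f (- L)) \<cong> rat_group \<and>
     (\<forall>p. p \<noteq> i \<longrightarrow> acyclic_at p (below f L) (below f (- L))) \<and>
     s = Inf {l \<in> {- L..L}. rel_surj i (below f l) (below f (- L)) (below f L) (below f (- L))}"

lemma minmax_at_iff_closed: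
  fixes f :: "'a::finite_dim_inner \<Rightarrow> real"
  assumes f: "smooth f" and L: "infinity_level f L"
  shows "minmax_homology f i L (- L) \<cong> rat_group \<and>
        (\<forall>p. p \<noteq> i \<longrightarrow> trivial_group (minmax_homology f p L (- L))) \<and>
        s = Inf {l \<in> {- L..L}.
              rat_homology_incl i (top_of_set (sublevel f L)) (sublevel f (- L))
                ` carrier (minmax_homology f i l (- L))
              = carrier (minmax_homology f i L (- L))}
     \<longleftrightarrow> minmax_at f s i L"
proof -
  have L0: "- L \<le> L" using infinity_levelD(1)[OF L] by simp
  have reg: "grad f x \<noteq> 0" if "f x = L \<or> f x = - L" for x using infinity_levelD(2)[OF L that] .
  have subc: "sublevel f l \<subseteq> sublevel f l'" if "l \<le> l'" for l l' using that by (auto simp: sublevel_def)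
  note q = qiso_open_closed_sublevels[OF f L0 reg]
  have iso: "hq p (below f L) (below f (- L)) \<cong> minmax_homology f p L (- L)" for p
    unfolding minmax_homology_def by (rule qiso_imp_iso[OF q below_mono[OF L0] subc[OF L0]])
  have gr: "group (hq p (below f L) (below f (- L)))" "group (minmax_homology f p L (- L))" for p
    unfolding minmax_homology_def
    by (rule group_rat_homology[OF below_mono[OF L0]], rule group_rat_homology[OF subc[OF L0]])
  have 1: "minmax_homology f i L (- L) \<cong> rat_group \<longleftrightarrow> hq i (below f L) (below f (- L)) \<cong> rat_group"
    using iso_trans[OF iso] iso_trans[OF group.iso_sym[OF gr(1) iso]] by blast
  have 2: "trivial_group (minmax_homology f p L (- L)) \<longleftrightarrow> acyclic_at p (below f L) (below f (- L))" for p
    using isomorphic_group_triviality[OF iso gr, of p] trivial_rat_homology_iff[OF below_mono[OF L0, of f], of p] by simp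
  have "{l \<in> {- L..L}.
              rat_homology_incl i (top_of_set (sublevel f L)) (sublevel f (- L))
                ` carrier (minmax_homology f i l (- L))
              = carrier (minmax_homology f i L (- L))}
     = {l \<in> {-L..L}. rel_surj i (sublevel f l) (sublevel f (- L)) (sublevel f L) (sublevel f (- L))}"
    unfolding minmax_homology_def
    by (intro Collect_cong conj_cong refl rat_homology_incl_surj_iff subc) auto
  then show ?thesis
    unfolding minmax_at_def 1 2 using Inf_open_closed_sublevels[OF f L0 reg, of i] by simp
qed

text \<open>
  The bound on the degree disappears, because homology isomorphic to \<open>\<rat>\<close> cannot occur above the
  dimension.
\<close>
lemma is_minmax_iff:
  fixes f :: "'a::finite_dim_inner \<Rightarrow> real"
  assumes f: "smooth f" and pr: "proper_map euclidean euclidean (grad f)"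
  shows "is_minmax f s \<longleftrightarrow> (\<exists>i. \<forall>L. infinity_level f L \<longrightarrow> minmax_at f s i L)"
proof -
  have "is_minmax f s \<longleftrightarrow> (\<exists>i\<le>dim (UNIV :: 'a set). \<forall>L. infinity_level f L \<longrightarrow> minmax_at f s i L)"
    unfolding is_minmax_def using f pr minmax_at_iff_closed[OF f] by simp
  also have "\<dots> \<longleftrightarrow> (\<exists>i. \<forall>L. infinity_level f L \<longrightarrow> minmax_at f s i L)"
  proof
    assume "\<exists>i. \<forall>L. infinity_level f L \<longrightarrow> minmax_at f s i L"
    then obtain i where i: "\<And>L. infinity_level f L \<Longrightarrow> minmax_at f s i L" by blast
    show "\<exists>i\<le>dim (UNIV :: 'a set). \<forall>L. infinity_level f L \<longrightarrow> minmax_at f s i L"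
    proof (cases "\<exists>L. infinity_level f L")
      case True
      then obtain L where L: "infinity_level f L" by blast
      have sub: "below f (- L) \<subseteq> below f L" using infinity_levelD(1)[OF L] by (intro below_mono) simp
      have "\<not> acyclic_at i (below f L) (below f (- L))"
        using i[OF L] by (intro rat_group_not_acyclic[OF sub]) (simp add: minmax_at_def)
      then have "i \<le> dim (UNIV :: 'a set)"
        using acyclic_above_dimension[OF open_below open_below sub, of i] smooth_continuous[OF f] not_less by blast
      then show ?thesis using i by blast
    qed auto
  qed blast
  finally show ?thesis .
qed

definition critical_values :: "('a::real_inner \<Rightarrow> real) \<Rightarrow> real set" where
  "critical_values f = {f x |x. grad f x = 0}"

lemma infinity_level_critical_values:
  "infinity_level f L \<longleftrightarrow> (\<exists>C. 0 < C \<and> C < L \<and> critical_values f \<subseteq> {-C<..<C})"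
  unfolding infinity_level_def critical_values_def by blast

definition sublevel_shift :: "nat \<Rightarrow> ('a::topological_space \<Rightarrow> real) \<Rightarrow> ('b::topological_space \<Rightarrow> real) \<Rightarrow> bool" where
  "sublevel_shift d f g \<longleftrightarrow> (\<forall>m l L. m \<le> l \<longrightarrow> l \<le> L \<longrightarrow>
     homology_shift d (below f l) (below f m) (below f L) (below f m) (below g l) (below g m) (below g L) (below g m))"

lemma sublevel_shiftD:
  assumes "sublevel_shift d f g" "m \<le> l" "l \<le> L"
  shows "hq p (below f L) (below f m) \<cong> hq (p + d) (below g L) (below g m)"
    "rel_surj p (below f l) (below f m) (below f L) (below f m) \<longleftrightarrow>
     rel_surj (p + d) (below g l) (below g m) (below g L) (below g m)"
    "q < d \<Longrightarrow> acyclic_at q (below g L) (below g m)"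
    "acyclic_at p (below f L) (below f m) \<longleftrightarrow> acyclic_at (p + d) (below g L) (below g m)"
proof -
  have h: "homology_shift d (below f l) (below f m) (below f L) (below f m) (below g l) (below g m) (below g L) (below g m)"
    using assms unfolding sublevel_shift_def by blast
  show iso: "hq p (below f L) (below f m) \<cong> hq (p + d) (below g L) (below g m)"
    by (rule homology_shiftD(3)[OF h])
  show "rel_surj p (below f l) (below f m) (below f L) (below f m) \<longleftrightarrow>
     rel_surj (p + d) (below g l) (below g m) (below g L) (below g m)"
    by (rule homology_shiftD(4)[OF h])
  show "q < d \<Longrightarrow> acyclic_at q (below g L) (below g m)"
    by (rule homology_shiftD(5)[OF h])
  have sub: "below f m \<subseteq> below f L" "below g m \<subseteq> below g L" using assms by (simp_all add: below_mono)
  show "acyclic_at p (below f L) (below f m) \<longleftrightarrow> acyclic_at (p + d) (below g L) (below g m)"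
    using isomorphic_group_triviality[OF iso group_rat_homology[OF sub(1)] group_rat_homology[OF sub(2)]]
    by (simp only: trivial_rat_homology_iff[OF sub(1)] trivial_rat_homology_iff[OF sub(2)])
qed

lemma minmax_at_shift:
  assumes sh: "sublevel_shift d f g" and L: "0 < L"
  shows "minmax_at f s i L \<longleftrightarrow> minmax_at g s (i + d) L"
proof -
  have m: "- L \<le> L" using L by simp
  note D = sublevel_shiftD[OF sh m order_refl]
  have sub: "below f (- L) \<subseteq> below f L" using below_mono[OF m] .
  have 1: "hq i (below f L) (below f (- L)) \<cong> rat_group \<longleftrightarrow> hq (i + d) (below g L) (below g (- L)) \<cong> rat_group"
    using iso_trans[OF D(1)] iso_trans[OF group.iso_sym[OF group_rat_homology[OF sub] D(1)]] by blast
  have 2: "(\<forall>p. p \<noteq> i \<longrightarrow> acyclic_at p (below f L) (below f (- L))) \<longleftrightarrow>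
    (\<forall>p. p \<noteq> i + d \<longrightarrow> acyclic_at p (below g L) (below g (- L)))" (is "?l \<longleftrightarrow> ?r")
  proof
    assume l: ?l
    show ?r
    proof (intro allI impI)
      fix p assume p: "p \<noteq> i + d"
      show "acyclic_at p (below g L) (below g (- L))"
      proof (cases "p < d")
        case False
        then have "p = (p - d) + d" "p - d \<noteq> i" using p by auto
        then show ?thesis using l D(4)[of "p - d"] by simp
      qed (rule D(3))
    qed
  next
    assume r: ?r
    show ?l using r D(4) by simp
  qed
  have 3: "{l \<in> {- L..L}. rel_surj i (below f l) (below f (- L)) (below f L) (below f (- L))} =
     {l \<in> {- L..L}. rel_surj (i + d) (below g l) (below g (- L)) (below g L) (below g (- L))}"
    using sublevel_shiftD(2)[OF sh] by auto
  show ?thesis unfolding minmax_at_def 1 2 3 ..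
qed

text \<open>
  In the backward direction the degree \<open>j\<close> of the min-max of \<open>g\<close> is at least \<open>d\<close>, since lower groups of \<open>g\<close>
  vanish. Levels are the same on both sides as they are determined by the critical values.
\<close>
proposition is_minmax_shift:
  fixes f :: "'a::finite_dim_inner \<Rightarrow> real" and g :: "'b::finite_dim_inner \<Rightarrow> real"
  assumes f: "smooth f" "proper_map euclidean euclidean (grad f)"
    and g: "smooth g" "proper_map euclidean euclidean (grad g)"
    and crit: "critical_values f = critical_values g" and sh: "sublevel_shift d f g"
  shows "is_minmax f s \<longleftrightarrow> is_minmax g s"
proof -
  have inf: "infinity_level f L \<longleftrightarrow> infinity_level g L" for L
    by (simp add: infinity_level_critical_values crit)
  show ?thesis
    unfolding is_minmax_iff[OF f] is_minmax_iff[OF g]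
  proof
    assume "\<exists>i. \<forall>L. infinity_level f L \<longrightarrow> minmax_at f s i L"
    then obtain i where "\<forall>L. infinity_level f L \<longrightarrow> minmax_at f s i L" by blast
    then have "\<forall>L. infinity_level g L \<longrightarrow> minmax_at g s (i + d) L"
      using minmax_at_shift[OF sh] infinity_levelD(1) inf by blast
    then show "\<exists>i. \<forall>L. infinity_level g L \<longrightarrow> minmax_at g s i L" by blast
  next
    assume "\<exists>i. \<forall>L. infinity_level g L \<longrightarrow> minmax_at g s i L"
    then obtain j where j: "\<And>L. infinity_level g L \<Longrightarrow> minmax_at g s j L" by blast
    show "\<exists>i. \<forall>L. infinity_level f L \<longrightarrow> minmax_at f s i L"
    proof (intro exI[of _ "j - d"] allI impI)
      fix L assume "infinity_level f L"
      then have L: "infinity_level g L" "0 < L" using inf infinity_levelD(1) by auto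
      then have m: "- L \<le> L" by simp
      have "\<not> acyclic_at j (below g L) (below g (- L))"
        using j[OF L(1)] by (intro rat_group_not_acyclic below_mono m) (simp add: minmax_at_def)
      then have "\<not> j < d" using sublevel_shiftD(3)[OF sh m order_refl] by blast
      then have "j = (j - d) + d" by simp
      then show "minmax_at f s (j - d) L" using minmax_at_shift[OF sh L(2), of s "j - d"] j[OF L(1)] by simp
    qed
  qed
qed

lemma sublevel_shift_trans:
  "sublevel_shift d f g \<Longrightarrow> sublevel_shift d' g h \<Longrightarrow> sublevel_shift (d + d') f h"
  unfolding sublevel_shift_def by (meson homology_shift_trans)

section \<open>Linear changes of fibre variables\<close>

lemma sublevel_shift_homeomorphism:
  assumes T: "continuous_on UNIV T" "continuous_on UNIV T'" "\<And>x. T' (T x) = x" "\<And>y. T (T' y) = y"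
    and fg: "\<And>x. g (T x) = f x"
  shows "sublevel_shift 0 f g"
  unfolding sublevel_shift_def
proof (intro allI impI)
  fix m l L :: real assume ml: "m \<le> l" "l \<le> L"
  have fg': "f (T' y) = g y" for y using fg[of "T' y"] T(4) by simp
  have q: "qiso p (below f l) (below f m) p (below g l) (below g m) (qchain_map p T)" if "m \<le> l" for p l
    by (rule qiso_homotopy_equivalence[where G = T' and H = snd and K = snd])
      (use that T(3,4) fg fg' in \<open>auto simp: below_def intro: continuous_on_subset[OF T(1)] continuous_on_subset[OF T(2)]
         intro!: continuous_intros\<close>)
  show "homology_shift 0 (below f l) (below f m) (below f L) (below f m) (below g l) (below g m) (below g L) (below g m)"
  proof (rule homology_shiftI)
    show "\<exists>\<phi>. qiso p (below f l) (below f m) (p + 0) (below g l) (below g m) \<phi> \<and>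
        qiso p (below f L) (below f m) (p + 0) (below g L) (below g m) \<phi>" for p
      using q[OF ml(1)] q[of L] ml by auto
  qed (simp_all add: incl_pairs_below ml)
qed

lemma critical_values_linear:
  fixes f :: "'a::finite_dim_inner \<Rightarrow> real" and g :: "'b::finite_dim_inner \<Rightarrow> real"
  assumes T: "bounded_linear T" "bounded_linear T'" "\<And>x. T' (T x) = x" "\<And>y. T (T' y) = y"
    and fg: "\<And>x. g (T x) = f x"
    and f: "\<And>x. f differentiable (at x)" and g: "\<And>y. g differentiable (at y)"
  shows "critical_values f = critical_values g"
proof -
  have *: "grad (u \<circ> S) x = 0"
    if S: "bounded_linear S" and "grad u (S x) = 0" "u differentiable (at (S x))" "(u \<circ> S) differentiable (at x)"
    for S :: "'c::finite_dim_inner \<Rightarrow> 'd::finite_dim_inner" and u x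
  proof -
    have "(u has_derivative (\<lambda>h. 0)) (at (S x))" using that grad_eq_0_iff by blast
    then have "(u \<circ> S has_derivative (\<lambda>h. 0)) (at x)"
      using has_derivative_compose[OF bounded_linear_imp_has_derivative[OF S]] by (simp add: o_def)
    then show ?thesis using that grad_eq_0_iff by blast
  qed
  have fT: "f = g \<circ> T" and gT: "g = f \<circ> T'" using fg T(4) by (auto simp: fun_eq_iff) (metis fg T(4))
  have 1: "grad f x = 0" if "grad g (T x) = 0" for x
    using *[OF T(1) that g] f unfolding fT by simp
  have 2: "grad g y = 0" if "grad f (T' y) = 0" for y
    using *[OF T(2) that f] g unfolding gT by simp
  show ?thesis
    unfolding critical_values_def
  proof (intro equalityI subsetI)
    fix v assume "v \<in> {f x |x. grad f x = 0}"
    then obtain x where "grad f x = 0" "v = f x" by blast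
    then show "v \<in> {g y |y. grad g y = 0}"
      using 2[of "T x"] T(3) fg by (intro CollectI exI[of _ "T x"]) simp
  next
    fix v assume "v \<in> {g y |y. grad g y = 0}"
    then obtain y where "grad g y = 0" "v = g y" by blast
    then show "v \<in> {f x |x. grad f x = 0}"
      using 1[of "T' y"] T(4) fg[of "T' y"] by (intro CollectI exI[of _ "T' y"]) simp
  qed
qed

section \<open>The five lemma\<close>

lemma qchains_empty: "qchains p {} = {0}"
proof -
  have "\<not> singular_simplex p (top_of_set {}) f" for f :: "(nat \<Rightarrow> real) \<Rightarrow> 'a"
    by (rule singular_simplex_empty) simp
  then have "singular_simplex_set p (top_of_set ({} :: 'a set)) = {}" by blast
  then show ?thesis unfolding qchains_def by (simp only: subset_empty keys_eq_empty singleton_conv)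
qed

lemma qcycles_absolute: "c \<in> qcycles p Y {} \<longleftrightarrow> c \<in> qchains p Y \<and> rat_boundary p c = 0"
  by (simp add: qcycles_def qchains_empty)

lemma qbounds_absolute: "c \<in> qbounds p Y {} \<longleftrightarrow> (\<exists>d\<in>qchains (Suc p) Y. c = rat_boundary (Suc p) d)"
  by (simp add: qbounds_iff qchains_empty)

lemma qiso_absolute_inj:
  assumes "qiso p Y {} p Z {} \<phi>" "c \<in> qchains p Y" "rat_boundary p c = 0"
    and "\<exists>d\<in>qchains (Suc p) Z. \<phi> c = rat_boundary (Suc p) d"
  shows "\<exists>y\<in>qchains (Suc p) Y. c = rat_boundary (Suc p) y"
proof -
  have "c \<in> qcycles p Y {}" "\<phi> c \<in> qbounds p Z {}"
    using assms by (simp_all add: qcycles_absolute qbounds_absolute)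
  then have "c \<in> qbounds p Y {}" using assms(1) by (simp add: qiso_def)
  then show ?thesis by (simp only: qbounds_absolute)
qed

lemma qiso_absolute_surj:
  assumes "qiso p Y {} p Z {} \<phi>" "z \<in> qchains p Z" "rat_boundary p z = 0"
  shows "\<exists>c\<in>qchains p Y. rat_boundary p c = 0 \<and> (\<exists>d\<in>qchains (Suc p) Z. z - \<phi> c = rat_boundary (Suc p) d)"
proof -
  have "z \<in> qcycles p Z {}" using assms by (simp add: qcycles_absolute)
  then obtain c where "c \<in> qcycles p Y {}" "z - \<phi> c \<in> qbounds p Z {}"
    using assms(1) unfolding qiso_def by blast
  then show ?thesis unfolding qcycles_absolute qbounds_absolute by blast
qed

text \<open>
  Used where the two members of a pair have homotopy inverses that do not fit together.
\<close>
proposition qiso_five_lemma: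
  assumes sub: "S \<subseteq> Y" "T \<subseteq> Z" and F: "continuous_on Y F" "F ` Y \<subseteq> Z" "F ` S \<subseteq> T"
    and Y: "\<And>p. qiso p Y {} p Z {} (qchain_map p F)"
    and S: "\<And>p. qiso p S {} p T {} (qchain_map p F)"
  shows "qiso p Y S p Z T (qchain_map p F)"
proof -
  let ?F = "\<lambda>p. qchain_map p F"
  note inj = qiso_absolute_inj[OF Y] and injS = qiso_absolute_inj[OF S]
    and surj = qiso_absolute_surj[OF Y] and surjS = qiso_absolute_surj[OF S]
  have FY: "?F p c \<in> qchains p Z" if "c \<in> qchains p Y" for c p by (rule qchains_chain_map[OF that F(1,2)])
  have FS: "?F p c \<in> qchains p T" if "c \<in> qchains p S" for c p
    by (rule qchains_chain_map[OF that continuous_on_subset[OF F(1) sub(1)] F(3)])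
  have nat: "rat_boundary (Suc p) (?F (Suc p) c) = ?F p (rat_boundary (Suc p) c)" if "c \<in> qchains (Suc p) Y" for c p
    using rat_boundary_chain_map[OF that] by simp
  have SY: "c \<in> qchains p S \<Longrightarrow> c \<in> qchains p Y" for c p using qchains_mono[OF sub(1)] by blast
  have TZ: "c \<in> qchains p T \<Longrightarrow> c \<in> qchains p Z" for c p using qchains_mono[OF sub(2)] by blast
  have add: "?F p (a + b) = ?F p a + ?F p b" "?F p (a - b) = ?F p a - ?F p b" for p a b
    by (rule qchain_map_add, rule qchain_map_diff)
  have bd: "rat_boundary p (a + b) = rat_boundary p a + rat_boundary p b"
    "rat_boundary p (a - b) = rat_boundary p a - rat_boundary p b" for p :: nat and a b :: "'c rat_chain"
    by (rule rat_boundary_add, rule rat_boundary_diff)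
  show ?thesis
    unfolding qiso_def
  proof (intro conjI allI ballI)
    show "?F p (a + b) = ?F p a + ?F p b" for a b by (rule add)
    fix c assume c: "c \<in> qcycles p Y S"
    show "?F p c \<in> qcycles p Z T" by (rule qcycles_chain_map[OF c sub(1) F])
    have cY: "c \<in> qchains p Y" using c by (simp add: qcycles_def)
    show "?F p c \<in> qbounds p Z T \<longleftrightarrow> c \<in> qbounds p Y S"
    proof
      assume "c \<in> qbounds p Y S"
      then show "?F p c \<in> qbounds p Z T" by (rule qbounds_chain_map[OF _ sub(1) F])
    next
      assume "?F p c \<in> qbounds p Z T"
      then obtain d e where de: "d \<in> qchains (Suc p) Z" "e \<in> qchains p T" "?F p c = rat_boundary (Suc p) d + e"
        unfolding qbounds_iff by blast
      have "\<exists>a\<in>qchains p S. rat_boundary p a = rat_boundary p c"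
      proof (cases p)
        case 0
        then show ?thesis by (intro bexI[of _ 0]) (auto simp: rat_boundary_def)
      next
        case (Suc n)
        have "rat_boundary p c \<in> qchains n S" using c Suc by (simp add: qcycles_def)
        moreover have "rat_boundary n (rat_boundary p c) = 0" using cY Suc rat_boundary_boundary by blast
        moreover have "?F n (rat_boundary p c) = rat_boundary p e"
        proof -
          have "?F n (rat_boundary p c) = rat_boundary p (?F p c)" using nat[of c n] cY Suc by simp
          also have "\<dots> = rat_boundary p (rat_boundary (Suc p) d) + rat_boundary p e"
            unfolding de(3) by (rule rat_boundary_add)
          finally show ?thesis using rat_boundary_boundary[OF de(1)] by simp
        qed
        \<comment> \<open>The boundary of \<open>c\<close> bounds in \<open>T\<close> after applying \<open>F\<close>, hence in \<open>S\<close>.\<close>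
        ultimately obtain a where "a \<in> qchains p S" "rat_boundary p c = rat_boundary p a"
          using injS[of "rat_boundary p c" n] de(2) Suc by blast
        then show ?thesis by metis
      qed
      then obtain a where a: "a \<in> qchains p S" "rat_boundary p a = rat_boundary p c" by blast
      have eF: "e - ?F p a = ?F p (c - a) - rat_boundary (Suc p) d" unfolding add de(3) by simp
      have bFca: "rat_boundary p (?F p (c - a)) = 0"
        using rat_boundary_chain_map[of "c - a" p Y F] a cY SY[OF a(1)]
        by (simp add: rat_boundary_diff qchains_diff) (simp add: qchain_map_def rat_extend_def)
      have "rat_boundary p (e - ?F p a) = 0"
        unfolding eF rat_boundary_diff bFca rat_boundary_boundary[OF de(1)] by simp
      moreover have "e - ?F p a \<in> qchains p T" using de(2) FS[OF a(1)] by (rule qchains_diff)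
      ultimately obtain b t where b: "b \<in> qchains p S" "rat_boundary p b = 0" "t \<in> qchains (Suc p) T"
        "e - ?F p a - ?F p b = rat_boundary (Suc p) t" using surjS by blast
      have "?F p (c - a - b) = rat_boundary (Suc p) (d + t)"
        unfolding rat_boundary_add b(4)[symmetric] add de(3) by simp
      moreover have "d + t \<in> qchains (Suc p) Z" using de(1) TZ[OF b(3)] by (rule qchains_add)
      moreover have "c - a - b \<in> qchains p Y" using cY SY[OF a(1)] SY[OF b(1)] by (simp add: qchains_diff)
      moreover have "rat_boundary p (c - a - b) = 0" by (simp add: rat_boundary_diff a b)
      ultimately obtain y where y: "y \<in> qchains (Suc p) Y" "c - a - b = rat_boundary (Suc p) y"
        using inj by blast
      have "c = rat_boundary (Suc p) y + (a + b)" using y(2) by (simp add: algebra_simps)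
      then show "c \<in> qbounds p Y S" unfolding qbounds_iff using y(1) qchains_add[OF a(1) b(1)] by blast
    qed
  next
    fix z assume z: "z \<in> qcycles p Z T"
    have zZ: "z \<in> qchains p Z" using z by (simp add: qcycles_def)
    have "\<exists>t\<in>qchains p T. \<exists>y\<in>qchains p Y. rat_boundary p y \<in> qchains (p - 1) S \<and>
        rat_boundary p z = rat_boundary p (?F p y) + rat_boundary p t"
    proof (cases p)
      case 0
      then show ?thesis by (intro bexI[of _ 0]) (auto simp: rat_boundary_def)
    next
      case (Suc n)
      have "rat_boundary p z \<in> qchains n T" using z Suc by (simp add: qcycles_def)
      moreover have "rat_boundary n (rat_boundary p z) = 0" using zZ Suc rat_boundary_boundary by blast
      ultimately obtain s t where s: "s \<in> qchains n S" "rat_boundary n s = 0" "t \<in> qchains p T"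
        "rat_boundary p z - ?F n s = rat_boundary p t" using surjS[of "rat_boundary p z" n] Suc by blast
      have "?F n s = rat_boundary p (z - t)" unfolding rat_boundary_diff s(4)[symmetric] by simp
      then obtain y where y: "y \<in> qchains p Y" "s = rat_boundary p y"
        using inj[of s n] s(1,2) SY[OF s(1)] qchains_diff[OF zZ TZ[OF s(3)]] Suc by blast
      have "rat_boundary p (?F p y) = ?F n s" using nat[of y n] y Suc by simp
      then have "rat_boundary p z = rat_boundary p (?F p y) + rat_boundary p t"
        using s(4) by (simp add: algebra_simps)
      then show ?thesis using s y Suc by (intro bexI[of _ t] bexI[of _ y]) auto
    qed
    then obtain t y where ty: "t \<in> qchains p T" "y \<in> qchains p Y" "rat_boundary p y \<in> qchains (p - 1) S"
      "rat_boundary p z = rat_boundary p (?F p y) + rat_boundary p t" by blast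
    have "z - t - ?F p y \<in> qchains p Z" using zZ TZ[OF ty(1)] FY[OF ty(2)] by (simp add: qchains_diff)
    moreover have "rat_boundary p (z - t - ?F p y) = 0" unfolding rat_boundary_diff ty(4) by simp
    ultimately obtain w v where w: "w \<in> qchains p Y" "rat_boundary p w = 0" "v \<in> qchains (Suc p) Z"
      "z - t - ?F p y - ?F p w = rat_boundary (Suc p) v" using surj by blast
    have "y + w \<in> qcycles p Y S" using ty w by (simp add: qcycles_def qchains_add rat_boundary_add)
    moreover have "z - ?F p (y + w) = rat_boundary (Suc p) v + t"
      unfolding w(4)[symmetric] add by simp
    then have "z - ?F p (y + w) \<in> qbounds p Z T" unfolding qbounds_iff using w(3) ty(1) by blast
    ultimately show "\<exists>c\<in>qcycles p Y S. z - ?F p c \<in> qbounds p Z T" by blast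
  qed
qed

section \<open>Stabilisation by the pairing of two vector variables\<close>

text \<open>
  The product of \<open>({f < l}, {f < m})\<close> with \<open>(\<real>\<^sup>S, \<real>\<^sup>S - 0)\<close>, where \<open>\<real>\<^sup>S\<close> is the span of a set \<open>S\<close> of coordinate
  vectors; adding a vector to \<open>S\<close> is a suspension with the two open half-lines as \<open>Lo\<close> and \<open>Hi\<close>.
\<close>
lemma frame_shift:
  fixes f :: "'x::real_normed_vector \<Rightarrow> real" and S :: "'e::euclidean_space set"
  assumes f: "continuous_on UNIV f" and S: "S \<subseteq> Basis" and ml: "m \<le> l" "l \<le> L"
  defines "E \<equiv> \<lambda>S l. {(x, u::'e). f x < l \<and> (\<forall>b\<in>Basis - S. u \<bullet> b = 0)}"
  defines "R \<equiv> \<lambda>S l. {(x, u::'e). f x < l \<and> (\<forall>b\<in>Basis - S. u \<bullet> b = 0) \<and> (u \<noteq> 0 \<or> f x < m)}"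
  shows "homology_shift (card S) (below f l) (below f m) (below f L) (below f m) (E S l) (R S l) (E S L) (R S L)"
proof -
  have "finite S" using S by (rule finite_subset) simp
  then show ?thesis
    using S
  proof (induction S)
    case empty
    have u0: "(\<forall>b\<in>Basis. u \<bullet> b = 0) \<longleftrightarrow> u = 0" for u :: 'e by (simp add: euclidean_all_zero_iff)
    have E0: "E {} l = {(x, u). f x < l \<and> u = 0}" for l by (simp add: E_def u0)
    have R0: "R {} l = {(x, u). f x < m \<and> u = 0}" if "m \<le> l" for l using that by (auto simp: R_def u0)
    have q: "qiso p (below f l) (below f m) p (E {} l) (R {} l) (qchain_map p (\<lambda>x. (x, 0)))" if "m \<le> l" for p l
      by (rule qiso_homotopy_equivalence[where G = fst and H = snd and K = snd])
        (use that in \<open>auto simp: E0 R0 below_def intro!: continuous_intros\<close>)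
    show ?case
    proof (rule homology_shiftI)
      show "\<exists>\<phi>. qiso p (below f l) (below f m) (p + card ({}::'e set)) (E {} l) (R {} l) \<phi> \<and>
         qiso p (below f L) (below f m) (p + card ({}::'e set)) (E {} L) (R {} L) \<phi>" for p
        using q[OF ml(1)] q[of L] ml by auto
    qed (use ml in \<open>auto simp: below_def E0 R0 incl_pairs_def\<close>)
  next
    case (insert b S)
    then have b: "b \<in> Basis" "b \<notin> S" "S \<subseteq> Basis" by auto
    interpret line_direction "\<lambda>z. snd z \<bullet> b" "(0::'x, b)"
      by (rule line_direction.intro)
        (use b in \<open>auto intro: bounded_linear_compose[OF bounded_linear_inner_left bounded_linear_snd]\<close>)
    have ib: "(u - (u \<bullet> b) *\<^sub>R b) \<bullet> c = (if c = b then 0 else u \<bullet> c)" if "c \<in> Basis" for u c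
      using b that by (auto simp: inner_diff_left inner_Basis)
    have perp: "(\<forall>c\<in>Basis - S. (u - (u \<bullet> b) *\<^sub>R b) \<bullet> c = 0) \<longleftrightarrow> (\<forall>c\<in>Basis - insert b S. u \<bullet> c = 0)" for u
      using ib by auto
    have CE: "Cyl (E S l) = E (insert b S) l" for l
      unfolding cyl_def E_def using perp by auto
    have nz: "u - (u \<bullet> b) *\<^sub>R b \<noteq> 0 \<or> u \<bullet> b \<noteq> 0 \<longleftrightarrow> u \<noteq> 0" for u by auto
    have RR: "Rel ({..<0} \<union> {0<..}) (E S l) (R S l) = R (insert b S) l" for l
    proof -
      have "(x, u) \<in> Rel ({..<0} \<union> {0<..}) (E S l) (R S l) \<longleftrightarrow> (x, u) \<in> R (insert b S) l" for x u
      proof -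
        have "(x, u) \<in> Rel ({..<0} \<union> {0<..}) (E S l) (R S l) \<longleftrightarrow>
          f x < l \<and> (\<forall>c\<in>Basis - S. (u - (u \<bullet> b) *\<^sub>R b) \<bullet> c = 0) \<and>
            ((u - (u \<bullet> b) *\<^sub>R b \<noteq> 0 \<or> f x < m) \<or> u \<bullet> b \<noteq> 0)"
          unfolding cyl_rel_def cyl_def E_def R_def by (auto simp: neq_iff)
        also have "\<dots> \<longleftrightarrow> (x, u) \<in> R (insert b S) l"
          unfolding perp R_def using nz[of u] by auto
        finally show ?thesis .
      qed
      then show ?thesis by auto
    qed
    have IH: "homology_shift (card S) (below f l) (below f m) (below f L) (below f m) (E S l) (R S l) (E S L) (R S L)"
      using insert b by blast
    have op: "openin (top_of_set (E S l)) (R S l)" for l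
    proof -
      have "R S l = E S l \<inter> (snd -` (- {0}) \<union> fst -` below f m)"
        by (auto simp: R_def E_def below_def)
      moreover have "open (snd -` (- {0}) \<union> fst -` below f m :: ('x \<times> 'e) set)"
        by (intro open_Un open_vimage_snd open_vimage_fst open_below f) auto
      ultimately show ?thesis by (auto simp: openin_open)
    qed
    have "homology_shift 1 (E S l) (R S l) (E S L) (R S L)
      (Cyl (E S l)) (Rel ({..<0} \<union> {0<..}) (E S l) (R S l)) (Cyl (E S L)) (Rel ({..<0} \<union> {0<..}) (E S L) (R S L))"
    proof (rule suspension_shift[where a = "-1" and b = 1])
      show "E S L \<subseteq> {z. snd z \<bullet> b = 0}" using b by (auto simp: E_def)
      show "incl_pairs (E S l) (R S l) (E S L) (R S L)" by (rule homology_shiftD(2)[OF IH])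
    qed (use op in auto)
    from homology_shift_trans[OF IH this] show ?case
      using insert by (simp add: CE RR)
  qed
qed

text \<open>
  The set \<open>Q r\<close> is the projection of \<open>{g < r}\<close> along \<open>V\<close>, and the fibres are convex because \<open>g\<close> is affine in \<open>V\<close>.
  So any continuous section is a homotopy inverse. Sections for different \<open>r\<close> do not agree, whence
  the five lemma.
\<close>
lemma fibre_shift:
  fixes h :: "'x::real_normed_vector \<times> 'e::euclidean_space \<Rightarrow> real"
  assumes h: "continuous_on UNIV h" and ml: "m \<le> l" "l \<le> L"
  defines "g \<equiv> \<lambda>(V, x, u). V \<bullet> u + h (x, u)"
  defines "Q \<equiv> \<lambda>l. {(x, u). u \<noteq> 0 \<or> h (x, u) < l}"
  shows "homology_shift 0 (Q l) (Q m) (Q L) (Q m) (below g l) (below g m) (below g L) (below g m)"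
proof -
  have Qmono: "Q r \<subseteq> Q r'" if "r \<le> r'" for r r' using that by (auto simp: Q_def)
  have snd_Q: "snd ` below g r \<subseteq> Q r" for r by (auto simp: below_def g_def Q_def)
  have snd_Q': "(V, z) \<in> below g r \<Longrightarrow> z \<in> Q r" for V z r
    using snd_Q[of r] by (auto simp: image_subset_iff)
  have absolute: "qiso p (below g r) {} p (Q r) {} (qchain_map p snd)" for p r
  proof -
    \<comment> \<open>In the section \<open>V = - \<kappa> u\<close>, so \<open>V \<bullet> u = - \<kappa> |u|\<^sup>2\<close> is at most \<open>r - h\<close>, strictly so for \<open>u \<noteq> 0\<close>.
      Near a point of \<open>Q r\<close> with \<open>u = 0\<close> the maximum vanishes, so \<open>\<kappa>\<close> is 1 there.\<close>
    define \<kappa> where "\<kappa> z = max 0 (h z - r) / (norm (snd z))\<^sup>2 + 1" for z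
    define \<sigma> where "\<sigma> z = (- \<kappa> z *\<^sub>R snd z, z)" for z
    have "open (h -` {..<r})" using h by (intro open_vimage) auto
    moreover have "open (snd -` (- {0}) :: ('x \<times> 'e) set)" by (intro open_vimage_snd) auto
    moreover have "continuous_on (snd -` (- {0})) \<kappa>"
      unfolding \<kappa>_def by (intro continuous_intros continuous_on_subset[OF h]) auto
    moreover have "continuous_on (h -` {..<r}) \<kappa>"
    proof -
      have "continuous_on (h -` {..<r}) (\<lambda>z. 1 :: real)" by simp
      then show ?thesis by (rule continuous_on_eq) (simp add: \<kappa>_def)
    qed
    ultimately have "continuous_on (snd -` (- {0}) \<union> h -` {..<r}) \<kappa>" by (intro continuous_on_open_Un)
    moreover have "Q r = snd -` (- {0}) \<union> h -` {..<r}" by (auto simp: Q_def)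
    ultimately have c\<kappa>: "continuous_on (Q r) \<kappa>" by simp
    have g\<sigma>: "g (\<sigma> z) < r" if "z \<in> Q r" for z
    proof -
      obtain x u where z: "z = (x, u)" by (cases z)
      show ?thesis
      proof (cases "u = 0")
        case True
        then show ?thesis using that z by (simp add: \<sigma>_def g_def Q_def)
      next
        case False
        then have "\<kappa> z * (u \<bullet> u) = max 0 (h z - r) + u \<bullet> u"
          by (simp add: \<kappa>_def z power2_norm_eq_inner[symmetric] field_simps)
        moreover have "g (\<sigma> z) = h z - \<kappa> z * (u \<bullet> u)" by (simp add: \<sigma>_def g_def z)
        moreover have "u \<bullet> u > 0" "h z - r \<le> max 0 (h z - r)" using False by simp_all
        ultimately show ?thesis by linarith
      qed
    qed
    have conv: "g ((1 - t) *\<^sub>R V + t *\<^sub>R V', z) < r" if "t \<in> {0..1}" "g (V, z) < r" "g (V', z) < r" for t V V' z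
    proof -
      have "g ((1 - t) *\<^sub>R V + t *\<^sub>R V', z) = (1 - t) * g (V, z) + t * g (V', z)"
        by (cases z) (simp add: g_def algebra_simps inner_add_left)
      also have "\<dots> < r"
        using convexD_alt[of "{..<r}" "g (V, z)" "g (V', z)" t] that by simp
      finally show ?thesis .
    qed
    define H where "H = (\<lambda>(t::real, V, z). ((1 - t) *\<^sub>R V + t *\<^sub>R (- \<kappa> z *\<^sub>R snd z), z))"
    have H: "H (t, y) = ((1 - t) *\<^sub>R fst y + t *\<^sub>R fst (\<sigma> (snd y)), snd y)" for t y
      by (cases y) (simp add: H_def \<sigma>_def)
    show ?thesis
    proof (rule qiso_homotopy_equivalence[where G = \<sigma> and H = H and K = snd])
      show "continuous_on (Q r) \<sigma>" unfolding \<sigma>_def by (intro continuous_intros c\<kappa>)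
      show "\<sigma> ` Q r \<subseteq> below g r" using g\<sigma> by (auto simp: below_def)
      show "continuous_on ({0..1} \<times> below g r) H"
        unfolding H_def case_prod_unfold
        by (intro continuous_intros continuous_on_compose2[OF c\<kappa>]) (auto dest: snd_Q')
      show "H (t, y) \<in> below g r" if "t \<in> {0..1}" "y \<in> below g r" for t y
      proof -
        have "snd y \<in> Q r" using that snd_Q by blast
        then have "g (fst (\<sigma> (snd y)), snd y) < r" using g\<sigma>[of "snd y"] by (simp add: \<sigma>_def)
        then show ?thesis using conv[of t "fst y" "snd y" "fst (\<sigma> (snd y))"] that by (simp add: H below_def)
      qed
      show "H (0, y) = y" for y by (simp add: H)
      show "H (1, y) = \<sigma> (snd y)" for y by (simp add: H) (simp add: \<sigma>_def)
      show "snd (1, z) = snd (\<sigma> z)" for z by (simp add: \<sigma>_def)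
    qed (use snd_Q in \<open>auto intro!: continuous_intros\<close>)
  qed
  have rel: "qiso p (below g l) (below g m) p (Q l) (Q m) (qchain_map p snd)" if "m \<le> l" for p l
    by (rule qiso_five_lemma) (use absolute snd_Q below_mono[OF that, of g] Qmono[OF that] in \<open>auto intro!: continuous_intros\<close>)
  show ?thesis
  proof (rule homology_shiftI_reverse)
    show "\<exists>\<phi>. qiso (p + 0) (below g l) (below g m) p (Q l) (Q m) \<phi> \<and> qiso (p + 0) (below g L) (below g m) p (Q L) (Q m) \<phi>" for p
      using rel[OF ml(1)] rel[of L] ml by auto
    show "incl_pairs (Q l) (Q m) (Q L) (Q m)" using Qmono ml by (auto simp: incl_pairs_def Q_def)
  qed (simp_all add: incl_pairs_below ml)
qed

text \<open>
  Excision of the points with \<open>f x \<ge> l\<close> turns \<open>(Q l, Q m)\<close> into the product of \<open>({f < l}, {f < m})\<close> with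
  \<open>(\<real>\<^sup>n, \<real>\<^sup>n - 0)\<close>.
\<close>
lemma base_shift:
  fixes h :: "'x::real_normed_vector \<times> 'e::euclidean_space \<Rightarrow> real"
  assumes h: "continuous_on UNIV h" and ml: "m \<le> l" "l \<le> L"
  defines "f \<equiv> \<lambda>x. h (x, 0)"
  defines "Q \<equiv> \<lambda>l. {(x, u). u \<noteq> 0 \<or> h (x, u) < l}"
  shows "homology_shift DIM('e) (below f l) (below f m) (below f L) (below f m) (Q l) (Q m) (Q L) (Q m)"
proof -
  let ?E = "\<lambda>l. {(x, u::'e). f x < l \<and> (\<forall>b\<in>Basis - Basis. u \<bullet> b = 0)}"
  let ?R = "\<lambda>l. {(x, u::'e). f x < l \<and> (\<forall>b\<in>Basis - Basis. u \<bullet> b = 0) \<and> (u \<noteq> 0 \<or> f x < m)}"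
  have cf: "continuous_on UNIV f"
    unfolding f_def by (intro continuous_on_compose2[OF h]) (auto intro!: continuous_intros)
  have 1: "homology_shift DIM('e) (below f l) (below f m) (below f L) (below f m) (?E l) (?R l) (?E L) (?R L)"
    by (rule frame_shift[OF cf subset_refl ml])
  have Q: "Q l = {(x, u). u \<noteq> 0 \<or> f x < l}" for l by (auto simp: Q_def f_def)
  have q: "qiso p (?E l) (?R l) p (Q l) (Q m) (\<lambda>c. c)" if "m \<le> l" for p l
  proof -
    have "Q l = ?E l \<union> Q m" using that by (auto simp: Q)
    moreover have "?R l = ?E l \<inter> Q m" by (auto simp: Q)
    moreover have "open (?E l)"
    proof -
      have "?E l = fst -` below f l" by (auto simp: below_def)
      then show ?thesis by (simp add: open_vimage_fst open_below cf)
    qed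
    moreover have "open (Q m)"
    proof -
      have "Q m = snd -` (- {0}) \<union> fst -` below f m" by (auto simp: below_def Q)
      moreover have "open (snd -` (- {0}) \<union> fst -` below f m :: ('x \<times> 'e) set)"
        by (intro open_Un open_vimage_snd open_vimage_fst open_below cf) auto
      ultimately show ?thesis by simp
    qed
    ultimately show ?thesis using qiso_excision[of "Q l" "?E l" "Q m" p] by (simp add: open_subset)
  qed
  have "homology_shift 0 (?E l) (?R l) (?E L) (?R L) (Q l) (Q m) (Q L) (Q m)"
  proof (rule homology_shiftI)
    show "\<exists>\<phi>. qiso p (?E l) (?R l) (p + 0) (Q l) (Q m) \<phi> \<and> qiso p (?E L) (?R L) (p + 0) (Q L) (Q m) \<phi>" for p
      using q[OF ml(1)] q[of L] ml by auto
    show "incl_pairs (?E l) (?R l) (?E L) (?R L)" by (rule homology_shiftD(2)[OF 1])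
    show "incl_pairs (Q l) (Q m) (Q L) (Q m)" using ml by (auto simp: incl_pairs_def Q)
  qed simp
  from homology_shift_trans[OF 1 this] show ?thesis by simp
qed

proposition sublevel_shift_stabilisation:
  fixes h :: "'x::real_normed_vector \<times> 'e::euclidean_space \<Rightarrow> real"
  assumes h: "continuous_on UNIV h"
  shows "sublevel_shift DIM('e) (\<lambda>x. h (x, 0)) (\<lambda>(V, x, u). V \<bullet> u + h (x, u))"
  unfolding sublevel_shift_def
  using homology_shift_trans[OF base_shift[OF h] fibre_shift[OF h]] by simp

lemma grad_eq_0_iff_derivative:
  fixes f :: "'a::finite_dim_inner \<Rightarrow> real"
  assumes f: "(f has_derivative f') (at x)"
  shows "grad f x = 0 \<longleftrightarrow> (\<forall>d. f' d = 0)"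
proof -
  have d: "f differentiable (at x)" using f by (auto simp: differentiable_def)
  show ?thesis
  proof
    assume "grad f x = 0"
    then have "(f has_derivative (\<lambda>h. 0)) (at x)" by (simp only: grad_eq_0_iff[OF d])
    then have "f' = (\<lambda>h. 0)" by (rule has_derivative_unique[OF f])
    then show "\<forall>d. f' d = 0" by simp
  next
    assume "\<forall>d. f' d = 0"
    then have "f' = (\<lambda>h. 0)" by auto
    then show "grad f x = 0" using f by (simp add: grad_eq_0_iff[OF d])
  qed
qed

text \<open>
  The derivative of \<open>g\<close> in \<open>V\<close> is \<open>u\<close>, so \<open>u = 0\<close> at a critical point and the value there is \<open>f x\<close>. Conversely, over a
  critical point \<open>x\<close> of \<open>f\<close> a unique \<open>V\<close> cancels the derivative of \<open>h\<close> in \<open>u\<close>.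
\<close>
lemma critical_values_stabilisation:
  fixes h :: "'x::finite_dim_inner \<times> 'e::euclidean_space \<Rightarrow> real"
  assumes h: "\<And>z. h differentiable (at z)"
  shows "critical_values (\<lambda>x. h (x, 0)) = critical_values (\<lambda>(V, x, u). V \<bullet> u + h (x, u))" (is "critical_values ?f = critical_values ?g")
proof -
  let ?h' = "\<lambda>z. frechet_derivative h (at z)"
  have hd: "(h has_derivative ?h' z) (at z)" for z using h by (simp add: frechet_derivative_works)
  have lin: "linear (?h' z)" for z using hd has_derivative_linear by blast
  have fd: "(?f has_derivative (\<lambda>d. ?h' (x, 0) (d, 0))) (at x)" for x
    by (rule has_derivative_compose[OF _ hd]) (auto intro!: derivative_eq_intros)
  have gd: "(?g has_derivative (\<lambda>(dV, dx, du). V \<bullet> du + dV \<bullet> u + ?h' (x, u) (dx, du))) (at (V, x, u))" for V x u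
  proof -
    have "((\<lambda>z. h (snd z)) has_derivative (\<lambda>d. ?h' (snd (V, x, u)) (snd d))) (at (V, x, u))"
      by (rule has_derivative_compose[OF _ hd]) (auto intro!: derivative_eq_intros)
    moreover have "((\<lambda>z::'e \<times> 'x \<times> 'e. fst z \<bullet> snd (snd z)) has_derivative
        (\<lambda>d. fst (V, x, u) \<bullet> snd (snd d) + fst d \<bullet> snd (snd (V, x, u)))) (at (V, x, u))"
      by (intro has_derivative_inner) (auto intro!: derivative_eq_intros)
    ultimately have "((\<lambda>z. fst z \<bullet> snd (snd z) + h (snd z)) has_derivative
        (\<lambda>d. (fst (V, x, u) \<bullet> snd (snd d) + fst d \<bullet> snd (snd (V, x, u))) + ?h' (snd (V, x, u)) (snd d))) (at (V, x, u))"
      by (rule has_derivative_add[rotated])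
    then show ?thesis by (simp add: case_prod_unfold)
  qed
  have f0: "grad ?f x = 0 \<longleftrightarrow> (\<forall>d. ?h' (x, 0) (d, 0) = 0)" for x
    by (rule grad_eq_0_iff_derivative[OF fd])
  have g0: "grad ?g (V, x, u) = 0 \<longleftrightarrow> (\<forall>dV dx du. V \<bullet> du + dV \<bullet> u + ?h' (x, u) (dx, du) = 0)" for V x u
    using grad_eq_0_iff_derivative[OF gd[where V = V and x = x and u = u]] by simp
  show ?thesis
    unfolding critical_values_def
  proof (intro equalityI subsetI)
    fix c assume "c \<in> {?f x |x. grad ?f x = 0}"
    then obtain x where x: "grad ?f x = 0" "c = ?f x" by blast
    define V where "V = - (\<Sum>b\<in>Basis. ?h' (x, 0) (0, b) *\<^sub>R b)"
    have V: "V \<bullet> du = - ?h' (x, 0) (0, du)" for du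
    proof -
      have l: "linear (\<lambda>u. ?h' (x, 0) (0, u))"
        using linear_compose[OF _ lin[of "(x, 0)"], of "\<lambda>u. (0, u)"] by (simp add: o_def linear_iff)
      have "?h' (x, 0) (0, du) = ?h' (x, 0) (0, \<Sum>b\<in>Basis. (du \<bullet> b) *\<^sub>R b)" by (simp add: euclidean_representation)
      also have "\<dots> = (\<Sum>b\<in>Basis. (du \<bullet> b) * ?h' (x, 0) (0, b))"
        using linear_sum[OF l, of "\<lambda>b. (du \<bullet> b) *\<^sub>R b" Basis] linear_scale[OF l] by simp
      finally show ?thesis
        unfolding V_def inner_minus_left inner_sum_left inner_scaleR_left
        by (simp add: inner_commute mult.commute)
    qed
    have "V \<bullet> du + dV \<bullet> 0 + ?h' (x, 0) (dx, du) = 0" for dV :: 'e and dx du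
    proof -
      have "?h' (x, 0) (dx, du) = ?h' (x, 0) (dx, 0) + ?h' (x, 0) (0, du)"
        using linear_add[OF lin, of "(x, 0)" "(dx, 0)" "(0, du)"] by simp
      then show ?thesis using V f0 x(1) by simp
    qed
    then have "grad ?g (V, x, 0) = 0" using g0 by blast
    moreover have "c = ?g (V, x, 0)" using x(2) by simp
    ultimately show "c \<in> {?g z |z. grad ?g z = 0}" by blast
  next
    fix c assume "c \<in> {?g z |z. grad ?g z = 0}"
    then obtain V x u where z: "grad ?g (V, x, u) = 0" "c = ?g (V, x, u)" by auto
    then have *: "V \<bullet> du + dV \<bullet> u + ?h' (x, u) (dx, du) = 0" for dV dx du using g0 by blast
    have h0: "?h' (x, u) (0, 0) = 0" using linear_0[OF lin, of "(x, u)"] by (simp add: zero_prod_def)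
    have "u = 0" using *[of 0 u 0] h0 by simp
    moreover have "?h' (x, u) (d, 0) = 0" for d using *[of 0 0 d] by simp
    ultimately have "grad ?f x = 0" using f0 by blast
    moreover have "c = ?f x" using z(2) \<open>u = 0\<close> by simp
    ultimately show "c \<in> {?f x |x. grad ?f x = 0}" by blast
  qed
qed

section \<open>Equality of the selectors\<close>

lemma differentiable_compose_linear:
  assumes "bounded_linear A" "f differentiable (at (A x))"
  shows "(\<lambda>x. f (A x)) differentiable (at x)"
proof -
  obtain f' where "(f has_derivative f') (at (A x))" using assms(2) by (auto simp: differentiable_def)
  then have "((\<lambda>x. f (A x)) has_derivative (\<lambda>h. f' (A h))) (at x)"
    by (rule has_derivative_compose[OF bounded_linear_imp_has_derivative[OF assms(1)]])
  then show ?thesis by (auto simp: differentiable_def)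
qed

lemma is_minmax_linear:
  fixes f :: "'a::finite_dim_inner \<Rightarrow> real" and g :: "'b::finite_dim_inner \<Rightarrow> real"
  assumes f: "smooth f" "proper_map euclidean euclidean (grad f)"
    and g: "smooth g" "proper_map euclidean euclidean (grad g)"
    and T: "bounded_linear T" "bounded_linear T'" "\<And>x. T' (T x) = x" "\<And>y. T (T' y) = y"
    and fg: "\<And>x. g (T x) = f x"
  shows "is_minmax f s \<longleftrightarrow> is_minmax g s"
proof (rule is_minmax_shift[OF f g])
  show "critical_values f = critical_values g"
    by (rule critical_values_linear[OF T fg smooth_differentiable[OF f(1)] smooth_differentiable[OF g(1)]])
  show "sublevel_shift 0 f g"
    by (rule sublevel_shift_homeomorphism[where T = T and T' = T' and f = f and g = g, OF _ _ T(3,4) fg]) (intro linear_continuous_on T)+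
qed

lemma is_minmax_stabilisation:
  fixes h :: "'x::finite_dim_inner \<times> 'e::euclidean_space \<Rightarrow> real" and g :: "'b::finite_dim_inner \<Rightarrow> real"
  defines "f \<equiv> \<lambda>x. h (x, 0)"
  assumes f: "smooth f" "proper_map euclidean euclidean (grad f)"
    and g: "smooth g" "proper_map euclidean euclidean (grad g)"
    and h: "\<And>z. h differentiable (at z)"
    and T: "bounded_linear T" "bounded_linear T'" "\<And>z. T' (T z) = z" "\<And>y. T (T' y) = y"
    and gT: "\<And>V x u. g (T (V, x, u)) = V \<bullet> u + h (x, u)"
  shows "is_minmax f s \<longleftrightarrow> is_minmax g s"
proof (rule is_minmax_shift[OF f g])
  let ?G = "\<lambda>(V, x, u). V \<bullet> u + h (x, u)"
  have gTG: "g (T z) = ?G z" for z using gT by (cases z) auto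
  have "?G = (\<lambda>z. g (T z))" using gTG by auto
  then have G: "?G differentiable (at z)" for z
    using differentiable_compose_linear[OF T(1) smooth_differentiable[OF g(1)]] by simp
  have "continuous_on UNIV h"
    using h by (intro continuous_at_imp_continuous_on ballI differentiable_imp_continuous_within)
  then have "sublevel_shift DIM('e) f ?G"
    unfolding f_def by (rule sublevel_shift_stabilisation)
  moreover have "sublevel_shift 0 ?G g"
    by (rule sublevel_shift_homeomorphism[where T = T and T' = T' and f = ?G and g = g, OF _ _ T(3,4) gTG]) (intro linear_continuous_on T)+
  ultimately show "sublevel_shift (DIM('e) + 0) f g" by (rule sublevel_shift_trans)
  have "critical_values f = critical_values ?G"
    unfolding f_def by (rule critical_values_stabilisation[OF h])
  also have "\<dots> = critical_values g"
    by (rule critical_values_linear[OF T gTG G smooth_differentiable[OF g(1)]])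
  finally show "critical_values f = critical_values g" .
qed

theorem theorem3p37:
  fixes F1 :: "(real^'n) \<times> 'w1::finite_dim_inner \<Rightarrow> real"
    and F2 :: "(real^'n) \<times> 'w2::finite_dim_inner \<Rightarrow> real"
  assumes "smooth F1" and "smooth F2"
    and "almost_simple_gf (gf_T1_plus_T2 F1 F2)"
    and "almost_simple_gf (gf_T_1_box_2 F1 F2)"
    and "almost_simple_gf (gf_T1_box_T2 F1 F2)"
    and "almost_simple_gf (gf_T_1_plus_2 F1 F2)"
  shows "selector (gf_T1_plus_T2 F1 F2) = selector (gf_T_1_box_2 F1 F2)
       \<and> selector (gf_T1_box_T2 F1 F2) = selector (gf_T_1_plus_2 F1 F2)"
proof
  note linear_intros = bounded_linear_Pair bounded_linear_add bounded_linear_sub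
    bounded_linear_fst_comp bounded_linear_snd_comp bounded_linear_ident
  show "selector (gf_T1_plus_T2 F1 F2) = selector (gf_T_1_box_2 F1 F2)"
  proof
    fix q
    define T :: "(real^'n) \<times> (real^'n) \<times> 'w1 \<times> 'w2 \<Rightarrow> (real^'n) \<times> (real^'n) \<times> 'w1 \<times> 'w2"
      where "T = (\<lambda>z. (fst z + fst (snd z), fst z, snd (snd z)))"
    define T' :: "(real^'n) \<times> (real^'n) \<times> 'w1 \<times> 'w2 \<Rightarrow> (real^'n) \<times> (real^'n) \<times> 'w1 \<times> 'w2"
      where "T' = (\<lambda>z. (fst (snd z), fst z - fst (snd z), snd (snd z)))"
    have "is_minmax (\<lambda>w. gf_T1_plus_T2 F1 F2 (q, w)) s \<longleftrightarrow> is_minmax (\<lambda>w. gf_T_1_box_2 F1 F2 (q, w)) s" for s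
    proof (rule is_minmax_linear[where T = T and T' = T', OF almost_simple_gf_slice[OF assms(3)] almost_simple_gf_slice[OF assms(4)]])
      show "bounded_linear T" unfolding T_def by (intro linear_intros)
      show "bounded_linear T'" unfolding T'_def by (intro linear_intros)
      show "T' (T x) = x" "T (T' y) = y" for x y by (simp_all add: T_def T'_def)
      show "gf_T_1_box_2 F1 F2 (q, T x) = gf_T1_plus_T2 F1 F2 (q, x)" for x
        by (cases x) (simp add: T_def gf_T1_plus_T2_def gf_T_1_box_2_def)
    qed
    then show "selector (gf_T1_plus_T2 F1 F2) q = selector (gf_T_1_box_2 F1 F2) q"
      by (simp add: selector_def minmax_def)
  qed
  show "selector (gf_T1_box_T2 F1 F2) = selector (gf_T_1_plus_2 F1 F2)"
  proof
    fix q
    \<comment> \<open>With \<open>z = ((v\<^sub>2, w\<^sub>1, w\<^sub>2), u)\<close> this is the part without \<open>V\<close>, for \<open>v\<^sub>1 = v\<^sub>2 + u\<close>.\<close>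
    define h :: "((real^'n) \<times> 'w1 \<times> 'w2) \<times> (real^'n) \<Rightarrow> real"
      where "h = (\<lambda>z. q \<bullet> fst (fst z) - (F1 (fst (fst z) + snd z, fst (snd (fst z))) + F2 (fst (fst z), snd (snd (fst z)))))"
    define T :: "(real^'n) \<times> ((real^'n) \<times> 'w1 \<times> 'w2) \<times> (real^'n) \<Rightarrow> (real^'n) \<times> (real^'n) \<times> (real^'n) \<times> 'w1 \<times> 'w2"
      where "T = (\<lambda>z. (fst z, fst (fst (snd z)) + snd (snd z), fst (snd z)))"
    define T' :: "(real^'n) \<times> (real^'n) \<times> (real^'n) \<times> 'w1 \<times> 'w2 \<Rightarrow> (real^'n) \<times> ((real^'n) \<times> 'w1 \<times> 'w2) \<times> (real^'n)"
      where "T' = (\<lambda>z. (fst z, snd (snd z), fst (snd z) - fst (snd (snd z))))"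
    have h0: "(\<lambda>x. h (x, 0)) = (\<lambda>w. gf_T_1_plus_2 F1 F2 (q, w))"
      by (simp add: h_def gf_T_1_plus_2_def case_prod_unfold)
    have "is_minmax (\<lambda>x. h (x, 0)) s \<longleftrightarrow> is_minmax (\<lambda>w. gf_T1_box_T2 F1 F2 (q, w)) s" for s
    proof (rule is_minmax_stabilisation[OF _ _ almost_simple_gf_slice[OF assms(5)], of h T T'])
      show "smooth (\<lambda>x. h (x, 0))" "proper_map euclidean euclidean (grad (\<lambda>x. h (x, 0)))"
        unfolding h0 by (rule almost_simple_gf_slice[OF assms(6)])+
      show "bounded_linear T" unfolding T_def by (intro linear_intros)
      show "bounded_linear T'" unfolding T'_def by (intro linear_intros)
      show "h differentiable (at z)" for z
      proof -
        have "(\<lambda>z. F1 (fst (fst z) + snd z, fst (snd (fst z)))) differentiable (at z)"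
          by (rule differentiable_compose_linear[OF _ smooth_differentiable[OF assms(1)]]) (intro linear_intros)
        moreover have "(\<lambda>z. F2 (fst (fst z), snd (snd (fst z)))) differentiable (at z)"
          by (rule differentiable_compose_linear[OF _ smooth_differentiable[OF assms(2)]]) (intro linear_intros)
        moreover have "(\<lambda>z. q \<bullet> fst (fst z)) differentiable (at z)"
          by (intro bounded_linear_imp_differentiable bounded_linear_inner_right_comp linear_intros)
        ultimately show ?thesis
          unfolding h_def by (intro differentiable_diff differentiable_add)
      qed
      show "T' (T z) = z" "T (T' y) = y" for z y by (simp_all add: T_def T'_def)
      show "gf_T1_box_T2 F1 F2 (q, T (V, x, u)) = V \<bullet> u + h (x, u)" for V x u
        by (cases x) (simp add: T_def h_def gf_T1_box_T2_def)
    qed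
    then show "selector (gf_T1_box_T2 F1 F2) q = selector (gf_T_1_plus_2 F1 F2) q"
      by (simp add: selector_def minmax_def h0)
  qed
qed

end
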